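(* Fix $t$ and let $P_{t+1}\in\mathbb{S}^n_{++}$, $S_{t+1}\in\mathbb{S}^n$ and $z_{t+1}\in\mathbb{R}$ be given. Define $r_t:\mathbb{S}^n_{++}\to\mathbb{R}$ by $$r_t(X)=\tfrac12\mathrm{Tr}\Big(S_{t+1}\big(AXA^\top-AXC^\top(CXC^\top+\hat V_t)^{-1}CXA^\top\big)\Big)$$ and let $$H_{t+1}(I_{t+1})=\mathbb{E}_{\mathbb{P}_{w_t}}\left[\tfrac12\big(x_{t+1}^\top P_{t+1}x_{t+1}+\xi_{t+1}^\top S_{t+1}\xi_{t+1}\big)\,\big|\,I_{t+1}\right]+z_{t+1}.$$ Consider the optimization problem $$H_t(I_t)=\inf_{u_t}\ \sup_{\mu_t,\,W_t\succ0}\ \mathbb{E}_{\mathbb{P}_{w_t}}\left[\tfrac12\big(x_t^\top Qx_t+u_t^\top Ru_t\big)+H_{t+1}(I_{t+1})-\tau_t\mathcal{R}_t\,\big|\,I_t,u_t\right],\qquad(\ast)$$ where $\mathbb{P}_{w_t}=\mathcal{N}(\mu_t,W_t)$ and the penalty parameter $\tau_t>0$ is fixed and satisfies $$\hat W_t^{-1}-\frac{P_{t+1}}{\tau_t}\succ0,\qquad \hat W_t^{-1}-\frac{P_{t+1}+S_{t+1}}{\tau_t}\succ0.$$ Then: (i) The optimal solutions of $(\ast)$ are $u_t^o=K_t^o\tilde x_t$ with $$K_t^o=-R^{-1}B^\top\Big(P_{t+1}^{-1}+BR^{-1}B^\top-\frac{\hat W_t}{\tau_t}\Big)^{-1}A,$$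 $$\mu_t^o=\Big[\Big(I-\frac{\hat W_tP_{t+1}}{\tau_t}\Big)^{-1}-I\Big](A\tilde x_t+Bu_t^o),\qquad W_t^o=\Big(\hat W_t^{-1}-\frac{P_{t+1}+S_{t+1}}{\tau_t}\Big)^{-1}.$$ (ii) The function $H_t(I_t)$ in $(\ast)$ is given by $$H_t(I_t)=\mathbb{E}\left[\tfrac12\big(x_t^\top P_tx_t+\xi_t^\top S_t\xi_t\big)\,\big|\,I_t\right]+z_t+r_t(\Sigma_t),$$ where $$P_t=Q+A^\top\Big(P_{t+1}^{-1}+BR^{-1}B^\top-\frac{\hat W_t}{\tau_t}\Big)^{-1}A,\qquad S_t=Q+A^\top P_{t+1}A-P_t,$$ $$z_t=z_{t+1}-\frac{\tau_t}{2}\log\Big|I-\frac{\hat W_t(P_{t+1}+S_{t+1})}{\tau_t}\Big|.$$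
   Context: System: $x_{t+1}=Ax_t+Bu_t+w_t$, $y_t=Cx_t+v_t$, with state $x_t\in\mathbb{R}^n$, input $u_t\in\mathbb{R}^m$, output $y_t\in\mathbb{R}^p$. The exogenous random vectors (initial state $x_0$, process noises $w_t$, measurement noises $v_t$) are assumed mutually independent. The distributions of $x_0\sim\mathcal{N}(0,\hat W_{-1})$, $\hat W_{-1}\succ0$, and of $v_t\sim\mathcal{N}(0,\hat V_t)$, $\hat V_t\succ0$, are known; only the distribution of the process noise is ambiguous, with nominal distribution $\hat{\mathbb{P}}_{w_t}=\mathcal{N}(0,\hat W_t)$, $\hat W_t\succ0$. Weights: $Q\in\mathbb{S}^n_+$ and $R\in\mathbb{S}^m_{++}$. Here $\mathbb{S}^n$, $\mathbb{S}^n_+$, $\mathbb{S}^n_{++}$ denote the symmetric, positive semidefinite and positive definite $n\times n$ matrices, and $|M|$ the determinant of a matrix $M$. Information vector: $I_t=(y_0,\dots,y_t,u_0,\dots,u_{t-1})$ with $I_0=y_0$, updated by $I_{t+1}=(I_t,y_{t+1},u_t)$. The controller chooses $u_t=\pi_t(I_t)$, and an adversary chooses the Gaussian distribution $\mathbb{P}_{w_t}=\mathcal{N}(\mu_t,W_t)$, $W_t\succ0$, of the process noise $w_t$ based on $I_t$ (in the inner supremum, for given $I_t$ and $u_t$). $\mathbb{E}_{\mathbb{P}_{w_t}}$ denotes expectation when the system evolves according to the process noise distribution selected by the adversary; the expectation in (ii) is over the state $x_t$ conditionally on $I_t$. Define $\tilde x_t=\mathbb{E}_{\mathbb{P}_{w_t}}[x_t\mid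 I_t]$, $\xi_t=x_t-\tilde x_t$ and $\Sigma_t=\mathbb{E}_{\mathbb{P}_{w_t}}[\xi_t\xi_t^\top\mid I_t]$, for $t\in\mathbb{N}$ (the matrix $\Sigma_t$ is called the prediction error covariance matrix of the state $x_t$). $\mathcal{R}_t$ denotes the Kullback–Leibler divergence from $\mathcal{N}(\mu_t,W_t)$ to the nominal distribution $\mathcal{N}(0,\hat W_t)$: $\mathcal{R}_t=\frac12\big(\mu_t^\top\hat W_t^{-1}\mu_t+\mathrm{Tr}(\hat W_t^{-1}W_t)-n+\ln\frac{|\hat W_t|}{|W_t|}\big)$.
   Formalization: The information vector is taken as I_t = (y_0,…,y_{t-1},u_0,…,u_{t-1}), without y_t (I_0 empty, I_{t+1} = (I_t,y_t,u_t)), so x̃_t and Σ_t are one-step predictions; with y_t included, part (i) fails, e.g. in the scalar case with S_{t+1} ≠ 0. *)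

theory Defs
  imports "HOL-Probability.Probability"
begin

definition pos_semidef :: "real^'n^'n \<Rightarrow> bool" where
  "pos_semidef M \<longleftrightarrow> transpose M = M \<and> (\<forall>x. 0 \<le> x \<bullet> (M *v x))"

definition pos_def :: "real^'n^'n \<Rightarrow> bool" where
  "pos_def M \<longleftrightarrow> transpose M = M \<and> (\<forall>x. x \<noteq> 0 \<longrightarrow> 0 < x \<bullet> (M *v x))"

definition outer :: "real^'n \<Rightarrow> real^'n \<Rightarrow> real^'n^'n" where
  "outer x y = (\<chi> i j. x $ i * y $ j)"

text \<open>Only meaningful for a positive definite covariance matrix.\<close>

definition gauss_density :: "real^'n \<Rightarrow> real^'n^'n \<Rightarrow> real^'n \<Rightarrow> real" where
  "gauss_density m S x =
     exp (- ((x - m) \<bullet> (matrix_inv S *v (x - m))) / 2) / sqrt ((2 * pi) ^ CARD('n) * det S)"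

definition gauss :: "real^'n \<Rightarrow> real^'n^'n \<Rightarrow> (real^'n) measure" where
  "gauss m S = density lborel (\<lambda>x. ennreal (gauss_density m S x))"

text \<open>
  The information vector at time \<open>t\<close> is the family of pairs (measurement, input) with indices
  \<open>s < t\<close>. The measurement of time \<open>t\<close> itself is not yet part of it, so that conditioning the
  state of time \<open>t\<close> on it gives the one-step-ahead prediction and the prediction error covariance,
  which at time \<open>0\<close> are the mean and the covariance of the initial state.
\<close>

type_synonym ('p, 'm) info = "nat \<Rightarrow> (real^'p) \<times> (real^'m)"

definition info_algebra :: "nat \<Rightarrow> ('p::finite, 'm::finite) info measure" where
  "info_algebra t = PiM {..<t} (\<lambda>_. borel)"

definition next_info ::
  "real^'n^'p \<Rightarrow> nat \<Rightarrow> ('p, 'm) info \<Rightarrow> real^'m \<Rightarrow> real^'n \<Rightarrow> real^'p \<Rightarrow> ('p, 'm) info" where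
  "next_info C t \<iota> u x v = \<iota>(t := (C *v x + v, u))"

definition next_state ::
  "real^'n^'n \<Rightarrow> real^'m^'n \<Rightarrow> real^'m \<Rightarrow> real^'n \<Rightarrow> real^'n \<Rightarrow> real^'n" where
  "next_state A B u x w = A *v x + B *v u + w"

text \<open>
  Joint law of the information vector and the state at time \<open>t\<close>, when the inputs are chosen by the
  policies \<open>\<pi> s\<close> and the process noise laws by the adversary policies \<open>\<mu> s\<close>, \<open>W s\<close>, all being
  functions of the information vector. Drawing every noise freshly at each step expresses the
  mutual independence of the exogenous random vectors.
\<close>

primrec system_law ::
  "real^'n^'n \<Rightarrow> real^'m^'n \<Rightarrow> real^'n^'p \<Rightarrow> real^'n^'n \<Rightarrow> (nat \<Rightarrow> real^'p^'p)
    \<Rightarrow> (nat \<Rightarrow> ('p::finite, 'm::finite) info \<Rightarrow> real^'m)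
    \<Rightarrow> (nat \<Rightarrow> ('p, 'm) info \<Rightarrow> real^'n) \<Rightarrow> (nat \<Rightarrow> ('p, 'm) info \<Rightarrow> real^'n^'n)
    \<Rightarrow> nat \<Rightarrow> (('p, 'm) info \<times> (real^'n::finite)) measure" where
  "system_law A B C X0 V \<pi> \<mu> W 0 =
     distr (gauss 0 X0) (info_algebra 0 \<Otimes>\<^sub>M borel) (\<lambda>x. (\<lambda>_. undefined, x))"
| "system_law A B C X0 V \<pi> \<mu> W (Suc s) =
     bind (system_law A B C X0 V \<pi> \<mu> W s) (\<lambda>(\<iota>, x).
       distr (gauss 0 (V s) \<Otimes>\<^sub>M gauss (\<mu> s \<iota>) (W s \<iota>)) (info_algebra (Suc s) \<Otimes>\<^sub>M borel)
         (\<lambda>(v, w). (next_info C s \<iota> (\<pi> s \<iota>) x v, next_state A B (\<pi> s \<iota>) x w)))"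

definition regular_cond_law ::
  "('a \<times> 'b) measure \<Rightarrow> 'a measure \<Rightarrow> 'b measure \<Rightarrow> ('a \<Rightarrow> 'b measure) \<Rightarrow> bool" where
  "regular_cond_law L I X \<kappa> \<longleftrightarrow>
     \<kappa> \<in> measurable I (prob_algebra X) \<and>
     (\<forall>E\<in>sets I. \<forall>D\<in>sets X.
        emeasure L (E \<times> D) = (\<integral>\<^sup>+\<iota>. indicator E \<iota> * emeasure (\<kappa> \<iota>) D \<partial>distr L I fst))"

definition mean :: "(real^'n) measure \<Rightarrow> real^'n" where
  "mean K = (\<integral>x. x \<partial>K)"

definition covariance :: "(real^'n) measure \<Rightarrow> real^'n^'n" where
  "covariance K = (\<integral>x. outer (x - mean K) (x - mean K) \<partial>K)"

definition vec_cond_exp :: "'a measure \<Rightarrow> 'a measure \<Rightarrow> ('a \<Rightarrow> real^'n) \<Rightarrow> 'a \<Rightarrow> real^'n" where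
  "vec_cond_exp N F f = (\<lambda>\<omega>. \<chi> i. real_cond_exp N F (\<lambda>\<omega>. f \<omega> $ i) \<omega>)"

text \<open>
  The value function of time \<open>t + 1\<close> as a random variable: \<open>F\<close> is the sigma-algebra generated by
  the information vector of time \<open>t + 1\<close>, and \<open>X\<close> is the state of time \<open>t + 1\<close>.
\<close>

definition next_value ::
  "real^'n^'n \<Rightarrow> real^'n^'n \<Rightarrow> real \<Rightarrow> 'a measure \<Rightarrow> 'a measure \<Rightarrow> ('a \<Rightarrow> real^'n) \<Rightarrow> 'a \<Rightarrow> real" where
  "next_value P S z N F X =
     (let \<xi> = (\<lambda>\<omega>. X \<omega> - vec_cond_exp N F X \<omega>) in
      (\<lambda>\<omega>. real_cond_exp N F (\<lambda>\<omega>. 1/2 * (X \<omega> \<bullet> (P *v X \<omega>) + \<xi> \<omega> \<bullet> (S *v \<xi> \<omega>))) \<omega> + z))"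

text \<open>
  The objective of the stage problem at time \<open>t\<close>. Here \<open>K\<close> is the conditional law of the state
  given that the information vector is \<open>\<iota>\<close>, so that \<open>N\<close> is the conditional law of
  (state, measurement noise, process noise) given \<open>\<iota>\<close> and the input \<open>u\<close>. For positive definite
  \<open>W\<close> and \<open>What\<close>, the divergence equals
  \<open>(\<mu> \<bullet> (matrix_inv What *v \<mu>) + trace (matrix_inv What ** W) - n + ln (det What / det W)) / 2\<close>.
\<close>

definition stage_objective ::
  "real^'n^'n \<Rightarrow> real^'m^'n \<Rightarrow> real^'n^'p \<Rightarrow> real^'n^'n \<Rightarrow> real^'m^'m
    \<Rightarrow> real^'n^'n \<Rightarrow> real^'n^'n \<Rightarrow> real \<Rightarrow> real \<Rightarrow> real^'p^'p \<Rightarrow> real^'n^'n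
    \<Rightarrow> nat \<Rightarrow> ('p::finite, 'm::finite) info \<Rightarrow> (real^'n::finite) measure
    \<Rightarrow> real^'m \<Rightarrow> real^'n \<Rightarrow> real^'n^'n \<Rightarrow> real" where
  "stage_objective A B C Q R P S z \<tau> V What t \<iota> K u \<mu> W =
     (let N = K \<Otimes>\<^sub>M gauss 0 V \<Otimes>\<^sub>M gauss \<mu> W;
          X' = (\<lambda>(x, v, w). next_state A B u x w);
          I' = (\<lambda>(x, v, w). next_info C t \<iota> u x v);
          F = vimage_algebra (space N) I' (info_algebra (Suc t));
          H' = next_value P S z N F X'
      in \<integral>\<omega>. 1/2 * (fst \<omega> \<bullet> (Q *v fst \<omega>) + u \<bullet> (R *v u)) + H' \<omega>
             - \<tau> * KL_divergence (exp 1) (gauss 0 What) (gauss \<mu> W) \<partial>N)"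

definition riccati_r ::
  "real^'n^'n \<Rightarrow> real^'n^'p \<Rightarrow> real^'p^'p \<Rightarrow> real^'n^'n \<Rightarrow> real^'n^'n \<Rightarrow> real" where
  "riccati_r A C V S X =
     1/2 * trace (S ** (A ** X ** transpose A
       - A ** X ** transpose C ** matrix_inv (C ** X ** transpose C + V) ** C ** X ** transpose A))"

end

theory Submission
  imports Defs
begin

text \<open>
  Completing squares shows that the joint density of a Gaussian state \<open>x\<close> and its noisy
  observation \<open>y = C x + v\<close> factors into a density in \<open>y\<close> and one in the estimation error. Hence
  \<open>y\<close> and the error are independent Gaussians; by induction on time, the conditional law of the
  state given the information vector is almost surely Gaussian, and conditional expectations given
  the next information vector become explicit. The stage objective is therefore a deterministic
  function of input, noise mean and noise covariance which splits into three independent penalties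
  around the saddle point: a quadratic in the input, a quadratic in the noise mean, and a
  Kullback--Leibler divergence in the noise covariance.
\<close>

section \<open>Positive definite matrices\<close>

text \<open>Two obstacles shape the proof. The conditional law \<open>\<kappa>\<close> is an
  arbitrary version, so nothing about it holds pointwise; once it is identified almost surely with a
  Gaussian, the stage problem sees it only through its mean and covariance. And the next value
  function is a conditional expectation; since the objective integrates it against the same law, the
  outer conditioning disappears by the tower property, and only the inner one, which defines the
  next prediction error, has to be computed. The splitting rests on that error: its law involves
  neither the input nor the noise mean, and its covariance depends on the noise covariance
  additively. Hence the first bound on \<open>\<tau>\<close> governs the noise mean and, through the
  value left after maximising over it, the input; the second governs the noise covariance. A linear
  cost in the covariance can be absorbed into a divergence from a tilted Gaussian, so optimality and
  uniqueness of the covariance follow from Gibbs' inequality without differentiating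
  determinants.\<close>

lemma inner_matrix_vector_mult: "(A *v x) \<bullet> y = x \<bullet> (transpose A *v y)"
  for A :: "real^'n^'m"
  by (metis dot_lmul_matrix inner_commute transpose_matrix_vector)

lemma inner_symmetric_matrix: "transpose M = M \<Longrightarrow> (M *v x) \<bullet> y = x \<bullet> (M *v y)"
  for M :: "real^'n^'n"
  by (metis inner_matrix_vector_mult)

lemma matrix_inv:
  assumes "invertible A"
  shows "A ** matrix_inv A = mat 1" "matrix_inv A ** A = mat 1"
  using someI_ex[OF assms[unfolded invertible_def]] by (auto simp: matrix_inv_def)

lemma matrix_inv_vector:
  assumes "invertible A"
  shows "A *v (matrix_inv A *v x) = x" "matrix_inv A *v (A *v x) = x"
  using matrix_inv[OF assms] by (simp_all add: matrix_vector_mul_assoc)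

lemma matrix_inv_unique:
  fixes A B :: "real^'n^'n"
  assumes "A ** B = mat 1"
  shows "matrix_inv A = B" and "invertible A"
proof -
  show inv: "invertible A"
    using assms invertible_right_inverse by blast
  show "matrix_inv A = B"
    by (metis assms inv matrix_inv(2) matrix_mul_assoc matrix_mul_lid matrix_mul_rid)
qed

lemma transpose_add: "transpose (A + B) = transpose A + transpose B"
  and transpose_diff: "transpose (C - D) = transpose C - transpose D"
  by (simp_all add: transpose_def vec_eq_iff)

lemma pos_defD:
  assumes "pos_def M"
  shows "transpose M = M" and "x \<noteq> 0 \<Longrightarrow> 0 < x \<bullet> (M *v x)" and "0 \<le> x \<bullet> (M *v x)"
  using assms by (cases "x = 0"; auto simp: pos_def_def less_imp_le)+

lemma pos_def_invertible: "pos_def M \<Longrightarrow> invertible M"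
  unfolding invertible_left_inverse matrix_left_invertible_ker
  by (metis inner_zero_right less_irrefl pos_defD(2))

lemma transpose_matrix_inv:
  fixes M :: "real^'n^'n"
  assumes "transpose M = M" "invertible M"
  shows "transpose (matrix_inv M) = matrix_inv M"
  by (metis assms matrix_inv(1) matrix_inv_unique(1) matrix_inv(2) matrix_transpose_mul transpose_mat)

lemma pos_def_matrix_inv:
  assumes "pos_def M"
  shows "pos_def (matrix_inv M)"
  unfolding pos_def_def
proof (intro conjI allI impI)
  note inv = pos_def_invertible[OF assms]
  show "transpose (matrix_inv M) = matrix_inv M"
    by (rule transpose_matrix_inv[OF pos_defD(1)[OF assms] inv])
  fix x :: "real^'a" assume "x \<noteq> 0"
  then have "matrix_inv M *v x \<noteq> 0"
    by (metis inv matrix_inv_vector(1) matrix_vector_mult_0_right)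
  from pos_defD(2)[OF assms this] show "0 < x \<bullet> (matrix_inv M *v x)"
    by (simp add: matrix_inv_vector[OF inv] inner_commute)
qed

lemma matrix_inv_matrix_inv: "invertible M \<Longrightarrow> matrix_inv (matrix_inv M) = M"
  for M :: "real^'n^'n"
  by (metis matrix_inv(2) matrix_inv_unique(1))

text \<open>\<open>C\<close> may be rectangular or singular, so the first summand is only
  semidefinite and \<open>V\<close> supplies strictness. Innovation covariances, predicted
  covariances, the posterior precision and the controller's matrix all have this shape.\<close>

lemma pos_def_congruence_add:
  fixes S :: "real^'n^'n" and C :: "real^'n^'p"
  assumes "pos_def S" "pos_def V"
  shows "pos_def (C ** S ** transpose C + V)"
  unfolding pos_def_def
proof (intro conjI allI impI)
  show "transpose (C ** S ** transpose C + V) = C ** S ** transpose C + V"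
    using pos_defD(1)[OF assms(1)] pos_defD(1)[OF assms(2)]
    by (simp add: transpose_add matrix_transpose_mul matrix_mul_assoc)
  fix x :: "real^'p" assume "x \<noteq> 0"
  have "x \<bullet> ((C ** S ** transpose C) *v x) = (transpose C *v x) \<bullet> (S *v (transpose C *v x))"
    by (subst inner_matrix_vector_mult)
      (simp add: matrix_vector_mul_assoc[symmetric] del: transpose_matrix_vector)
  moreover have "0 \<le> (transpose C *v x) \<bullet> (S *v (transpose C *v x))"
    by (rule pos_defD(3)[OF assms(1)])
  ultimately show "0 < x \<bullet> ((C ** S ** transpose C + V) *v x)"
    using pos_defD(2)[OF assms(2) \<open>x \<noteq> 0\<close>]
    by (simp add: matrix_vector_mult_add_rdistrib inner_add_right)
qed

text \<open>Gram--Schmidt orthonormalisation for the inner product \<open>x \<bullet> (S *v y)\<close>.\<close>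

lemma pos_def_orthonormal_family:
  fixes S :: "real^'n^'n"
  assumes S: "pos_def S"
  shows "k \<le> CARD('n) \<Longrightarrow> \<exists>B. finite B \<and> card B = k \<and>
    (\<forall>x\<in>B. \<forall>y\<in>B. x \<bullet> (S *v y) = of_bool (x = y))"
proof (induction k)
  case (Suc k)
  then obtain B where B: "finite B" "card B = k"
    and orth: "\<And>x y. x \<in> B \<Longrightarrow> y \<in> B \<Longrightarrow> x \<bullet> (S *v y) = of_bool (x = y)"
    by auto
  \<comment> \<open>Fewer vectors than the dimension cannot span, so some \<open>z\<close> lies
    outside; this keeps \<open>y\<close> below nonzero after the projections are removed.\<close>
  have "span B \<noteq> UNIV"
  proof
    assume "span B = UNIV"
    then have "dim (UNIV :: (real^'n) set) \<le> card B"
      using B(1) by (intro dim_le_card) auto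
    then show False
      using Suc.prems B(2) by simp
  qed
  then obtain z where z: "z \<notin> span B" by auto
  define y where "y = z - (\<Sum>b\<in>B. (b \<bullet> (S *v z)) *\<^sub>R b)"
  have sum_in: "(\<Sum>b\<in>B. (b \<bullet> (S *v z)) *\<^sub>R b) \<in> span B"
    by (intro span_sum span_scale span_base)
  have "y \<noteq> 0"
    using sum_in z unfolding y_def by auto
  have y_orth: "b \<bullet> (S *v y) = 0" if "b \<in> B" for b
  proof -
    have "b \<bullet> (S *v (\<Sum>c\<in>B. (c \<bullet> (S *v z)) *\<^sub>R c)) = (\<Sum>c\<in>B. (c \<bullet> (S *v z)) * (b \<bullet> (S *v c)))"
      by (simp add: linear_sum[OF matrix_vector_mul_linear] inner_sum_right
          matrix_vector_mult_scaleR)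
    also have "\<dots> = (\<Sum>c\<in>B. if c = b then b \<bullet> (S *v z) else 0)"
      using that by (intro sum.cong) (auto simp: orth)
    finally show ?thesis
      using B(1) that by (simp add: y_def matrix_vector_mult_diff_distrib inner_diff_right)
  qed
  define q where "q = y \<bullet> (S *v y)"
  define w where "w = (1 / sqrt q) *\<^sub>R y"
  have "q > 0"
    unfolding q_def by (rule pos_defD(2)[OF S \<open>y \<noteq> 0\<close>])
  have ww: "w \<bullet> (S *v w) = 1"
    using \<open>q > 0\<close> unfolding w_def by (simp add: matrix_vector_mult_scaleR q_def[symmetric])
  have bw: "b \<bullet> (S *v w) = 0" "w \<bullet> (S *v b) = 0" if "b \<in> B" for b
  proof -
    show "b \<bullet> (S *v w) = 0"
      unfolding w_def using y_orth[OF that] by (simp add: matrix_vector_mult_scaleR)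
    then show "w \<bullet> (S *v b) = 0"
      by (metis inner_commute inner_symmetric_matrix pos_defD(1)[OF S])
  qed
  have "w \<notin> B"
    using bw ww by force
  then show ?case
    using B bw ww orth by (intro exI[of _ "insert w B"]) auto
qed auto

text \<open>If the columns of \<open>E\<close> are orthonormal for the form of \<open>S\<close>,
  then \<open>transpose E ** S ** E\<close> is the identity, so the inverse transpose of
  \<open>E\<close> is a square root of \<open>S\<close>. It will carry the standard Gaussian to the
  one with covariance \<open>S\<close>.\<close>

lemma pos_def_factor:
  fixes S :: "real^'n^'n"
  assumes S: "pos_def S"
  obtains L :: "real^'n^'n" where "invertible L" "S = L ** transpose L"
proof -
  obtain B where B: "finite B" "card B = CARD('n)"
    and orth: "\<And>x y. x \<in> B \<Longrightarrow> y \<in> B \<Longrightarrow> x \<bullet> (S *v y) = of_bool (x = y)"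
    using pos_def_orthonormal_family[OF S order_refl] by auto
  obtain f :: "'n \<Rightarrow> real^'n" where f: "bij_betw f UNIV B"
    using B finite_same_card_bij[of "UNIV :: 'n set" B] by auto
  define E where "E = (\<chi> i j. f j $ i)"
  have col: "column j E = f j" for j
    by (simp add: E_def column_def vec_eq_iff)
  have Sf: "(S ** E) $ k $ j = (S *v f j) $ k" for k j
    by (simp add: E_def matrix_matrix_mult_def matrix_vector_mult_def)
  have "(transpose E ** (S ** E)) $ i $ j = (mat 1 :: real^'n^'n) $ i $ j" for i j
  proof -
    have "(transpose E ** (S ** E)) $ i $ j = f i \<bullet> (S *v f j)"
      unfolding matrix_matrix_mult_def[of "transpose E"] inner_vec_def
      by (simp add: Sf) (simp add: transpose_def E_def)
    also have "\<dots> = of_bool (f i = f j)"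
      using f by (intro orth) (auto simp: bij_betw_def)
    also have "\<dots> = (mat 1 :: real^'n^'n) $ i $ j"
      using f by (auto simp: bij_betw_def mat_def inj_on_def)
    finally show ?thesis .
  qed
  then have E: "transpose E ** (S ** E) = mat 1"
    by (simp add: vec_eq_iff)
  have inv: "invertible E"
    using E by (metis invertible_left_inverse matrix_mul_assoc)
  let ?L = "transpose (matrix_inv E)"
  have "S = ?L ** (transpose E ** (S ** E)) ** matrix_inv E"
    by (metis inv matrix_inv(1) matrix_mul_assoc matrix_mul_lid matrix_mul_rid
        matrix_transpose_mul transpose_mat)
  then have "S = ?L ** transpose ?L"
    by (simp add: E)
  moreover have "invertible ?L"
    by (metis inv invertible_def matrix_inv transpose_invertible)
  ultimately show ?thesis
    by (rule that[rotated])
qed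

lemma pos_def_det: "pos_def S \<Longrightarrow> 0 < det S"
  by (metis det_mul det_transpose invertible_det_nz not_real_square_gt_zero pos_def_factor)

section \<open>Linear changes of variables\<close>

lemma borel_measurable_vec_iff:
  fixes f :: "'a \<Rightarrow> 'b::euclidean_space^'n"
  shows "f \<in> borel_measurable M \<longleftrightarrow> (\<forall>i. (\<lambda>x. f x $ i) \<in> borel_measurable M)"
  by (subst (1 2) borel_measurable_euclidean_space) (auto simp: Basis_vec_def inner_axis)

lemma borel_measurable_vec_nth [measurable (raw)]:
  fixes f :: "'a \<Rightarrow> 'b::euclidean_space^'n"
  shows "f \<in> borel_measurable M \<Longrightarrow> (\<lambda>x. f x $ i) \<in> borel_measurable M"
  by (simp add: borel_measurable_vec_iff)

lemma borel_measurable_vec_lambda [measurable (raw)]: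
  fixes f :: "'a \<Rightarrow> 'n::finite \<Rightarrow> 'b::euclidean_space"
  assumes "\<And>i. (\<lambda>x. f x i) \<in> borel_measurable M"
  shows "(\<lambda>x. \<chi> i. f x i) \<in> borel_measurable M"
  by (simp add: borel_measurable_vec_iff assms)

lemma borel_measurable_matrix_vector_mult [measurable (raw)]:
  fixes f :: "'a \<Rightarrow> real^'n" and A :: "'a \<Rightarrow> real^'n^'m"
  assumes [measurable]: "A \<in> borel_measurable M" "f \<in> borel_measurable M"
  shows "(\<lambda>x. A x *v f x) \<in> borel_measurable M"
  unfolding matrix_vector_mult_def by measurable

lemma borel_measurable_matrix_matrix_mult [measurable (raw)]:
  fixes A :: "'a \<Rightarrow> real^'n^'m" and B :: "'a \<Rightarrow> real^'k^'n"
  assumes [measurable]: "A \<in> borel_measurable M" "B \<in> borel_measurable M"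
  shows "(\<lambda>x. A x ** B x) \<in> borel_measurable M"
  unfolding matrix_matrix_mult_def by measurable

lemma borel_measurable_det [measurable (raw)]:
  fixes A :: "'a \<Rightarrow> real^'n^'n"
  assumes [measurable]: "A \<in> borel_measurable M"
  shows "(\<lambda>x. det (A x)) \<in> borel_measurable M"
  unfolding det_def by measurable

text \<open>Cramer's rule writes every entry of the inverse as a quotient of determinants. The
  adversary's covariances, and with them the prediction covariances, vary with the information
  vector, so their inverses must be measurable in it.\<close>

lemma borel_measurable_matrix_inv:
  fixes A :: "'a \<Rightarrow> real^'n^'n"
  assumes A[measurable]: "A \<in> borel_measurable M"
    and inv: "\<And>x. x \<in> space M \<Longrightarrow> invertible (A x)"
  shows "(\<lambda>x. matrix_inv (A x)) \<in> borel_measurable M"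
proof -
  have "matrix_inv (A x) = (\<chi> k l. det (\<chi> i j. if j = k then axis l 1 $ i else A x $ i $ j) / det (A x))"
    if "x \<in> space M" for x
  proof -
    have "det (A x) \<noteq> 0"
      using inv[OF that] invertible_det_nz by blast
    then have "matrix_inv (A x) *v axis l 1 =
      (\<chi> k. det (\<chi> i j. if j = k then axis l 1 $ i else A x $ i $ j) / det (A x))" for l
      using cramer[of "A x"] matrix_inv_vector(1)[OF inv[OF that]] by blast
    then show ?thesis
      by (simp add: vec_eq_iff matrix_vector_mult_basis column_def)
  qed
  moreover have "(\<lambda>x. \<chi> k l. det (\<chi> i j. if j = k then axis l 1 $ i else A x $ i $ j) / det (A x))
    \<in> borel_measurable M"
    by measurable
  ultimately show ?thesis
    by (simp cong: measurable_cong)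
qed

section \<open>Lebesgue measure on vectors and its behaviour under linear maps\<close>

lemma prod_Basis_vec: "(\<Prod>b\<in>Basis. g b) = (\<Prod>i\<in>UNIV. g (axis i (1::real)))"
  for g :: "real^'n \<Rightarrow> 'a::comm_monoid_mult"
proof -
  have "(Basis :: (real^'n) set) = range (\<lambda>i. axis i 1)"
    by (auto simp: Basis_vec_def)
  moreover have "inj (\<lambda>i::'n. axis i (1::real))"
    by (auto simp: inj_on_def axis_eq_axis)
  ultimately show ?thesis
    using prod.reindex[of "\<lambda>i. axis i 1" UNIV g] by (simp only: comp_def)
qed

text \<open>A Borel measure that agrees with volume on boxes is Lebesgue measure. The product form
  makes single coordinates available for Fubini arguments and product densities.\<close>

lemma lborel_vec_eq:
  "(lborel :: (real^'n) measure) = distr (\<Pi>\<^sub>M i\<in>UNIV. lborel) borel vec_lambda"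
proof (rule lborel_eqI)
  have m: "vec_lambda \<in> (\<Pi>\<^sub>M i\<in>UNIV. lborel) \<rightarrow>\<^sub>M (borel :: (real^'n) measure)"
    by (auto simp: borel_measurable_vec_iff)
  fix l u :: "real^'n"
  assume lu: "\<And>b. b \<in> Basis \<Longrightarrow> l \<bullet> b \<le> u \<bullet> b"
  interpret product_sigma_finite "\<lambda>_::'n. lborel :: real measure" ..
  have le: "l $ i \<le> u $ i" for i
    using lu[of "axis i 1"] by (simp add: inner_axis)
  have "emeasure (distr (\<Pi>\<^sub>M i\<in>UNIV. lborel) borel vec_lambda) (box l u)
      = emeasure (\<Pi>\<^sub>M i\<in>UNIV. lborel) (\<Pi>\<^sub>E i\<in>UNIV. {l $ i<..<u $ i})"
    using m by (subst emeasure_distr)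
      (auto simp: space_PiM box_def Basis_vec_def inner_axis PiE_def Pi_def
        intro!: arg_cong[where f="emeasure _"])
  also have "\<dots> = (\<Prod>i\<in>UNIV. ennreal (u $ i - l $ i))"
    by (subst emeasure_PiM) (auto simp: le)
  also have "\<dots> = ennreal (\<Prod>i\<in>UNIV. u $ i - l $ i)"
    by (rule prod_ennreal) (simp add: le)
  also have "(\<Prod>i\<in>UNIV. u $ i - l $ i) = (\<Prod>b\<in>Basis. (u - l) \<bullet> b)"
    by (simp add: prod_Basis_vec inner_axis)
  finally show "emeasure (distr (\<Pi>\<^sub>M i\<in>UNIV. lborel) borel vec_lambda) (box l u) =
    (\<Prod>b\<in>Basis. (u - l) \<bullet> b)" .
qed simp

lemma nn_integral_lborel_add:
  fixes f :: "'a::euclidean_space \<Rightarrow> ennreal"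
  assumes [measurable]: "f \<in> borel_measurable borel"
  shows "(\<integral>\<^sup>+x. f (x + c) \<partial>lborel) = (\<integral>\<^sup>+x. f x \<partial>lborel)"
  by (subst lborel_distr_plus[of c, symmetric]) (simp add: nn_integral_distr add.commute)

text \<open>Singles out coordinate \<open>m\<close> as the innermost integral, as the shear case of
  the change of variables requires.\<close>

lemma nn_integral_lborel_vec_insert:
  fixes f :: "real^'n \<Rightarrow> ennreal"
  assumes [measurable]: "f \<in> borel_measurable borel"
  shows "(\<integral>\<^sup>+x. f x \<partial>lborel) =
    (\<integral>\<^sup>+x. (\<integral>\<^sup>+y. f (vec_lambda (x(m := y))) \<partial>lborel) \<partial>(\<Pi>\<^sub>M i\<in>UNIV - {m}. lborel))"
proof -
  interpret product_sigma_finite "\<lambda>_::'n. lborel :: real measure" ..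
  have [measurable]: "vec_lambda \<in> (\<Pi>\<^sub>M i\<in>UNIV. lborel) \<rightarrow>\<^sub>M (borel :: (real^'n) measure)"
    by (auto simp: borel_measurable_vec_iff)
  have U: "insert m (UNIV - {m}) = UNIV" by auto
  show ?thesis
    using product_nn_integral_insert[of "UNIV - {m}" m "\<lambda>x. f (vec_lambda x)"]
    by (subst lborel_vec_eq) (simp add: nn_integral_distr U)
qed

text \<open>HOL-Analysis has this change of variables only for index types of class wellorder.\<close>

lemma nn_integral_linear_change:
  fixes A :: "real^'n^'n"
  assumes "det A \<noteq> 0" "f \<in> borel_measurable borel"
  shows "(\<integral>\<^sup>+x. f (A *v x) \<partial>lborel) * ennreal \<bar>det A\<bar> = (\<integral>\<^sup>+x. f x \<partial>lborel)"
proof -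
  \<comment> \<open>\<open>f\<close> is quantified inside the induction: in the product case the
    hypothesis for the right factor is applied to \<open>f\<close> composed with the left
    factor.\<close>
  have "\<forall>f\<in>borel_measurable borel. det A \<noteq> 0 \<longrightarrow>
    (\<integral>\<^sup>+x. f (A *v x) \<partial>lborel) * ennreal \<bar>det A\<bar> = (\<integral>\<^sup>+x. f x \<partial>lborel)"
  proof (induction A rule: induct_matrix_elementary)
    case (1 A B)
    show ?case
    proof (intro ballI impI)
      fix f :: "real^'n \<Rightarrow> ennreal"
      assume f[measurable]: "f \<in> borel_measurable borel" and "det (A ** B) \<noteq> 0"
      then have d: "det A \<noteq> 0" "det B \<noteq> 0" by (auto simp: det_mul)
      have "(\<integral>\<^sup>+x. f ((A ** B) *v x) \<partial>lborel) * ennreal \<bar>det (A ** B)\<bar>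
        = (\<integral>\<^sup>+x. f (A *v (B *v x)) \<partial>lborel) * ennreal \<bar>det B\<bar> * ennreal \<bar>det A\<bar>"
        by (simp add: matrix_vector_mul_assoc det_mul abs_mult ennreal_mult mult_ac)
      also have "\<dots> = (\<integral>\<^sup>+x. f (A *v x) \<partial>lborel) * ennreal \<bar>det A\<bar>"
        using 1(2) d by (subst 1(2)[rule_format, of "\<lambda>x. f (A *v x)"]) auto
      also have "\<dots> = (\<integral>\<^sup>+x. f x \<partial>lborel)"
        using 1(1) d f by auto
      finally show "(\<integral>\<^sup>+x. f ((A ** B) *v x) \<partial>lborel) * ennreal \<bar>det (A ** B)\<bar>
        = (\<integral>\<^sup>+x. f x \<partial>lborel)" .
    qed
  next
    case (2 A i)
    then show ?case by (simp add: det_zero_row)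
  next
    case (3 A)
    show ?case
    proof (intro ballI impI)
      fix f :: "real^'n \<Rightarrow> ennreal"
      assume f[measurable]: "f \<in> borel_measurable borel" and "det A \<noteq> 0"
      have det: "det A = (\<Prod>i\<in>UNIV. A $ i $ i)"
        using 3 by (rule det_diagonal)
      have nz: "A $ i $ i \<noteq> 0" for i
        using \<open>det A \<noteq> 0\<close> by (simp add: det)
      \<comment> \<open>On standard basis vectors \<open>c\<close> gives the diagonal entries, as
        one scaling factor per basis direction.\<close>
      define c where "c b = b \<bullet> (A *v b)" for b
      have c: "c (axis i 1) = A $ i $ i" for i
        by (simp add: c_def inner_axis' matrix_vector_mult_basis column_def)
      have T: "(\<Sum>j\<in>Basis. (c j * (x \<bullet> j)) *\<^sub>R j) = A *v x" for x
      proof -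
        have "(\<Sum>j\<in>Basis. (c j * (x \<bullet> j)) *\<^sub>R j) \<bullet> b = (A *v x) \<bullet> b" if "b \<in> Basis" for b
        proof -
          obtain i where i: "b = axis i 1" using \<open>b \<in> Basis\<close> by (auto simp: Basis_vec_def)
          have "(A *v x) $ i = A $ i $ i * x $ i"
            using 3 unfolding matrix_vector_mult_def
            by simp (subst sum.remove[of _ i]; auto intro!: sum.neutral)
          moreover have "b' = axis i 1" if "b' \<in> Basis" "b' $ i \<noteq> 0" for b' :: "real^'n"
            using that by (auto simp: Basis_vec_def axis_def split: if_splits)
          ultimately show ?thesis
            using that unfolding inner_sum_left
            by (subst sum.remove[of _ b])
              (auto simp: i c inner_axis inner_Basis intro!: sum.neutral)
        qed
        then show ?thesis by (rule euclidean_eqI)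
      qed
      have "(\<integral>\<^sup>+x. f x \<partial>lborel) = (\<integral>\<^sup>+x. ennreal (\<Prod>j\<in>Basis. \<bar>c j\<bar>) * f (A *v x) \<partial>lborel)"
      proof (subst lborel_affine_euclidean[of c 0])
        show "c j \<noteq> 0" if "j \<in> Basis" for j
          using that nz c by (auto simp: Basis_vec_def)
      qed (simp_all add: T nn_integral_density nn_integral_distr)
      also have "(\<Prod>j\<in>Basis. \<bar>c j\<bar>) = \<bar>det A\<bar>"
        by (simp add: prod_Basis_vec c det abs_prod)
      finally show "(\<integral>\<^sup>+x. f (A *v x) \<partial>lborel) * ennreal \<bar>det A\<bar> = (\<integral>\<^sup>+x. f x \<partial>lborel)"
        by (simp add: nn_integral_cmult mult.commute)
    qed
  next
    case (4 m n)
    let ?A = "\<chi> i j. mat 1 $ i $ Transposition.transpose m n j :: real^'n^'n"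
    let ?s = "Transposition.transpose m n"
    have A: "?A *v x = (\<chi> i. x $ ?s i)" for x
    proof -
      have "(if i = ?s j then 1 else 0) * x $ j = (if j = ?s i then x $ j else 0)" for i j
        by (auto simp: transpose_involutory)
      then show ?thesis
        by (simp add: matrix_vector_mult_def vec_eq_iff mat_def)
    qed
    have det: "\<bar>det ?A\<bar> = 1"
      using det_permute_columns[of ?s "mat 1 :: real^'n^'n"] by (simp add: permutes_swap_id sign_def)
    \<comment> \<open>A transposition of coordinates maps boxes to boxes with permuted sides, so it
      preserves volume and hence Lebesgue measure.\<close>
    have "(lborel :: (real^'n) measure) = distr lborel borel ((*v) ?A)"
    proof (rule lborel_eqI)
      fix l u :: "real^'n"
      assume lu: "\<And>b. b \<in> Basis \<Longrightarrow> l \<bullet> b \<le> u \<bullet> b"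
      have le: "l $ i \<le> u $ i" for i
        using lu[of "axis i 1"] by (simp add: inner_axis)
      have "emeasure (distr lborel borel ((*v) ?A)) (box l u)
        = emeasure lborel ((*v) ?A -` box l u)"
        by (subst emeasure_distr) auto
      also have "(*v) ?A -` box l u = box (\<chi> i. l $ ?s i) (\<chi> i. u $ ?s i)"
        unfolding A by (auto simp: box_def Basis_vec_def inner_axis) (metis transpose_involutory)+
      also have "emeasure lborel \<dots> = ennreal (\<Prod>i\<in>UNIV. u $ ?s i - l $ ?s i)"
      proof (subst emeasure_lborel_box)
        show "(\<chi> i. l $ ?s i) \<bullet> b \<le> (\<chi> i. u $ ?s i) \<bullet> b" if "b \<in> Basis" for b
          using that by (auto simp: Basis_vec_def inner_axis le)
      qed (simp add: prod_Basis_vec inner_axis)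
      also have "(\<Prod>i\<in>UNIV. u $ ?s i - l $ ?s i) = (\<Prod>i\<in>UNIV. u $ i - l $ i)"
        by (rule prod.reindex_bij_betw[of ?s]) simp
      finally show "emeasure (distr lborel borel ((*v) ?A)) (box l u) = (\<Prod>b\<in>Basis. (u - l) \<bullet> b)"
        by (simp add: prod_Basis_vec inner_axis)
    qed simp
    then have "(\<integral>\<^sup>+x. f (?A *v x) \<partial>lborel) = (\<integral>\<^sup>+x. f x \<partial>lborel)"
      if "f \<in> borel_measurable borel" for f
      using that nn_integral_distr[of "(*v) ?A" lborel borel f] by simp
    then show ?case
      by (simp add: det)
  next
    case (5 m n c)
    let ?A = "\<chi> i j. if i = m \<and> j = n then c else of_bool (i = j) :: real^'n^'n"
    have A: "?A *v x = (\<chi> i. if i = m then x $ m + c * x $ n else x $ i)" for x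
    proof -
      have "(if i = m \<and> j = n then c else of_bool (i = j)) * x $ j
        = (if j = i then x $ j else 0) + (if j = n then if i = m then c * x $ n else 0 else 0)" for i j
        using 5 by auto
      then show ?thesis
        by (simp add: matrix_vector_mult_def vec_eq_iff sum.distrib)
    qed
    have "?A = (\<chi> k. if k = m then row m (mat 1) + c *s row n (mat 1) else row k (mat 1))"
      using 5 by (auto simp: vec_eq_iff row_def mat_def)
    then have det: "det ?A = 1"
      using det_row_operation[OF 5, of "mat 1 :: real^'n^'n" c] by simp
    have "(\<integral>\<^sup>+x. f (?A *v x) \<partial>lborel) = (\<integral>\<^sup>+x. f x \<partial>lborel)"
      if [measurable]: "f \<in> borel_measurable borel" for f
    proof -
      \<comment> \<open>The shear changes only coordinate \<open>m\<close>, by an amount that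
        depends on coordinate \<open>n\<close> alone. As \<open>m\<close> and \<open>n\<close>
        differ, the inner integral absorbs it as a translation.\<close>
      have "f (?A *v vec_lambda (x(m := y))) = f (vec_lambda (x(m := y + c * x n)))" for x y
        using 5 unfolding A by (auto intro!: arg_cong[where f=f] simp: vec_eq_iff)
      then have "(\<integral>\<^sup>+x. f (?A *v x) \<partial>lborel) =
        (\<integral>\<^sup>+x. (\<integral>\<^sup>+y. f (vec_lambda (x(m := y + c * x n))) \<partial>lborel) \<partial>(\<Pi>\<^sub>M i\<in>UNIV - {m}. lborel))"
        by (subst nn_integral_lborel_vec_insert[of _ m]) simp_all
      also have "\<dots> =
        (\<integral>\<^sup>+x. (\<integral>\<^sup>+y. f (vec_lambda (x(m := y))) \<partial>lborel) \<partial>(\<Pi>\<^sub>M i\<in>UNIV - {m}. lborel))"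
      proof (rule nn_integral_cong)
        fix x
        have [measurable]: "(\<lambda>y. f (vec_lambda (x(m := y)))) \<in> borel_measurable borel"
          by (rule measurable_compose[OF _ that])
            (auto simp: borel_measurable_vec_iff)
        show "(\<integral>\<^sup>+y. f (vec_lambda (x(m := y + c * x n))) \<partial>lborel)
          = (\<integral>\<^sup>+y. f (vec_lambda (x(m := y))) \<partial>lborel)"
          by (rule nn_integral_lborel_add) simp
      qed
      also have "\<dots> = (\<integral>\<^sup>+x. f x \<partial>lborel)"
        by (subst nn_integral_lborel_vec_insert[of _ m]) simp_all
      finally show ?thesis .
    qed
    then show ?case by (simp add: det)
  qed
  then show ?thesis using assms by blast
qed

section \<open>Gaussian measures\<close>

lemma integral_lborel_vec_prod:
  fixes g :: "'n::finite \<Rightarrow> real \<Rightarrow> real"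
  assumes g: "\<And>i. integrable lborel (g i)"
  shows "integrable lborel (\<lambda>x::real^'n. \<Prod>i\<in>UNIV. g i (x $ i))"
    and "(\<integral>x. (\<Prod>i\<in>UNIV. g i ((x :: real^'n) $ i)) \<partial>lborel) = (\<Prod>i\<in>UNIV. \<integral>y. g i y \<partial>lborel)"
proof -
  interpret product_sigma_finite "\<lambda>_::'n. lborel :: real measure" ..
  have [measurable]: "vec_lambda \<in> (\<Pi>\<^sub>M i\<in>UNIV. lborel) \<rightarrow>\<^sub>M (borel :: (real^'n) measure)"
    by (auto simp: borel_measurable_vec_iff)
  have [measurable]: "g i \<in> borel_measurable borel" for i
    using borel_measurable_integrable[OF g, of i] by simp
  show "integrable lborel (\<lambda>x::real^'n. \<Prod>i\<in>UNIV. g i (x $ i))"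
    using product_integrable_prod[of UNIV g] g
    by (subst lborel_vec_eq) (simp add: integrable_distr_eq)
  show "(\<integral>x. (\<Prod>i\<in>UNIV. g i ((x :: real^'n) $ i)) \<partial>lborel) = (\<Prod>i\<in>UNIV. \<integral>y. g i y \<partial>lborel)"
    using product_integral_prod[of UNIV g] g
    by (subst lborel_vec_eq) (simp add: integral_distr)
qed

lemma sets_gauss [simp, measurable_cong]: "sets (gauss m S) = sets borel"
  and space_gauss [simp]: "space (gauss m S) = UNIV"
  by (simp_all add: gauss_def)

lemma borel_measurable_gauss_density [measurable]: "gauss_density m S \<in> borel_measurable borel"
  unfolding gauss_density_def[abs_def] by measurable

lemma gauss_density_nonneg: "pos_def S \<Longrightarrow> 0 \<le> gauss_density m S x"
  and gauss_density_pos: "pos_def S \<Longrightarrow> 0 < gauss_density m S x"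
  using pos_def_det[of S] by (simp_all add: gauss_density_def zero_less_mult_iff)

lemma pos_def_mat_1: "pos_def (mat 1)"
  by (simp add: pos_def_def)

lemma matrix_inv_mat_1 [simp]: "matrix_inv (mat 1 :: real^'n^'n) = mat 1"
  by (simp add: matrix_inv_unique(1))

lemma gauss_density_std: "gauss_density 0 (mat 1) x = (\<Prod>i\<in>UNIV. std_normal_density (x $ i))"
  for x :: "real^'n"
proof -
  have "(\<Prod>i\<in>UNIV. std_normal_density (x $ i)) =
    (1 / sqrt (2 * pi)) ^ CARD('n) * exp (\<Sum>i\<in>UNIV. - (x $ i)\<^sup>2 / 2)"
    by (simp add: std_normal_density_def prod_dividef exp_sum power_one_over)
  also have "(\<Sum>i\<in>UNIV. - (x $ i)\<^sup>2 / 2) = - (x \<bullet> x) / 2"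
    by (simp add: inner_vec_def power2_eq_square sum_negf sum_divide_distrib)
  finally show ?thesis
    by (simp add: gauss_density_def power_one_over real_sqrt_mult real_sqrt_power power_mult_distrib)
qed

text \<open>Monomials of degree at most two are products of functions of single coordinates, so
  their integrals factor into the one-dimensional normal moments 1, 0 and 1.\<close>

lemma std_gauss_moments:
  fixes i j :: "'n::finite"
  defines "N \<equiv> gauss (0 :: real^'n) (mat 1)"
  shows "integrable N (\<lambda>x. 1::real)" "(\<integral>x. 1 \<partial>N) = (1::real)"
    and "integrable N (\<lambda>x. x $ i)" "(\<integral>x. x $ i \<partial>N) = 0"
    and "integrable N (\<lambda>x. x $ i * x $ j)" "(\<integral>x. x $ i * x $ j \<partial>N) = of_bool (i = j)"
proof -
  have m0: "integrable lborel std_normal_density" "(\<integral>y. std_normal_density y \<partial>lborel) = 1"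
    by simp_all
  have m1: "integrable lborel (\<lambda>y. std_normal_density y * y)"
    "(\<integral>y. std_normal_density y * y \<partial>lborel) = 0"
    using integrable_std_normal_moment[of 1] integral_std_normal_moment_odd[of 0] by simp_all
  have m2: "integrable lborel (\<lambda>y. std_normal_density y * (y * y))"
    "(\<integral>y. std_normal_density y * (y * y) \<partial>lborel) = 1"
    using integrable_std_normal_moment[of 2] integral_std_normal_moment_even[of 1]
    by (simp_all add: power2_eq_square)
  have *: "integrable N (\<lambda>x. \<Prod>k\<in>UNIV. h k (x $ k))"
    "(\<integral>x. (\<Prod>k\<in>UNIV. h k (x $ k)) \<partial>N) = (\<Prod>k\<in>UNIV. \<integral>y. std_normal_density y * h k y \<partial>lborel)"
    if [measurable]: "\<And>k. h k \<in> borel_measurable borel"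
      and h: "\<And>k. integrable lborel (\<lambda>y. std_normal_density y * h k y)" for h :: "'n \<Rightarrow> real \<Rightarrow> real"
  proof -
    have eq: "gauss_density 0 (mat 1) x * (\<Prod>k\<in>UNIV. h k (x $ k))
      = (\<Prod>k\<in>UNIV. std_normal_density (x $ k) * h k (x $ k))" for x :: "real^'n"
      by (simp only: gauss_density_std prod.distrib)
    have nn: "AE x in lborel. 0 \<le> gauss_density (0 :: real^'n) (mat 1) x"
      by (simp add: gauss_density_nonneg pos_def_mat_1)
    have meas: "gauss_density 0 (mat 1) \<in> borel_measurable (lborel :: (real^'n) measure)"
      "(\<lambda>x. \<Prod>k\<in>UNIV. h k (x $ k)) \<in> borel_measurable (lborel :: (real^'n) measure)"
      by measurable
    show "integrable N (\<lambda>x. \<Prod>k\<in>UNIV. h k (x $ k))"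
      unfolding N_def gauss_def integrable_real_density[OF meas(1) nn meas(2)] eq
      by (rule integral_lborel_vec_prod(1)[OF h])
    show "(\<integral>x. (\<Prod>k\<in>UNIV. h k (x $ k)) \<partial>N) = (\<Prod>k\<in>UNIV. \<integral>y. std_normal_density y * h k y \<partial>lborel)"
      unfolding N_def gauss_def integral_real_density[OF meas(1) nn meas(2)] eq
      by (rule integral_lborel_vec_prod(2)[OF h])
  qed
  show "integrable N (\<lambda>x. 1::real)" "(\<integral>x. 1 \<partial>N) = (1::real)"
  proof -
    have one: "integrable lborel (\<lambda>y. std_normal_density y * 1)" by simp
    show "integrable N (\<lambda>x. 1::real)"
      using *(1)[of "\<lambda>_ _. 1", OF _ one] by simp
    show "(\<integral>x. 1 \<partial>N) = (1::real)"
      using *(2)[of "\<lambda>_ _. 1", OF _ one] by (simp only: mult_1_right m0 prod.neutral_const) simp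
  qed
  let ?h = "\<lambda>k y. if k = i then y else (1::real)"
  have "integrable lborel (\<lambda>y. std_normal_density y * ?h k y)" for k
    using m0 m1 by (cases "k = i") simp_all
  note * [of ?h, OF _ this]
  moreover have "(\<Prod>k\<in>UNIV. ?h k (x $ k)) = x $ i" for x :: "real^'n"
    by (subst prod.remove[of _ i]) auto
  moreover have "(\<Prod>k\<in>UNIV. \<integral>y. std_normal_density y * ?h k y \<partial>lborel) = 0"
    using m1 by (intro prod_zero) (auto intro!: exI[of _ i])
  ultimately show "integrable N (\<lambda>x. x $ i)" "(\<integral>x. x $ i \<partial>N) = 0"
    by simp_all
  \<comment> \<open>One family covers both cases: for \<open>i = j\<close> the two factors act on
    the same coordinate and give its second moment.\<close>
  let ?g = "\<lambda>k y. (if k = i then y else (1::real)) * (if k = j then y else 1)"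
  have "integrable lborel (\<lambda>y. std_normal_density y * ?g k y)" for k
    using m0 m1 m2 by (cases "k = i"; cases "k = j") simp_all
  note * [of ?g, OF _ this]
  moreover have "(\<Prod>k\<in>UNIV. ?g k (x $ k)) = x $ i * x $ j" for x :: "real^'n"
    by (simp add: prod.distrib)
  moreover have "(\<Prod>k\<in>UNIV. \<integral>y. std_normal_density y * ?g k y \<partial>lborel) = of_bool (i = j)"
  proof (cases "i = j")
    case True
    then have "(\<integral>y. std_normal_density y * ?g k y \<partial>lborel) = 1" for k
      using m0 m2 by (cases "k = i") simp_all
    then show ?thesis using True by simp
  next
    case False
    then show ?thesis
      using m1 by (auto intro!: prod_zero exI[of _ i])
  qed
  ultimately show "integrable N (\<lambda>x. x $ i * x $ j)" "(\<integral>x. x $ i * x $ j \<partial>N) = of_bool (i = j)"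
    by simp_all
qed

text \<open>Substituting \<open>x = m + L *v z\<close> turns the exponent into that of the standard
  density, and the Jacobian of \<open>L\<close> cancels the root of
  \<open>det (L ** transpose L)\<close> in the normalisation.\<close>

lemma gauss_eq_distr_std:
  fixes L :: "real^'n^'n"
  assumes "invertible L"
  shows "gauss m (L ** transpose L) = distr (gauss 0 (mat 1)) borel (\<lambda>x. m + L *v x)"
proof (rule measure_eqI)
  let ?S = "L ** transpose L"
  have inv: "matrix_inv ?S = transpose (matrix_inv L) ** matrix_inv L"
  proof (rule matrix_inv_unique(1))
    show "?S ** (transpose (matrix_inv L) ** matrix_inv L) = mat 1"
      using matrix_inv[OF assms]
      by (metis matrix_mul_assoc matrix_mul_rid matrix_transpose_mul transpose_mat)
  qed
  have detL: "det L \<noteq> 0"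
    using assms invertible_det_nz by blast
  have *: "gauss_density m ?S (L *v x + m) * \<bar>det L\<bar> = gauss_density 0 (mat 1) x" for x
  proof -
    have "(L *v x) \<bullet> (matrix_inv ?S *v (L *v x)) = x \<bullet> x"
      by (simp add: inv matrix_vector_mul_assoc[symmetric] matrix_inv_vector[OF assms]
          inner_matrix_vector_mult[symmetric] del: transpose_matrix_vector)
    then show ?thesis
      using detL by (simp add: gauss_density_def det_mul real_sqrt_mult)
  qed
  fix X assume "X \<in> sets (gauss m ?S)"
  then have X[measurable]: "X \<in> sets borel" by simp
  have "emeasure (gauss m ?S) X = (\<integral>\<^sup>+x. ennreal (gauss_density m ?S x) * indicator X x \<partial>lborel)"
    by (simp add: gauss_def emeasure_density)
  also have "\<dots> = (\<integral>\<^sup>+x. ennreal (gauss_density m ?S (x + m)) * indicator X (x + m) \<partial>lborel)"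
    by (rule nn_integral_lborel_add[symmetric]) measurable
  also have "\<dots> = (\<integral>\<^sup>+x. ennreal (gauss_density m ?S (L *v x + m)) * indicator X (L *v x + m) \<partial>lborel) * ennreal \<bar>det L\<bar>"
    by (rule nn_integral_linear_change[OF detL, symmetric]) measurable
  also have "\<dots> = (\<integral>\<^sup>+x. ennreal (gauss_density 0 (mat 1) x) * indicator X (L *v x + m) \<partial>lborel)"
    by (subst nn_integral_multc[symmetric])
      (auto intro!: nn_integral_cong simp: *[symmetric] ennreal_mult'' split: split_indicator)
  also have "\<dots> = emeasure (gauss 0 (mat 1)) ((\<lambda>x. m + L *v x) -` X)"
    unfolding gauss_def
  proof (subst emeasure_density)
    have "(\<lambda>x. m + L *v x) \<in> lborel \<rightarrow>\<^sub>M borel" by simp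
    from measurable_sets[OF this X] show "(\<lambda>x. m + L *v x) -` X \<in> sets lborel" by simp
  qed (auto simp: add.commute indicator_def intro!: nn_integral_cong)
  also have "\<dots> = emeasure (distr (gauss 0 (mat 1)) borel (\<lambda>x. m + L *v x)) X"
    by (subst emeasure_distr)
      (auto simp: gauss_def emeasure_density add.commute indicator_def
        intro!: nn_integral_cong)
  finally show "emeasure (gauss m ?S) X = \<dots>" .
qed simp

text \<open>Total mass is computed only for the standard Gaussian; every other one is its image
  under an affine map.\<close>

lemma prob_space_gauss:
  assumes "pos_def S"
  shows "prob_space (gauss m S)"
proof -
  have "prob_space (gauss (0 :: real^'a) (mat 1))"
  proof (rule prob_spaceI)
    note std = std_gauss_moments(1,2)[where 'n='a]
    have "(\<integral>\<^sup>+x. ennreal 1 \<partial>gauss (0 :: real^'a) (mat 1)) = 1"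
      by (subst nn_integral_eq_integral[OF std(1)]) (simp_all only: std(2), simp_all)
    then show "emeasure (gauss (0 :: real^'a) (mat 1)) (space (gauss 0 (mat 1))) = 1"
      by simp
  qed
  then have "prob_space (distr (gauss 0 (mat 1)) borel (\<lambda>x. m + L *v x))" for L :: "real^'a^'a"
    by (rule prob_space.prob_space_distr) measurable
  moreover obtain L :: "real^'a^'a" where "invertible L" "S = L ** transpose L"
    using pos_def_factor[OF assms] .
  ultimately show ?thesis
    by (simp add: gauss_eq_distr_std)
qed

lemma inner_matrix_vector_mult_sum: "x \<bullet> (M *v x) = (\<Sum>i\<in>UNIV. \<Sum>j\<in>UNIV. M $ i $ j * (x $ i * x $ j))"
  by (simp add: inner_vec_def matrix_vector_mult_def sum_distrib_left mult_ac)

text \<open>Affine substitution preserves quadratic polynomials, so the standard moments suffice.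
  There the linear part integrates to 0 and the quadratic part to a trace, which cyclicity turns
  into \<open>trace (M ** S)\<close>. Later moments arise by specialising the coefficients.\<close>

lemma gauss_quadratic:
  fixes M :: "real^'n^'n"
  assumes "pos_def S"
  shows "integrable (gauss m S) (\<lambda>x. a + b \<bullet> x + x \<bullet> (M *v x))"
    and "(\<integral>x. a + b \<bullet> x + x \<bullet> (M *v x) \<partial>gauss m S) = a + b \<bullet> m + m \<bullet> (M *v m) + trace (M ** S)"
proof -
  let ?N = "gauss (0 :: real^'n) (mat 1)"
  note std = std_gauss_moments[where 'n='n]
  have lin: "integrable ?N (\<lambda>x. b \<bullet> x)" "(\<integral>x. b \<bullet> x \<partial>?N) = 0" for b :: "real^'n"
    by (simp_all add: inner_vec_def std)
  have quad: "integrable ?N (\<lambda>x. x \<bullet> (M *v x))" "(\<integral>x. x \<bullet> (M *v x) \<partial>?N) = trace M" for M :: "real^'n^'n"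
    unfolding inner_matrix_vector_mult_sum
    by (simp_all add: std trace_def)
  have all: "integrable ?N (\<lambda>x. a + b \<bullet> x + x \<bullet> (M *v x))"
    "(\<integral>x. a + b \<bullet> x + x \<bullet> (M *v x) \<partial>?N) = a + trace M" for a b and M :: "real^'n^'n"
    using lin[of b] quad[of M] std(1,2) integrable_mult_right[OF std(1), of a]
    by (simp_all)
  obtain L :: "real^'n^'n" where L: "invertible L" "S = L ** transpose L"
    using pos_def_factor[OF assms] .
  have eq: "a + b \<bullet> (m + L *v x) + (m + L *v x) \<bullet> (M *v (m + L *v x)) =
    (a + b \<bullet> m + m \<bullet> (M *v m)) + (transpose L *v (b + M *v m + transpose M *v m)) \<bullet> x
     + x \<bullet> ((transpose L ** M ** L) *v x)" for x
  proof -
    have "m \<bullet> (M *v (L *v x)) = (transpose L *v (transpose M *v m)) \<bullet> x"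
      "b \<bullet> (L *v x) = (transpose L *v b) \<bullet> x"
      "(L *v x) \<bullet> (M *v m) = (transpose L *v (M *v m)) \<bullet> x"
      by (metis inner_commute inner_matrix_vector_mult transpose_transpose)+
    moreover have "(L *v x) \<bullet> (M *v (L *v x)) = x \<bullet> ((transpose L ** M ** L) *v x)"
      by (simp add: inner_matrix_vector_mult matrix_vector_mul_assoc[symmetric]
          del: transpose_matrix_vector)
    ultimately show ?thesis
      by (simp add: matrix_vector_right_distrib inner_add_left inner_add_right
          del: transpose_matrix_vector)
  qed
  have tr: "trace (M ** S) = trace (transpose L ** M ** L)"
    by (metis L(2) matrix_mul_assoc trace_mul_sym)
  show "integrable (gauss m S) (\<lambda>x. a + b \<bullet> x + x \<bullet> (M *v x))"
    unfolding L(2) gauss_eq_distr_std[OF L(1)]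
    by (subst integrable_distr_eq) (measurable, simp only: eq all)
  show "(\<integral>x. a + b \<bullet> x + x \<bullet> (M *v x) \<partial>gauss m S) = a + b \<bullet> m + m \<bullet> (M *v m) + trace (M ** S)"
    unfolding tr unfolding L(2) gauss_eq_distr_std[OF L(1)]
    by (subst integral_distr) (measurable, simp only: eq all)
qed

lemma gauss_quadratic_form:
  fixes M :: "real^'n^'n"
  assumes "pos_def S"
  shows "integrable (gauss m S) (\<lambda>x. x \<bullet> (M *v x))"
    and "(\<integral>x. x \<bullet> (M *v x) \<partial>gauss m S) = m \<bullet> (M *v m) + trace (M ** S)"
  using gauss_quadratic[OF assms, of m 0 0 M] by simp_all

lemma gauss_linear_form:
  assumes "pos_def S"
  shows "integrable (gauss m S) (\<lambda>x. b \<bullet> x)" and "(\<integral>x. b \<bullet> x \<partial>gauss m S) = b \<bullet> m"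
  using gauss_quadratic[OF assms, of m 0 b 0] by (simp_all add: trace_def)

lemma gauss_centered_quadratic_form:
  fixes M :: "real^'n^'n"
  assumes "pos_def S"
  shows "integrable (gauss m S) (\<lambda>x. (x - c) \<bullet> (M *v (x - c)))"
    and "(\<integral>x. (x - c) \<bullet> (M *v (x - c)) \<partial>gauss m S) = (m - c) \<bullet> (M *v (m - c)) + trace (M ** S)"
proof -
  have eq: "(x - c) \<bullet> (M *v (x - c)) =
    c \<bullet> (M *v c) + (- (M *v c) - transpose M *v c) \<bullet> x + x \<bullet> (M *v x)" for x
    using inner_commute[of x "M *v c"]
    by (simp add: matrix_vector_mult_diff_distrib inner_diff_left inner_diff_right dot_lmul_matrix)
  show "integrable (gauss m S) (\<lambda>x. (x - c) \<bullet> (M *v (x - c)))"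
    unfolding eq by (rule gauss_quadratic(1)[OF assms])
  show "(\<integral>x. (x - c) \<bullet> (M *v (x - c)) \<partial>gauss m S) = (m - c) \<bullet> (M *v (m - c)) + trace (M ** S)"
    unfolding eq gauss_quadratic(2)[OF assms] by simp
qed

section \<open>Mean and covariance of a Gaussian measure\<close>

lemma integrable_Basis_components:
  fixes f :: "'a \<Rightarrow> 'b::euclidean_space"
  assumes "\<And>b. b \<in> Basis \<Longrightarrow> integrable M (\<lambda>x. f x \<bullet> b)"
  shows "integrable M f"
proof -
  have "integrable M (\<lambda>x. \<Sum>b\<in>Basis. (f x \<bullet> b) *\<^sub>R b)"
    by (intro Bochner_Integration.integrable_sum integrable_scaleR_left assms)
  then show ?thesis
    by (simp add: euclidean_representation)
qed

lemma integrable_gauss: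
  assumes "pos_def S"
  shows "integrable (gauss m S) (\<lambda>x. x)"
  by (rule integrable_Basis_components, subst inner_commute, rule gauss_linear_form(1)[OF assms])

lemma mean_gauss:
  assumes "pos_def S"
  shows "mean (gauss m S) = m"
proof (rule euclidean_eqI)
  fix b :: "real^'a"
  show "mean (gauss m S) \<bullet> b = m \<bullet> b"
    unfolding mean_def
    by (subst integral_inner_left[symmetric, OF integrable_gauss[OF assms]])
      (simp only: inner_commute[of _ b] gauss_linear_form(2)[OF assms])
qed

text \<open>Pairing with a matrix unit turns an entry of the covariance into a quadratic form, whose
  Gaussian integral is already known.\<close>

lemma outer_component_eq_quadratic:
  fixes x :: "real^'n"
  shows "outer x x $ i $ j = x \<bullet> ((\<chi> k l. if k = i \<and> l = j then 1 else 0) *v x)"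
proof -
  have "x \<bullet> ((\<chi> k l. if k = i \<and> l = j then 1 else 0) *v x)
    = (\<Sum>k\<in>UNIV. \<Sum>l\<in>UNIV. if l = j then if k = i then x $ i * x $ j else 0 else 0)"
    unfolding inner_matrix_vector_mult_sum by (intro sum.cong) auto
  then show ?thesis
    by (simp add: outer_def)
qed

lemma covariance_gauss:
  fixes m :: "real^'n"
  assumes S: "pos_def S"
  shows "covariance (gauss m S) = S"
proof -
  let ?E = "\<lambda>i j :: 'n. (\<chi> k l. if k = i \<and> l = j then 1 else 0) :: real^'n^'n"
  let ?f = "\<lambda>x. outer (x - m) (x - m)"
  have comp: "integrable (gauss m S) (\<lambda>x. ?f x $ i $ j)"
    "(\<integral>x. ?f x $ i $ j \<partial>gauss m S) = trace (?E i j ** S)" for i j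
    unfolding outer_component_eq_quadratic
    using gauss_centered_quadratic_form[OF S, of m m "?E i j"] by simp_all
  have tr: "trace (?E i j ** S) = S $ i $ j" for i j
  proof -
    have "trace (?E i j ** S) = (\<Sum>k\<in>UNIV. \<Sum>l\<in>UNIV. if l = j then if k = i then S $ j $ i else 0 else 0)"
      unfolding trace_def matrix_matrix_mult_def vec_lambda_beta by (intro sum.cong) auto
    \<comment> \<open>The trace against the matrix unit at \<open>(i, j)\<close> selects the
      transposed entry; symmetry of \<open>S\<close> restores the order.\<close>
    moreover have "S $ j $ i = S $ i $ j"
      using arg_cong[OF pos_defD(1)[OF S], of "\<lambda>M. M $ i $ j"] by (simp add: transpose_def)
    ultimately show ?thesis by simp
  qed
  have int: "integrable (gauss m S) ?f"
    by (rule integrable_Basis_components) (auto simp: Basis_vec_def inner_axis comp)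
  have "(\<integral>x. ?f x \<partial>gauss m S) $ i $ j = S $ i $ j" for i j
  proof -
    have "(\<integral>x. ?f x \<partial>gauss m S) $ i $ j = (\<integral>x. ?f x \<bullet> axis i (axis j 1) \<partial>gauss m S)"
      using int by (subst integral_inner_left) (simp_all add: inner_axis)
    then show ?thesis
      by (simp add: inner_axis comp tr)
  qed
  then show ?thesis
    by (simp add: covariance_def mean_gauss[OF S] vec_eq_iff)
qed

section \<open>Log density ratios and the divergence between Gaussians\<close>

lemma ln_gauss_density_ratio:
  assumes "pos_def S" "pos_def T"
  shows "ln (gauss_density m S x / gauss_density c T x) =
    ((x - c) \<bullet> (matrix_inv T *v (x - c)) - (x - m) \<bullet> (matrix_inv S *v (x - m)) + ln (det T / det S)) / 2"
proof -
  have *: "ln (gauss_density m S x) =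
    - ((x - m) \<bullet> (matrix_inv S *v (x - m))) / 2 - (ln ((2 * pi) ^ CARD('a)) + ln (det S)) / 2"
    if "pos_def S" for m :: "real^'a" and S
    using pos_def_det[OF that]
    by (simp add: gauss_density_def ln_div ln_sqrt ln_mult)
  show ?thesis
    using gauss_density_pos[OF assms(1), of m x] gauss_density_pos[OF assms(2), of c x]
      pos_def_det[OF assms(1)] pos_def_det[OF assms(2)]
    by (simp add: ln_div *[OF assms(1)] *[OF assms(2)] diff_divide_distrib add_divide_distrib)
qed

text \<open>The term \<open>real CARD('n)\<close> is the expected value of the Gaussian's own
  quadratic form, \<open>trace (matrix_inv S ** S)\<close>; the powers of \<open>2 * pi\<close> have
  cancelled in the ratio.\<close>

lemma gauss_log_density_ratio:
  fixes m c :: "real^'n"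
  assumes S: "pos_def S" and T: "pos_def T"
  shows "integrable (gauss m S) (\<lambda>x. ln (gauss_density m S x / gauss_density c T x))"
    and "(\<integral>x. ln (gauss_density m S x / gauss_density c T x) \<partial>gauss m S) =
      ((m - c) \<bullet> (matrix_inv T *v (m - c)) + trace (matrix_inv T ** S) - real CARD('n)
        + ln (det T / det S)) / 2"
proof -
  interpret prob_space "gauss m S" by (rule prob_space_gauss[OF S])
  note T_int = gauss_centered_quadratic_form[OF S, of m c "matrix_inv T"]
  note S_int = gauss_centered_quadratic_form[OF S, of m m "matrix_inv S"]
  show "integrable (gauss m S) (\<lambda>x. ln (gauss_density m S x / gauss_density c T x))"
    unfolding ln_gauss_density_ratio[OF S T] using T_int S_int by simp
  have split: "(\<integral>x. (f x - g x + k) / 2 \<partial>gauss m S) = ((\<integral>x. f x \<partial>gauss m S) - (\<integral>x. g x \<partial>gauss m S) + k) / 2"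
    if "integrable (gauss m S) f" "integrable (gauss m S) g" for f g and k :: real
  proof -
    have "prob UNIV = 1"
      using prob_space by (simp only: space_gauss)
    then show ?thesis
      using that by simp
  qed
  have "trace (matrix_inv S ** S) = real CARD('n)"
    by (simp add: matrix_inv(2)[OF pos_def_invertible[OF S]] trace_def mat_def)
  then show "(\<integral>x. ln (gauss_density m S x / gauss_density c T x) \<partial>gauss m S) =
      ((m - c) \<bullet> (matrix_inv T *v (m - c)) + trace (matrix_inv T ** S) - real CARD('n)
        + ln (det T / det S)) / 2"
    unfolding ln_gauss_density_ratio[OF S T] split[OF T_int(1) S_int(1)] T_int(2) S_int(2) by simp
qed

lemma KL_divergence_gauss:
  fixes m c :: "real^'n"
  assumes S: "pos_def S" and T: "pos_def T"
  shows "KL_divergence (exp 1) (gauss c T) (gauss m S) =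
      ((m - c) \<bullet> (matrix_inv T *v (m - c)) + trace (matrix_inv T ** S) - real CARD('n)
        + ln (det T / det S)) / 2"
proof -
  have "KL_divergence (exp 1) (gauss c T) (gauss m S) =
    (\<integral>x. gauss_density m S x * log (exp 1) (gauss_density m S x / gauss_density c T x) \<partial>lborel)"
    unfolding gauss_def using gauss_density_pos[OF S] gauss_density_pos[OF T]
    by (intro lborel.KL_density_density) (auto simp: less_imp_le less_imp_neq[symmetric])
  also have "\<dots> = (\<integral>x. ln (gauss_density m S x / gauss_density c T x) \<partial>gauss m S)"
    unfolding gauss_def using gauss_density_nonneg[OF S]
    by (subst integral_real_density) (auto simp: log_ln[symmetric])
  finally show ?thesis
    by (simp only: gauss_log_density_ratio[OF assms])
qed

text \<open>The left-hand side is twice the divergence of \<open>gauss 0 S\<close> from \<open>gauss 0 T\<close>.\<close>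

lemma trace_ln_det_ge:
  fixes S T :: "real^'n^'n"
  assumes S: "pos_def S" and T: "pos_def T"
  defines "D \<equiv> trace (matrix_inv T ** S) - real CARD('n) + ln (det T / det S)"
  shows "0 \<le> D" and "D = 0 \<longleftrightarrow> S = T"
proof -
  interpret prob_space "gauss (0 :: real^'n) T" by (rule prob_space_gauss[OF T])
  interpret information_space "gauss (0 :: real^'n) T" "exp 1"
    by unfold_locales simp
  \<comment> \<open>\<open>f\<close> is the Radon-Nikodym derivative of \<open>gauss 0 S\<close>
    with respect to \<open>gauss 0 T\<close>; in this form Gibbs' inequality with its equality case
    applies.\<close>
  define f where "f x = gauss_density 0 S x / gauss_density 0 T x" for x :: "real^'n"
  have f_nonneg: "0 \<le> f x" for x
    unfolding f_def using gauss_density_nonneg[OF S] gauss_density_nonneg[OF T] by simp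
  have [measurable]: "f \<in> borel_measurable borel"
    unfolding f_def[abs_def] by measurable
  have f_mult: "gauss_density 0 T x * f x = gauss_density 0 S x" for x
    using gauss_density_pos[OF T, of 0 x] by (simp add: f_def)
  have dens: "density (gauss 0 T) f = gauss 0 S"
    unfolding gauss_def
    by (subst density_density_eq)
      (auto simp: ennreal_mult''[symmetric] f_nonneg f_mult intro!: density_cong)
  have prob: "prob_space (density (gauss 0 T) f)"
    unfolding dens by (rule prob_space_gauss[OF S])
  have "integrable (density (gauss 0 T) f) (\<lambda>x. log (exp 1) (f x))"
    unfolding dens using gauss_log_density_ratio(1)[OF S T, of 0 0]
    by (simp add: f_def log_ln[symmetric])
  then have int: "integrable (gauss 0 T) (\<lambda>x. f x * log (exp 1) (f x))"
    by (subst (asm) integrable_real_density) (auto simp: f_nonneg)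
  have KL: "KL_divergence (exp 1) (gauss 0 T) (density (gauss 0 T) f) = D / 2"
    unfolding dens by (simp add: KL_divergence_gauss[OF S T] D_def)
  show "0 \<le> D"
    using KL_nonneg[OF prob _ _ int] KL f_nonneg by simp
  \<comment> \<open>Vanishing divergence identifies the measures, and the covariance then recovers
    the matrix from the measure.\<close>
  have "D = 0 \<longleftrightarrow> gauss 0 S = gauss 0 T"
    using KL_eq_0_iff_eq[OF prob _ _ int] KL f_nonneg by (auto simp: dens)
  also have "\<dots> \<longleftrightarrow> S = T"
    by (metis S T covariance_gauss)
  finally show "D = 0 \<longleftrightarrow> S = T" .
qed

section \<open>Gaussian kernels and conditioning\<close>

lemma nn_integral_gauss:
  assumes "f \<in> borel_measurable borel"
  shows "(\<integral>\<^sup>+x. f x \<partial>gauss m S) = (\<integral>\<^sup>+x. ennreal (gauss_density m S x) * f x \<partial>lborel)"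
  unfolding gauss_def using assms by (subst nn_integral_density) auto

lemma nn_integral_gauss_translate:
  assumes [measurable]: "f \<in> borel_measurable borel"
  shows "(\<integral>\<^sup>+x. f x \<partial>gauss (m + c) S) = (\<integral>\<^sup>+x. f (x + c) \<partial>gauss m S)"
proof -
  have "(\<integral>\<^sup>+x. f x \<partial>gauss (m + c) S) =
    (\<integral>\<^sup>+x. ennreal (gauss_density (m + c) S (x + c)) * f (x + c) \<partial>lborel)"
    unfolding nn_integral_gauss[OF assms] by (rule nn_integral_lborel_add[symmetric]) measurable
  also have "\<dots> = (\<integral>\<^sup>+x. f (x + c) \<partial>gauss m S)"
    by (subst nn_integral_gauss) (auto simp: gauss_density_def)
  finally show ?thesis .
qed

lemma measurable_gauss_kernel:
  fixes m :: "'a \<Rightarrow> real^'n"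
  assumes m[measurable]: "m \<in> borel_measurable M" and S[measurable]: "S \<in> borel_measurable M"
    and pos: "\<And>x. x \<in> space M \<Longrightarrow> pos_def (S x)"
  shows "(\<lambda>x. gauss (m x) (S x)) \<in> measurable M (prob_algebra borel)"
proof (rule measurable_prob_algebraI)
  show "prob_space (gauss (m x) (S x))" if "x \<in> space M" for x
    by (rule prob_space_gauss[OF pos[OF that]])
  have [measurable]: "(\<lambda>x. matrix_inv (S x)) \<in> borel_measurable M"
    by (rule borel_measurable_matrix_inv[OF S pos_def_invertible[OF pos]])
  show "(\<lambda>x. gauss (m x) (S x)) \<in> measurable M (subprob_algebra borel)"
  proof (rule measurable_subprob_algebra)
    show "subprob_space (gauss (m x) (S x))" if "x \<in> space M" for x
      by (rule prob_space_imp_subprob_space[OF prob_space_gauss[OF pos[OF that]]])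
    fix A :: "(real^'n) set" assume [measurable]: "A \<in> sets borel"
    have "(\<lambda>x. \<integral>\<^sup>+y. ennreal (gauss_density (m x) (S x) y) * indicator A y \<partial>lborel) \<in> borel_measurable M"
      unfolding gauss_density_def by measurable
    then show "(\<lambda>x. emeasure (gauss (m x) (S x)) A) \<in> borel_measurable M"
      by (simp add: gauss_def emeasure_density)
  qed simp
qed

text \<open>This is the Woodbury identity: \<open>G\<close> is the posterior precision and the
  right-hand side the posterior covariance. It is checked by applying the product to a
  vector.\<close>

lemma matrix_inv_congruence_add:
  fixes S :: "real^'n^'n" and C :: "real^'n^'p"
  assumes S: "pos_def S" and V: "pos_def V"
  defines "T \<equiv> C ** S ** transpose C + V"
  defines "G \<equiv> transpose C ** matrix_inv V ** C + matrix_inv S"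
  shows "matrix_inv G = S - S ** transpose C ** matrix_inv T ** C ** S"
proof (rule matrix_inv_unique(1))
  have invT: "invertible T"
    unfolding T_def by (rule pos_def_invertible[OF pos_def_congruence_add[OF S V]])
  note invS = pos_def_invertible[OF S] and invV = pos_def_invertible[OF V]
  have "(G ** (S - S ** transpose C ** matrix_inv T ** C ** S)) *v z = z" for z
  proof -
    \<comment> \<open>With \<open>a\<close> as normalised innovation, \<open>C *v (S *v z)\<close>
      splits into a state part and a noise part; only the noise part \<open>V *v a\<close> remains
      once the correction is subtracted.\<close>
    define a where "a = matrix_inv T *v (C *v (S *v z))"
    have Ta: "C *v (S *v z) = C *v (S *v (transpose C *v a)) + V *v a"
      using matrix_inv_vector(1)[OF invT, of "C *v (S *v z)"] unfolding a_def[symmetric]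
      by (simp add: T_def matrix_vector_mult_add_rdistrib matrix_vector_mul_assoc[symmetric]
          del: transpose_matrix_vector)
    have "(S - S ** transpose C ** matrix_inv T ** C ** S) *v z = S *v (z - transpose C *v a)"
      by (simp add: a_def matrix_vector_mult_diff_rdistrib matrix_vector_mult_diff_distrib
          matrix_vector_mul_assoc[symmetric] del: transpose_matrix_vector)
    moreover have "C *v (S *v (z - transpose C *v a)) = V *v a"
      by (simp add: Ta matrix_vector_mult_diff_distrib del: transpose_matrix_vector)
    ultimately show ?thesis
      by (simp add: G_def matrix_vector_mult_add_rdistrib matrix_vector_mul_assoc[symmetric]
          matrix_inv_vector[OF invS] matrix_inv_vector[OF invV] del: transpose_matrix_vector)
  qed
  then show "G ** (S - S ** transpose C ** matrix_inv T ** C ** S) = mat 1"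
    by (simp add: matrix_eq)
qed

text \<open>Positivity is not visible in a difference, but this matrix is the inverse of the sum
  \<open>transpose C ** matrix_inv V ** C + matrix_inv S\<close>, which is positive
  definite.\<close>

lemma pos_def_conditional_covariance:
  fixes S :: "real^'n^'n" and C :: "real^'n^'p"
  assumes S: "pos_def S" and V: "pos_def V"
  shows "pos_def (S - S ** transpose C ** matrix_inv (C ** S ** transpose C + V) ** C ** S)"
  using pos_def_congruence_add[OF pos_def_matrix_inv[OF V] pos_def_matrix_inv[OF S], of "transpose C"]
    pos_def_matrix_inv matrix_inv_congruence_add[OF S V, of C]
  by force

text \<open>With \<open>y = T *v a\<close> both quadratic forms on the left can be expanded in \<open>e\<close> and \<open>a\<close>,
  and the mixed terms cancel.\<close>

lemma gauss_exponent_identity: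
  fixes S :: "real^'n^'n" and C :: "real^'n^'p" and e y
  assumes S: "pos_def S" and V: "pos_def V"
  defines "T \<equiv> C ** S ** transpose C + V"
  defines "L \<equiv> S ** transpose C ** matrix_inv T"
  defines "G \<equiv> transpose C ** matrix_inv V ** C + matrix_inv S"
  defines "x \<equiv> e + L *v y"
  shows "x \<bullet> (matrix_inv S *v x) + (y - C *v x) \<bullet> (matrix_inv V *v (y - C *v x))
    = y \<bullet> (matrix_inv T *v y) + e \<bullet> (G *v e)"
proof -
  have T: "pos_def T"
    unfolding T_def by (rule pos_def_congruence_add[OF S V])
  note invS = pos_def_invertible[OF S] and invV = pos_def_invertible[OF V]
    and invT = pos_def_invertible[OF T]
  define a where "a = matrix_inv T *v y"
  define b where "b = transpose C *v a"
  have y: "y = C *v (S *v b) + V *v a"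
    using matrix_inv_vector(1)[OF invT, of y] unfolding a_def[symmetric] b_def
    by (simp add: T_def matrix_vector_mult_add_rdistrib matrix_vector_mul_assoc[symmetric]
        del: transpose_matrix_vector)
  have x: "x = e + S *v b"
    by (simp add: x_def L_def a_def b_def matrix_vector_mul_assoc[symmetric]
        del: transpose_matrix_vector)
  have r: "y - C *v x = V *v a - C *v e"
    by (simp add: y x matrix_vector_right_distrib)
  have Sx: "matrix_inv S *v x = matrix_inv S *v e + b"
    by (simp add: x matrix_vector_right_distrib matrix_inv_vector[OF invS])
  have Vr: "matrix_inv V *v (V *v a - C *v e) = a - matrix_inv V *v (C *v e)"
    by (simp add: matrix_vector_mult_diff_distrib matrix_inv_vector[OF invV])
  have Cb: "(C *v z) \<bullet> a = z \<bullet> b" for z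
    by (simp add: b_def inner_matrix_vector_mult del: transpose_matrix_vector)
  have Sb: "(S *v b) \<bullet> (matrix_inv S *v e) = b \<bullet> e"
    by (simp add: inner_symmetric_matrix[OF pos_defD(1)[OF S]] matrix_inv_vector[OF invS])
  have Va: "(V *v a) \<bullet> (matrix_inv V *v (C *v e)) = e \<bullet> b"
    using Cb[of e] by (simp add: inner_symmetric_matrix[OF pos_defD(1)[OF V]]
        matrix_inv_vector[OF invV] inner_commute)
  have G: "e \<bullet> (G *v e) = (C *v e) \<bullet> (matrix_inv V *v (C *v e)) + e \<bullet> (matrix_inv S *v e)"
    by (simp add: G_def matrix_vector_mult_add_rdistrib inner_add_right inner_matrix_vector_mult
        matrix_vector_mul_assoc[symmetric] del: transpose_matrix_vector)
  have yT: "y \<bullet> a = (S *v b) \<bullet> b + (V *v a) \<bullet> a"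
    by (simp add: y inner_add_left Cb)
  show ?thesis
    unfolding r Sx Vr G a_def[symmetric] yT
    by (simp add: x inner_add_left inner_add_right inner_diff_left inner_diff_right Cb Sb Va
        inner_commute[of b e])
qed

text \<open>Rewriting the exponents turns prior times likelihood into the marginal of
  \<open>y\<close> times the law of the error \<open>e\<close>. The constant is the quotient of the
  normalisations; it depends on none of \<open>m\<close>, \<open>y\<close>, \<open>e\<close>, and
  leaving it unspecified avoids a determinant identity.\<close>

lemma gauss_density_factorisation:
  fixes S :: "real^'n^'n" and C :: "real^'n^'p"
  assumes S: "pos_def S" and V: "pos_def V"
  defines "T \<equiv> C ** S ** transpose C + V"
  defines "L \<equiv> S ** transpose C ** matrix_inv T"
  defines "S' \<equiv> S - S ** transpose C ** matrix_inv T ** C ** S"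
  obtains c where "0 \<le> c"
    "\<And>m y e. gauss_density m S (e + (m + L *v (y - C *v m))) *
        gauss_density 0 V (y - C *v (e + (m + L *v (y - C *v m))))
      = c * (gauss_density (C *v m) T y * gauss_density 0 S' e)"
proof -
  let ?Z = "\<lambda>M. sqrt ((2 * pi) ^ CARD('b) * det (M :: real^'b^'b))"
  define G where "G = transpose C ** matrix_inv V ** C + matrix_inv S"
  have T: "pos_def T"
    unfolding T_def by (rule pos_def_congruence_add[OF S V])
  have G: "pos_def G"
    using pos_def_congruence_add[OF pos_def_matrix_inv[OF V] pos_def_matrix_inv[OF S], of "transpose C"]
    by (simp add: G_def)
  have S': "S' = matrix_inv G"
    unfolding S'_def T_def G_def by (rule matrix_inv_congruence_add[OF S V, symmetric])
  then have posS': "pos_def S'"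
    using pos_def_matrix_inv[OF G] by simp
  define Z where "Z = sqrt ((2 * pi) ^ CARD('n) * det S) * sqrt ((2 * pi) ^ CARD('p) * det V)"
  define Z' where "Z' = sqrt ((2 * pi) ^ CARD('p) * det T) * sqrt ((2 * pi) ^ CARD('n) * det S')"
  have pos: "Z > 0" "Z' > 0"
    unfolding Z_def Z'_def using pos_def_det[OF S] pos_def_det[OF V] pos_def_det[OF T] pos_def_det[OF posS']
    by simp_all
  show ?thesis
  proof (rule that[of "Z' / Z"])
    show "0 \<le> Z' / Z" using pos by simp
    fix m e :: "real^'n" and y :: "real^'p"
    let ?x = "e + L *v (y - C *v m)"
    have x: "e + (m + L *v (y - C *v m)) - m = ?x"
      "y - C *v (e + (m + L *v (y - C *v m))) = y - C *v m - C *v ?x"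
      by (simp_all add: matrix_vector_right_distrib)
    have "gauss_density m S (e + (m + L *v (y - C *v m))) *
        gauss_density 0 V (y - C *v (e + (m + L *v (y - C *v m))))
      = exp (- (?x \<bullet> (matrix_inv S *v ?x) +
          (y - C *v m - C *v ?x) \<bullet> (matrix_inv V *v (y - C *v m - C *v ?x))) / 2) / Z"
      unfolding gauss_density_def x Z_def
      by (simp add: exp_add[symmetric] add_divide_distrib)
    also have "\<dots> = exp (- ((y - C *v m) \<bullet> (matrix_inv T *v (y - C *v m)) + e \<bullet> (G *v e)) / 2) / Z"
      unfolding L_def T_def G_def gauss_exponent_identity[OF S V] ..
    also have "\<dots> = (Z' / Z) * (gauss_density (C *v m) T y * gauss_density 0 S' e)"
      unfolding gauss_density_def Z'_def using pos(1) pos_def_det[OF T] pos_def_det[OF posS']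
      by (simp add: exp_add[symmetric] add_divide_distrib S' matrix_inv_matrix_inv[OF pos_def_invertible[OF G]])
    finally show "gauss_density m S (e + (m + L *v (y - C *v m))) *
        gauss_density 0 V (y - C *v (e + (m + L *v (y - C *v m))))
      = (Z' / Z) * (gauss_density (C *v m) T y * gauss_density 0 S' e)" .
  qed
qed


text \<open>The constant of the factorisation is 1, because both sides integrate to 1.\<close>

lemma gauss_joint_nn_integral:
  fixes S :: "real^'n^'n" and C :: "real^'n^'p"
  assumes S: "pos_def S" and V: "pos_def V"
  defines "T \<equiv> C ** S ** transpose C + V"
  defines "L \<equiv> S ** transpose C ** matrix_inv T"
  defines "S' \<equiv> S - S ** transpose C ** matrix_inv T ** C ** S"
  assumes f: "f \<in> borel_measurable (borel \<Otimes>\<^sub>M borel)"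
  shows "(\<integral>\<^sup>+x. \<integral>\<^sup>+v. f (C *v x + v, x - (m + L *v (C *v x + v - C *v m))) \<partial>gauss 0 V \<partial>gauss m S)
    = (\<integral>\<^sup>+y. \<integral>\<^sup>+e. f (y, e) \<partial>gauss 0 S' \<partial>gauss (C *v m) T)"
proof -
  have T: "pos_def T"
    unfolding T_def by (rule pos_def_congruence_add[OF S V])
  have S': "pos_def S'"
    unfolding S'_def T_def by (rule pos_def_conditional_covariance[OF S V])
  obtain c where c: "0 \<le> c"
    "\<And>m y e. gauss_density m S (e + (m + L *v (y - C *v m))) *
        gauss_density 0 V (y - C *v (e + (m + L *v (y - C *v m))))
      = c * (gauss_density (C *v m) T y * gauss_density 0 S' e)"
    using gauss_density_factorisation[OF S V, of C] unfolding T_def L_def S'_def by blast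
  note nonneg = gauss_density_nonneg[OF S] gauss_density_nonneg[OF V] gauss_density_nonneg[OF T]
    gauss_density_nonneg[OF S']
  have scaled: "(\<integral>\<^sup>+x. \<integral>\<^sup>+v. f (C *v x + v, x - (m + L *v (C *v x + v - C *v m))) \<partial>gauss 0 V \<partial>gauss m S)
    = ennreal c * (\<integral>\<^sup>+y. \<integral>\<^sup>+e. f (y, e) \<partial>gauss 0 S' \<partial>gauss (C *v m) T)"
    if [measurable]: "f \<in> borel_measurable (borel \<Otimes>\<^sub>M borel)" for f
  proof -
    let ?h = "\<lambda>y. m + L *v (y - C *v m)"
    have "(\<integral>\<^sup>+x. \<integral>\<^sup>+v. f (C *v x + v, x - ?h (C *v x + v)) \<partial>gauss 0 V \<partial>gauss m S)
      = (\<integral>\<^sup>+x. ennreal (gauss_density m S x) *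
          (\<integral>\<^sup>+v. ennreal (gauss_density 0 V v) * f (C *v x + v, x - ?h (C *v x + v)) \<partial>lborel) \<partial>lborel)"
    proof -
      have inner: "(\<integral>\<^sup>+v. f (C *v x + v, x - ?h (C *v x + v)) \<partial>gauss 0 V) =
        (\<integral>\<^sup>+v. ennreal (gauss_density 0 V v) * f (C *v x + v, x - ?h (C *v x + v)) \<partial>lborel)" for x
        by (rule nn_integral_gauss) measurable
      show ?thesis
        unfolding inner by (rule nn_integral_gauss) measurable
    qed
    also have "\<dots> = (\<integral>\<^sup>+x. \<integral>\<^sup>+y. ennreal (gauss_density m S x) *
        (ennreal (gauss_density 0 V (y - C *v x)) * f (y, x - ?h y)) \<partial>lborel \<partial>lborel)"
    proof (rule nn_integral_cong)
      fix x
      have "(\<integral>\<^sup>+v. ennreal (gauss_density 0 V v) * f (C *v x + v, x - ?h (C *v x + v)) \<partial>lborel)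
        = (\<integral>\<^sup>+y. ennreal (gauss_density 0 V (y + - (C *v x))) *
            f (C *v x + (y + - (C *v x)), x - ?h (C *v x + (y + - (C *v x)))) \<partial>lborel)"
        by (rule nn_integral_lborel_add[symmetric]) measurable
      then show "ennreal (gauss_density m S x) *
          (\<integral>\<^sup>+v. ennreal (gauss_density 0 V v) * f (C *v x + v, x - ?h (C *v x + v)) \<partial>lborel)
        = (\<integral>\<^sup>+y. ennreal (gauss_density m S x) *
            (ennreal (gauss_density 0 V (y - C *v x)) * f (y, x - ?h y)) \<partial>lborel)"
        by (subst nn_integral_cmult) simp_all
    qed
    \<comment> \<open>The order of integration is exchanged because the next substitution shifts the
      state by the estimate \<open>?h y\<close>, which requires \<open>y\<close> to be
      fixed.\<close>
    also have "\<dots> = (\<integral>\<^sup>+y. \<integral>\<^sup>+x. ennreal (gauss_density m S x) *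
        (ennreal (gauss_density 0 V (y - C *v x)) * f (y, x - ?h y)) \<partial>lborel \<partial>lborel)"
      by (rule lborel_pair.Fubini') measurable
    also have "\<dots> = (\<integral>\<^sup>+y. \<integral>\<^sup>+e. ennreal (gauss_density m S (e + ?h y)) *
        (ennreal (gauss_density 0 V (y - C *v (e + ?h y))) * f (y, e + ?h y - ?h y)) \<partial>lborel \<partial>lborel)"
      by (intro nn_integral_cong nn_integral_lborel_add[symmetric]) measurable
    also have "\<dots> = (\<integral>\<^sup>+y. \<integral>\<^sup>+e. ennreal c * (ennreal (gauss_density (C *v m) T y) *
        (ennreal (gauss_density 0 S' e) * f (y, e))) \<partial>lborel \<partial>lborel)"
      using c nonneg by (intro nn_integral_cong) (simp add: mult.assoc[symmetric] ennreal_mult'[symmetric])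
    also have "\<dots> = ennreal c * (\<integral>\<^sup>+y. ennreal (gauss_density (C *v m) T y) *
        (\<integral>\<^sup>+e. ennreal (gauss_density 0 S' e) * f (y, e) \<partial>lborel) \<partial>lborel)"
      by (simp add: nn_integral_cmult)
    also have "\<dots> = ennreal c * (\<integral>\<^sup>+y. \<integral>\<^sup>+e. f (y, e) \<partial>gauss 0 S' \<partial>gauss (C *v m) T)"
    proof -
      have inner: "(\<integral>\<^sup>+e. f (y, e) \<partial>gauss 0 S') =
        (\<integral>\<^sup>+e. ennreal (gauss_density 0 S' e) * f (y, e) \<partial>lborel)" for y
        by (rule nn_integral_gauss) measurable
      show ?thesis
        unfolding inner by (subst nn_integral_gauss[of _ "C *v m" T]) simp_all
    qed
    finally show ?thesis .
  qed
  have one: "(\<integral>\<^sup>+x. \<integral>\<^sup>+y. 1 \<partial>gauss b N \<partial>gauss a M) = 1" if "pos_def M" "pos_def N"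
    for a :: "real^'a" and M and b :: "real^'b" and N
    using prob_space.emeasure_space_1[OF prob_space_gauss[OF that(1), of a]]
      prob_space.emeasure_space_1[OF prob_space_gauss[OF that(2), of b]]
    by simp
  have "ennreal c = 1"
    using scaled[of "\<lambda>_. 1"] one[OF S V] one[OF T S'] by simp
  then show ?thesis
    using scaled[OF f] by simp
qed

text \<open>The marginal in \<open>y\<close> of the joint formula: the error coordinate integrates
  out with mass 1, and a nonzero noise mean \<open>c\<close> enters by translation.\<close>

lemma gauss_convolution_nn_integral:
  fixes S :: "real^'n^'n" and C :: "real^'n^'p"
  assumes S: "pos_def S" and V: "pos_def V"
  assumes f[measurable]: "f \<in> borel_measurable borel"
  shows "(\<integral>\<^sup>+x. \<integral>\<^sup>+v. f (C *v x + v) \<partial>gauss c V \<partial>gauss m S)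
    = (\<integral>\<^sup>+y. f y \<partial>gauss (C *v m + c) (C ** S ** transpose C + V))"
proof -
  let ?S' = "S - S ** transpose C ** matrix_inv (C ** S ** transpose C + V) ** C ** S"
  have S': "pos_def ?S'"
    by (rule pos_def_conditional_covariance[OF S V])
  have "(\<integral>\<^sup>+x. \<integral>\<^sup>+v. f (C *v x + v) \<partial>gauss c V \<partial>gauss m S)
    = (\<integral>\<^sup>+x. \<integral>\<^sup>+v. f (C *v x + v + c) \<partial>gauss 0 V \<partial>gauss m S)"
    using nn_integral_gauss_translate[of _ 0 c V] by (simp add: add.assoc)
  also have "\<dots> = (\<integral>\<^sup>+y. \<integral>\<^sup>+e. f (y + c) \<partial>gauss 0 ?S' \<partial>gauss (C *v m) (C ** S ** transpose C + V))"
    using gauss_joint_nn_integral[OF S V, of "\<lambda>p. f (fst p + c)"] by simp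
  also have "\<dots> = (\<integral>\<^sup>+y. f y \<partial>gauss (C *v m + c) (C ** S ** transpose C + V))"
    using prob_space.emeasure_space_1[OF prob_space_gauss[OF S']]
    by (subst nn_integral_gauss_translate) simp_all
  finally show ?thesis .
qed

section \<open>The one-step filter formula\<close>

lemma nn_integral_prob_const: "prob_space M \<Longrightarrow> (\<integral>\<^sup>+x. c \<partial>M) = c"
  by (simp add: prob_space.emeasure_space_1)

lemma borel_measurable_nn_integral_gauss [measurable (raw)]:
  assumes S: "pos_def S" and "case_prod f \<in> borel_measurable (M \<Otimes>\<^sub>M borel)"
  shows "(\<lambda>x. \<integral>\<^sup>+w. f x w \<partial>gauss c S) \<in> borel_measurable M"
proof -
  interpret prob_space "gauss c S" by (rule prob_space_gauss[OF S])
  have "case_prod f \<in> borel_measurable (M \<Otimes>\<^sub>M gauss c S)"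
    using assms(2) by (simp cong: measurable_cong_sets)
  then show ?thesis
    by (rule borel_measurable_nn_integral)
qed

definition kalman_gain :: "real^'n^'p \<Rightarrow> real^'p^'p \<Rightarrow> real^'n^'n \<Rightarrow> real^'p^'n" where
  "kalman_gain C V S = S ** transpose C ** matrix_inv (C ** S ** transpose C + V)"

text \<open>This is the filtered error covariance, after the measurement of the same time has been
  used; prediction conjugates it by \<open>A\<close> and adds the noise covariance.\<close>

definition kalman_cov :: "real^'n^'p \<Rightarrow> real^'p^'p \<Rightarrow> real^'n^'n \<Rightarrow> real^'n^'n" where
  "kalman_cov C V S = S - kalman_gain C V S ** C ** S"

lemma pos_def_kalman_cov: "pos_def S \<Longrightarrow> pos_def V \<Longrightarrow> pos_def (kalman_cov C V S)"
  unfolding kalman_cov_def kalman_gain_def by (rule pos_def_conditional_covariance)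

text \<open>Measurement update followed by time update: the state is its estimate from
  \<open>y\<close> plus an error independent of \<open>y\<close>, and the image of that error under
  \<open>A\<close> convolves with the process noise to one Gaussian.\<close>

lemma gauss_step_nn_integral:
  fixes S :: "real^'n^'n" and C :: "real^'n^'p" and A :: "real^'n^'k"
  assumes S: "pos_def S" and V: "pos_def V" and W: "pos_def W"
  assumes f[measurable]: "f \<in> borel_measurable (borel \<Otimes>\<^sub>M borel)"
  shows "(\<integral>\<^sup>+x. \<integral>\<^sup>+v. \<integral>\<^sup>+w. f (C *v x + v, A *v x + w) \<partial>gauss c W \<partial>gauss 0 V \<partial>gauss m S)
    = (\<integral>\<^sup>+y. \<integral>\<^sup>+h. f (y, A *v (m + kalman_gain C V S *v (y - C *v m)) + h)
        \<partial>gauss c (A ** kalman_cov C V S ** transpose A + W)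
        \<partial>gauss (C *v m) (C ** S ** transpose C + V))"
proof -
  let ?x = "\<lambda>y. m + kalman_gain C V S *v (y - C *v m)"
  \<comment> \<open>\<open>F\<close> takes the error in place of the state and adds the estimate
    back, so that the joint formula for measurement and error applies.\<close>
  define F where "F p = (\<integral>\<^sup>+w. f (fst p, A *v (snd p + ?x (fst p)) + w) \<partial>gauss c W)" for p
  have F[measurable]: "F \<in> borel_measurable (borel \<Otimes>\<^sub>M borel)"
    unfolding F_def using W by measurable
  have "(\<integral>\<^sup>+x. \<integral>\<^sup>+v. \<integral>\<^sup>+w. f (C *v x + v, A *v x + w) \<partial>gauss c W \<partial>gauss 0 V \<partial>gauss m S)
    = (\<integral>\<^sup>+x. \<integral>\<^sup>+v. F (C *v x + v, x - ?x (C *v x + v)) \<partial>gauss 0 V \<partial>gauss m S)"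
    by (simp add: F_def)
  also have "\<dots> = (\<integral>\<^sup>+y. \<integral>\<^sup>+e. F (y, e) \<partial>gauss 0 (kalman_cov C V S) \<partial>gauss (C *v m) (C ** S ** transpose C + V))"
    unfolding kalman_cov_def kalman_gain_def by (rule gauss_joint_nn_integral[OF S V F])
  also have "\<dots> = (\<integral>\<^sup>+y. \<integral>\<^sup>+h. f (y, A *v ?x y + h)
        \<partial>gauss c (A ** kalman_cov C V S ** transpose A + W)
        \<partial>gauss (C *v m) (C ** S ** transpose C + V))"
  proof (rule nn_integral_cong)
    fix y
    have "(\<integral>\<^sup>+e. F (y, e) \<partial>gauss 0 (kalman_cov C V S))
      = (\<integral>\<^sup>+e. \<integral>\<^sup>+w. f (y, A *v ?x y + (A *v e + w)) \<partial>gauss c W \<partial>gauss 0 (kalman_cov C V S))"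
      by (simp add: F_def matrix_vector_right_distrib add_ac)
    also have "\<dots> = (\<integral>\<^sup>+h. f (y, A *v ?x y + h) \<partial>gauss c (A ** kalman_cov C V S ** transpose A + W))"
      by (subst gauss_convolution_nn_integral[OF pos_def_kalman_cov[OF S V] W]) simp_all
    finally show "(\<integral>\<^sup>+e. F (y, e) \<partial>gauss 0 (kalman_cov C V S)) = \<dots>" .
  qed
  finally show ?thesis .
qed

lemma borel_measurable_kalman:
  fixes S :: "'a \<Rightarrow> real^'n^'n"
  assumes [measurable]: "S \<in> borel_measurable M" and S: "\<And>x. x \<in> space M \<Longrightarrow> pos_def (S x)"
    and V: "pos_def V"
  shows "(\<lambda>x. kalman_gain C V (S x)) \<in> borel_measurable M"
    and "(\<lambda>x. kalman_cov C V (S x)) \<in> borel_measurable M"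
proof -
  have [measurable]: "(\<lambda>x. matrix_inv (C ** S x ** transpose C + V)) \<in> borel_measurable M"
    by (rule borel_measurable_matrix_inv, measurable)
      (rule pos_def_invertible[OF pos_def_congruence_add[OF S V]])
  show "(\<lambda>x. kalman_gain C V (S x)) \<in> borel_measurable M"
    and "(\<lambda>x. kalman_cov C V (S x)) \<in> borel_measurable M"
    unfolding kalman_cov_def kalman_gain_def by measurable
qed

section \<open>The filtering law of the system\<close>

text \<open>For one fixed event both kernels are densities of the same finite measure, hence agree
  almost surely. A countable generator closed under intersections merges the exceptional sets into
  one null set.\<close>

lemma regular_cond_law_unique:
  fixes \<kappa> \<kappa>' :: "'a \<Rightarrow> ('b :: second_countable_topology) measure"
  assumes D: "prob_space (distr L I fst)"
    and \<kappa>: "regular_cond_law L I borel \<kappa>" and \<kappa>': "regular_cond_law L I borel \<kappa>'"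
  shows "AE \<iota> in distr L I fst. \<kappa> \<iota> = \<kappa>' \<iota>"
proof -
  interpret prob_space "distr L I fst" by (rule D)
  have meas: "\<kappa> \<in> measurable I (prob_algebra borel)" "\<kappa>' \<in> measurable I (prob_algebra borel)"
    using \<kappa> \<kappa>' by (auto simp: regular_cond_law_def)
  have AE_X: "AE \<iota> in distr L I fst. emeasure (\<kappa> \<iota>) X = emeasure (\<kappa>' \<iota>) X" if "X \<in> sets borel" for X
  proof (rule density_unique_finite_measure)
    show "(\<lambda>\<iota>. emeasure (\<kappa> \<iota>) X) \<in> borel_measurable (distr L I fst)"
      "(\<lambda>\<iota>. emeasure (\<kappa>' \<iota>) X) \<in> borel_measurable (distr L I fst)"
      using measurable_prob_algebraD[OF meas(1)] measurable_prob_algebraD[OF meas(2)] that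
      by (simp_all add: measurable_emeasure_kernel)
    fix E assume "E \<in> sets (distr L I fst)"
    then have "E \<in> sets I" by simp
    then show "(\<integral>\<^sup>+\<iota>. emeasure (\<kappa> \<iota>) X * indicator E \<iota> \<partial>distr L I fst)
      = (\<integral>\<^sup>+\<iota>. emeasure (\<kappa>' \<iota>) X * indicator E \<iota> \<partial>distr L I fst)"
      using \<kappa> \<kappa>' that unfolding regular_cond_law_def by (simp add: mult.commute)
  qed simp_all
  obtain B :: "'b set set" where B: "countable B" "topological_basis B"
    using ex_countable_basis by blast
  \<comment> \<open>Finite intersections of a countable basis form a countable, intersection-stable
    generator; the empty family contributes \<open>UNIV\<close>, which serves as the exhausting set
    below.\<close>
  define G where "G = Inter ` {F. finite F \<and> F \<subseteq> B}"
  have "countable G"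
    unfolding G_def using B(1) by (intro countable_image countable_Collect_finite_subset)
  have borel_G: "G \<subseteq> sets borel"
    unfolding G_def using B(2)
    by (auto intro!: borel_open open_Inter simp: topological_basis_open)
  have G_Int: "Int_stable G"
    unfolding Int_stable_def G_def
  proof safe
    fix F H assume "finite F" "F \<subseteq> B" "finite H" "H \<subseteq> B"
    then show "\<Inter>F \<inter> \<Inter>H \<in> Inter ` {F. finite F \<and> F \<subseteq> B}"
      by (intro image_eqI[of _ _ "F \<union> H"]) auto
  qed
  have gen: "sets borel = sigma_sets UNIV G"
  proof
    have "B \<subseteq> G"
      unfolding G_def by (auto intro!: image_eqI[where x="{_}"])
    then show "sets borel \<subseteq> sigma_sets UNIV G"
      unfolding borel_eq_countable_basis[OF B] by (simp add: sigma_sets_mono')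
    show "sigma_sets UNIV G \<subseteq> sets borel"
      using borel_G sets.sigma_sets_subset[of G borel] by simp
  qed
  have "AE \<iota> in distr L I fst. \<forall>X\<in>G. emeasure (\<kappa> \<iota>) X = emeasure (\<kappa>' \<iota>) X"
    using AE_X borel_G by (subst AE_ball_countable[OF \<open>countable G\<close>]) auto
  with AE_space show ?thesis
  proof eventually_elim
    case (elim \<iota>)
    then have \<iota>: "\<iota> \<in> space I" by simp
    have prob: "prob_space (\<kappa> \<iota>)" "sets (\<kappa> \<iota>) = sets borel" "sets (\<kappa>' \<iota>) = sets borel"
      using measurable_space[OF meas(1) \<iota>] measurable_space[OF meas(2) \<iota>]
      by (auto simp: space_prob_algebra)
    show ?case
    proof (rule measure_eqI_generator_eq[of G UNIV _ _ "\<lambda>_. UNIV"])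
      show "range (\<lambda>_. UNIV) \<subseteq> G"
        unfolding G_def by (auto intro!: image_eqI[where x="{}"])
      show "emeasure (\<kappa> \<iota>) UNIV \<noteq> \<infinity>"
        using prob_space.emeasure_space_1[OF prob(1)] sets_eq_imp_space_eq[OF prob(2)] by simp
    qed (use elim(2) G_Int prob gen in auto)
  qed
qed

section \<open>Information vectors and the Gaussian conditional law\<close>

lemma measurable_info_update:
  assumes f: "f \<in> M \<rightarrow>\<^sub>M (info_algebra s :: ('p::finite, 'm::finite) info measure)"
    and g: "g \<in> borel_measurable M"
  shows "(\<lambda>x. (f x)(s := g x)) \<in> M \<rightarrow>\<^sub>M info_algebra (Suc s)"
proof -
  have "(\<lambda>x. (f x, g x)) \<in> M \<rightarrow>\<^sub>M PiM {..<s} (\<lambda>_. borel) \<Otimes>\<^sub>M borel"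
    using f g unfolding info_algebra_def by (rule measurable_Pair)
  from measurable_compose[OF this measurable_add_dim] show ?thesis
    by (simp add: info_algebra_def lessThan_Suc)
qed

lemma measurable_info_restrict:
  "(\<lambda>\<iota>. restrict \<iota> {..<s}) \<in> info_algebra (Suc s) \<rightarrow>\<^sub>M info_algebra s"
  unfolding info_algebra_def by (rule measurable_restrict_subset) auto

lemma measurable_info_last: "(\<lambda>\<iota>. \<iota> s) \<in> borel_measurable (info_algebra (Suc s))"
  unfolding info_algebra_def by (rule measurable_component_singleton) simp

text \<open>Information vectors are \<open>undefined\<close> outside their index range, so dropping
  the newly written coordinate recovers the old vector exactly.\<close>

lemma space_info_restrict:
  "\<iota> \<in> space (info_algebra s) \<Longrightarrow> restrict (\<iota>(s := a)) {..<s} = \<iota>"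
  by (auto simp: info_algebra_def space_PiM PiE_def extensional_def restrict_def fun_eq_iff)

text \<open>The invariant of the induction on time. Testing with all nonnegative measurable
  functions, instead of rectangles as in \<open>regular_cond_law\<close>, lets it pass through
  \<open>bind\<close>; measurable parameters keep the next kernel measurable.\<close>

definition gauss_disintegration ::
  "('a \<times> (real^'n)) measure \<Rightarrow> 'a measure \<Rightarrow> ('a \<Rightarrow> real^'n) \<Rightarrow> ('a \<Rightarrow> real^'n^'n) \<Rightarrow> bool" where
  "gauss_disintegration L I m S \<longleftrightarrow>
     m \<in> borel_measurable I \<and> S \<in> borel_measurable I \<and> (\<forall>\<iota>\<in>space I. pos_def (S \<iota>)) \<and>
     prob_space L \<and> sets L = sets (I \<Otimes>\<^sub>M borel) \<and>
     (\<forall>f\<in>borel_measurable (I \<Otimes>\<^sub>M borel).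
        (\<integral>\<^sup>+p. f p \<partial>L) = (\<integral>\<^sup>+\<iota>. \<integral>\<^sup>+x. f (\<iota>, x) \<partial>gauss (m \<iota>) (S \<iota>) \<partial>distr L I fst))"

lemma gauss_disintegration_prob_space_distr:
  assumes "gauss_disintegration L I m S"
  shows "prob_space (distr L I fst)"
proof -
  have "fst \<in> measurable L I"
    using assms measurable_fst[of I borel] unfolding gauss_disintegration_def
    by (simp cong: measurable_cong_sets)
  then show ?thesis
    using assms unfolding gauss_disintegration_def by (auto intro: prob_space.prob_space_distr)
qed

lemma gauss_disintegration_regular_cond_law:
  assumes "gauss_disintegration L I m S"
  shows "regular_cond_law L I borel (\<lambda>\<iota>. gauss (m \<iota>) (S \<iota>))"
  unfolding regular_cond_law_def
proof (intro conjI ballI)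
  show "(\<lambda>\<iota>. gauss (m \<iota>) (S \<iota>)) \<in> I \<rightarrow>\<^sub>M prob_algebra borel"
    using assms unfolding gauss_disintegration_def by (intro measurable_gauss_kernel) auto
  fix E and X :: "(real^'b) set"
  assume EX: "E \<in> sets I" "X \<in> sets borel"
  have "emeasure L (E \<times> X) = (\<integral>\<^sup>+p. indicator (E \<times> X) p \<partial>L)"
    using assms EX unfolding gauss_disintegration_def by (subst nn_integral_indicator) auto
  also have "\<dots> = (\<integral>\<^sup>+\<iota>. \<integral>\<^sup>+x. indicator (E \<times> X) (\<iota>, x) \<partial>gauss (m \<iota>) (S \<iota>) \<partial>distr L I fst)"
  proof -
    have "(indicator (E \<times> X) :: _ \<Rightarrow> ennreal) \<in> borel_measurable (I \<Otimes>\<^sub>M borel)"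
      using EX by (intro borel_measurable_indicator pair_measureI)
    then show ?thesis
      using assms unfolding gauss_disintegration_def by blast
  qed
  also have "\<dots> = (\<integral>\<^sup>+\<iota>. indicator E \<iota> * emeasure (gauss (m \<iota>) (S \<iota>)) X \<partial>distr L I fst)"
    using EX by (simp add: indicator_times nn_integral_cmult)
  finally show "emeasure L (E \<times> X) = \<dots>" .
qed

text \<open>Input and noise parameters are functions of the old information vector. Once that vector
  is fixed they are constants, and the one-step formula yields mean and covariance by the Kalman
  recursion.\<close>

lemma gauss_disintegration_step:
  fixes A :: "real^'n^'n" and B :: "real^'m^'n" and C :: "real^'n^'p"
    and L :: "(('p::finite, 'm::finite) info \<times> (real^'n::finite)) measure"
  assumes L: "gauss_disintegration L (info_algebra s) m S"
    and V: "pos_def V"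
    and u[measurable]: "u \<in> borel_measurable (info_algebra s)"
    and \<mu>[measurable]: "\<mu> \<in> borel_measurable (info_algebra s)"
    and W[measurable]: "W \<in> borel_measurable (info_algebra s)"
    and W_pos: "\<And>\<iota>. \<iota> \<in> space (info_algebra s) \<Longrightarrow> pos_def (W \<iota>)"
  defines "L' \<equiv> bind L (\<lambda>(\<iota>, x).
       distr (gauss 0 V \<Otimes>\<^sub>M gauss (\<mu> \<iota>) (W \<iota>)) (info_algebra (Suc s) \<Otimes>\<^sub>M borel)
         (\<lambda>(v, w). (next_info C s \<iota> (u \<iota>) x v, next_state A B (u \<iota>) x w)))"
  shows "\<exists>m' S'. gauss_disintegration L' (info_algebra (Suc s)) m' S'"
proof -
  let ?I = "info_algebra s :: ('p, 'm) info measure"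
  let ?J = "info_algebra (Suc s) :: ('p, 'm) info measure"
  interpret L: prob_space L
    using L by (simp add: gauss_disintegration_def)
  have m[measurable]: "m \<in> borel_measurable ?I" and S[measurable]: "S \<in> borel_measurable ?I"
    and S_pos: "\<And>\<iota>. \<iota> \<in> space ?I \<Longrightarrow> pos_def (S \<iota>)"
    and sets_L[measurable_cong]: "sets L = sets (?I \<Otimes>\<^sub>M borel)"
    and int_L: "\<And>f. f \<in> borel_measurable (?I \<Otimes>\<^sub>M borel) \<Longrightarrow>
        (\<integral>\<^sup>+p. f p \<partial>L) = (\<integral>\<^sup>+\<iota>. \<integral>\<^sup>+x. f (\<iota>, x) \<partial>gauss (m \<iota>) (S \<iota>) \<partial>distr L ?I fst)"
    using L unfolding gauss_disintegration_def by auto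
  let ?D = "distr L ?I fst"
  define K where "K = (\<lambda>(\<iota>, x).
       distr (gauss 0 V \<Otimes>\<^sub>M gauss (\<mu> \<iota>) (W \<iota>)) (?J \<Otimes>\<^sub>M borel)
         (\<lambda>(v, w). (next_info C s \<iota> (u \<iota>) x v, next_state A B (u \<iota>) x w)))"
  have step_meas: "(\<lambda>((\<iota>, x), v, w). (next_info C s \<iota> (u \<iota>) x v, next_state A B (u \<iota>) x w))
    \<in> (?I \<Otimes>\<^sub>M borel) \<Otimes>\<^sub>M (borel \<Otimes>\<^sub>M borel) \<rightarrow>\<^sub>M ?J \<Otimes>\<^sub>M borel"
    unfolding next_info_def next_state_def split_beta'
    by (intro measurable_Pair measurable_info_update) measurable
  have noise: "(\<lambda>p. gauss 0 V \<Otimes>\<^sub>M gauss (\<mu> (fst p)) (W (fst p)))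
    \<in> ?I \<Otimes>\<^sub>M borel \<rightarrow>\<^sub>M prob_algebra (borel \<Otimes>\<^sub>M borel)"
    using V W_pos by (intro measurable_pair_prob measurable_gauss_kernel) (auto simp: space_pair_measure)
  have K: "K \<in> L \<rightarrow>\<^sub>M prob_algebra (?J \<Otimes>\<^sub>M borel)"
  proof -
    have "K \<in> ?I \<Otimes>\<^sub>M borel \<rightarrow>\<^sub>M prob_algebra (?J \<Otimes>\<^sub>M borel)"
      unfolding K_def split_beta'
      by (rule measurable_distr_prob_space2[OF noise]) (use step_meas in \<open>simp add: split_beta'\<close>)
    then show ?thesis
      using sets_L by (simp cong: measurable_cong_sets)
  qed
  have int_K: "(\<integral>\<^sup>+q. f q \<partial>K (\<iota>, x)) =
    (\<integral>\<^sup>+v. \<integral>\<^sup>+w. f (\<iota>(s := (C *v x + v, u \<iota>)), A *v x + B *v u \<iota> + w) \<partial>gauss (\<mu> \<iota>) (W \<iota>) \<partial>gauss 0 V)"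
    if [measurable]: "f \<in> borel_measurable (?J \<Otimes>\<^sub>M borel)" and \<iota>: "\<iota> \<in> space ?I" for f \<iota> x
  proof -
    interpret w: prob_space "gauss (\<mu> \<iota>) (W \<iota>)" by (rule prob_space_gauss[OF W_pos[OF \<iota>]])
    have g: "(\<lambda>(v, w). (next_info C s \<iota> (u \<iota>) x v, next_state A B (u \<iota>) x w))
      \<in> gauss 0 V \<Otimes>\<^sub>M gauss (\<mu> \<iota>) (W \<iota>) \<rightarrow>\<^sub>M ?J \<Otimes>\<^sub>M borel"
      unfolding next_info_def next_state_def split_beta'
      using \<iota> by (intro measurable_Pair measurable_info_update) measurable
    have "(\<integral>\<^sup>+q. f q \<partial>K (\<iota>, x)) = (\<integral>\<^sup>+p. f (\<iota>(s := (C *v x + fst p, u \<iota>)), A *v x + B *v u \<iota> + snd p)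
        \<partial>(gauss 0 V \<Otimes>\<^sub>M gauss (\<mu> \<iota>) (W \<iota>)))"
      unfolding K_def prod.case
      by (subst nn_integral_distr[OF g]) (auto simp: next_info_def next_state_def split_beta')
    also have "\<dots> = (\<integral>\<^sup>+v. \<integral>\<^sup>+w. f (\<iota>(s := (C *v x + v, u \<iota>)), A *v x + B *v u \<iota> + w)
        \<partial>gauss (\<mu> \<iota>) (W \<iota>) \<partial>gauss 0 V)"
      using measurable_compose[OF g that(1)]
      by (subst w.nn_integral_fst[symmetric]) (simp_all add: next_info_def next_state_def split_beta')
    finally show ?thesis .
  qed
  have L': "L' = bind L K"
    by (simp add: L'_def K_def)
  have sets_L': "sets L' = sets (?J \<Otimes>\<^sub>M borel)"
    unfolding L' using measurable_prob_algebraD[OF K] L.not_empty by (rule sets_bind_measurable)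
  have prob_L': "prob_space L'"
    unfolding L' using measurable_space[OF K]
    by (intro L.prob_space_bind[OF _ measurable_prob_algebraD[OF K]])
      (auto simp: space_prob_algebra)
  \<comment> \<open>The new parameters must be functions of the new information vector alone: its
    restriction is the old vector, and the first component of its last entry is the
    measurement.\<close>
  define m' where "m' \<iota>' = (let \<iota> = restrict \<iota>' {..<s}; y = fst (\<iota>' s) in
      A *v (m \<iota> + kalman_gain C V (S \<iota>) *v (y - C *v m \<iota>)) + B *v u \<iota> + \<mu> \<iota>)" for \<iota>'
  define S' where "S' \<iota>' = (let \<iota> = restrict \<iota>' {..<s} in
      A ** kalman_cov C V (S \<iota>) ** transpose A + W \<iota>)" for \<iota>'
  have restr: "(\<lambda>\<iota>. restrict \<iota> {..<s}) \<in> ?J \<rightarrow>\<^sub>M ?I"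
    by (rule measurable_info_restrict)
  note [measurable] = measurable_compose[OF restr m] measurable_compose[OF restr u]
    measurable_compose[OF restr \<mu>] measurable_compose[OF restr W]
    measurable_compose[OF restr borel_measurable_kalman(1)[OF S S_pos V, of C]]
    measurable_compose[OF restr borel_measurable_kalman(2)[OF S S_pos V, of C]]
  have [measurable]: "(\<lambda>\<iota>. fst (\<iota> s)) \<in> borel_measurable ?J"
    by (rule measurable_compose[OF measurable_info_last]) (simp add: borel_prod[symmetric])
  have m'[measurable]: "m' \<in> borel_measurable ?J" and S'[measurable]: "S' \<in> borel_measurable ?J"
    unfolding m'_def S'_def Let_def by measurable
  have S'_pos: "pos_def (S' \<iota>')" if "\<iota>' \<in> space ?J" for \<iota>'
    using measurable_space[OF measurable_info_restrict that]
    unfolding S'_def Let_def by (intro pos_def_congruence_add pos_def_kalman_cov S_pos V W_pos)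
  \<comment> \<open>This is already a disintegration, except that the outer integrals run over the
    old vector and \<open>y\<close> instead of the law of the new vector.\<close>
  have int_L': "(\<integral>\<^sup>+q. f q \<partial>L') = (\<integral>\<^sup>+\<iota>. \<integral>\<^sup>+y.
      (\<integral>\<^sup>+x. f (\<iota>(s := (y, u \<iota>)), x) \<partial>gauss (m' (\<iota>(s := (y, u \<iota>)))) (S' (\<iota>(s := (y, u \<iota>)))))
      \<partial>gauss (C *v m \<iota>) (C ** S \<iota> ** transpose C + V) \<partial>?D)"
    if f[measurable]: "f \<in> borel_measurable (?J \<Otimes>\<^sub>M borel)" for f
  proof -
    have "(\<integral>\<^sup>+q. f q \<partial>L') = (\<integral>\<^sup>+p. \<integral>\<^sup>+q. f q \<partial>K p \<partial>L)"
      unfolding L' by (rule nn_integral_bind[OF f measurable_prob_algebraD[OF K]])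
    also have "\<dots> = (\<integral>\<^sup>+\<iota>. \<integral>\<^sup>+x. \<integral>\<^sup>+q. f q \<partial>K (\<iota>, x) \<partial>gauss (m \<iota>) (S \<iota>) \<partial>?D)"
      using measurable_prob_algebraD[OF K]
      by (intro int_L nn_integral_measurable_subprob_algebra2[of _ _ "?J \<Otimes>\<^sub>M borel"])
        (auto cong: measurable_cong_sets)
    also have "\<dots> = (\<integral>\<^sup>+\<iota>. \<integral>\<^sup>+y.
      (\<integral>\<^sup>+x. f (\<iota>(s := (y, u \<iota>)), x) \<partial>gauss (m' (\<iota>(s := (y, u \<iota>)))) (S' (\<iota>(s := (y, u \<iota>)))))
      \<partial>gauss (C *v m \<iota>) (C ** S \<iota> ** transpose C + V) \<partial>?D)"
    proof (rule nn_integral_cong)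
      fix \<iota> assume "\<iota> \<in> space ?D"
      then have \<iota>: "\<iota> \<in> space ?I" by simp
      have [measurable]: "(\<lambda>y. \<iota>(s := (y, u \<iota>))) \<in> borel \<rightarrow>\<^sub>M ?J"
        using \<iota> by (intro measurable_info_update) auto
      let ?f = "\<lambda>p. f (\<iota>(s := (fst p, u \<iota>)), B *v u \<iota> + snd p)"
      have f': "?f \<in> borel_measurable (borel \<Otimes>\<^sub>M borel)"
        by measurable
      have "(\<integral>\<^sup>+x. \<integral>\<^sup>+q. f q \<partial>K (\<iota>, x) \<partial>gauss (m \<iota>) (S \<iota>)) = (\<integral>\<^sup>+x. \<integral>\<^sup>+v. \<integral>\<^sup>+w.
          ?f (C *v x + v, A *v x + w) \<partial>gauss (\<mu> \<iota>) (W \<iota>) \<partial>gauss 0 V \<partial>gauss (m \<iota>) (S \<iota>))"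
        by (simp add: int_K[OF f \<iota>] add_ac)
      also have "\<dots> = (\<integral>\<^sup>+y. \<integral>\<^sup>+h. ?f (y, A *v (m \<iota> + kalman_gain C V (S \<iota>) *v (y - C *v m \<iota>)) + h)
        \<partial>gauss (\<mu> \<iota>) (A ** kalman_cov C V (S \<iota>) ** transpose A + W \<iota>)
        \<partial>gauss (C *v m \<iota>) (C ** S \<iota> ** transpose C + V))"
        by (rule gauss_step_nn_integral[OF S_pos[OF \<iota>] V W_pos[OF \<iota>] f'])
      also have "\<dots> = (\<integral>\<^sup>+y. \<integral>\<^sup>+x. f (\<iota>(s := (y, u \<iota>)), x)
        \<partial>gauss (\<mu> \<iota> + (A *v (m \<iota> + kalman_gain C V (S \<iota>) *v (y - C *v m \<iota>)) + B *v u \<iota>))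
          (A ** kalman_cov C V (S \<iota>) ** transpose A + W \<iota>)
        \<partial>gauss (C *v m \<iota>) (C ** S \<iota> ** transpose C + V))"
        by (subst nn_integral_gauss_translate) (measurable, simp add: add_ac)
      also have "\<dots> = (\<integral>\<^sup>+y.
        (\<integral>\<^sup>+x. f (\<iota>(s := (y, u \<iota>)), x) \<partial>gauss (m' (\<iota>(s := (y, u \<iota>)))) (S' (\<iota>(s := (y, u \<iota>)))))
        \<partial>gauss (C *v m \<iota>) (C ** S \<iota> ** transpose C + V))"
        by (simp add: m'_def S'_def space_info_restrict[OF \<iota>] add_ac)
      finally show "(\<integral>\<^sup>+x. \<integral>\<^sup>+q. f q \<partial>K (\<iota>, x) \<partial>gauss (m \<iota>) (S \<iota>)) = \<dots>" .
    qed
    finally show ?thesis .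
  qed
  have "(\<integral>\<^sup>+q. f q \<partial>L') = (\<integral>\<^sup>+\<iota>. \<integral>\<^sup>+x. f (\<iota>, x) \<partial>gauss (m' \<iota>) (S' \<iota>) \<partial>distr L' ?J fst)"
    if f[measurable]: "f \<in> borel_measurable (?J \<Otimes>\<^sub>M borel)" for f
  proof -
    let ?g = "\<lambda>\<iota>. \<integral>\<^sup>+x. f (\<iota>, x) \<partial>gauss (m' \<iota>) (S' \<iota>)"
    have ker: "(\<lambda>\<iota>. gauss (m' \<iota>) (S' \<iota>)) \<in> ?J \<rightarrow>\<^sub>M subprob_algebra borel"
      using m' S' S'_pos by (intro measurable_prob_algebraD measurable_gauss_kernel)
    have g[measurable]: "?g \<in> borel_measurable ?J"
      by (rule nn_integral_measurable_subprob_algebra2[OF _ ker]) simp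
    have upd: "\<iota>(s := (y, u \<iota>)) \<in> space ?J" if "\<iota> \<in> space ?I" for \<iota> y
      using that by (auto simp: info_algebra_def space_PiM PiE_def extensional_def)
    have one: "emeasure (gauss (m' (\<iota>(s := (y, u \<iota>)))) (S' (\<iota>(s := (y, u \<iota>))))) UNIV = 1"
      if "\<iota> \<in> space ?I" for \<iota> y
      using prob_space.emeasure_space_1[OF prob_space_gauss[OF S'_pos[OF upd[OF that]]]] by simp
    \<comment> \<open>The preceding formula is applied both to \<open>f\<close> and to
      \<open>?g\<close> of the first component. The latter is constant in the state, and a
      probability kernel leaves it unchanged, so both sides coincide.\<close>
    have "(\<integral>\<^sup>+\<iota>. ?g \<iota> \<partial>distr L' ?J fst) = (\<integral>\<^sup>+q. ?g (fst q) \<partial>L')"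
      using sets_L' by (subst nn_integral_distr) (auto cong: measurable_cong_sets)
    also have "\<dots> = (\<integral>\<^sup>+q. f q \<partial>L')"
      by (subst (1 2) int_L')
        (auto intro!: nn_integral_cong simp: one)
    finally show ?thesis by simp
  qed
  then show ?thesis
    using m' S' S'_pos prob_L' sets_L' unfolding gauss_disintegration_def by blast
qed


text \<open>The information vector of time 0 is empty: its space has the single point
  \<open>\<lambda>_. undefined\<close>, and conditioning on it is trivial.\<close>

lemma gauss_disintegration_init:
  fixes X0 :: "real^'n^'n"
  assumes X0: "pos_def X0"
  shows "gauss_disintegration
    (distr (gauss 0 X0) (info_algebra 0 \<Otimes>\<^sub>M borel) (\<lambda>x. (\<lambda>_. undefined, x)))
    (info_algebra 0 :: ('p::finite, 'm::finite) info measure) (\<lambda>_. 0) (\<lambda>_. X0)"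
proof -
  let ?I = "info_algebra 0 :: ('p, 'm) info measure"
  let ?L = "distr (gauss 0 X0) (?I \<Otimes>\<^sub>M borel) (\<lambda>x. (\<lambda>_. undefined, x))"
  interpret prob_space "gauss 0 X0" by (rule prob_space_gauss[OF X0])
  have undef: "(\<lambda>_. undefined) \<in> space ?I"
    by (simp add: info_algebra_def space_PiM)
  then have meas[measurable]: "(\<lambda>x. (\<lambda>_. undefined, x)) \<in> gauss 0 X0 \<rightarrow>\<^sub>M ?I \<Otimes>\<^sub>M borel"
    by measurable
  have "(\<integral>\<^sup>+p. f p \<partial>?L) = (\<integral>\<^sup>+\<iota>. \<integral>\<^sup>+x. f (\<iota>, x) \<partial>gauss 0 X0 \<partial>distr ?L ?I fst)"
    if [measurable]: "f \<in> borel_measurable (?I \<Otimes>\<^sub>M borel)" for f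
  proof -
    have [measurable]: "(\<lambda>\<iota>. \<integral>\<^sup>+x. f (\<iota>, x) \<partial>gauss 0 X0) \<in> borel_measurable ?I"
      by (rule borel_measurable_nn_integral_gauss[OF X0]) simp
    show ?thesis
      by (simp add: nn_integral_distr emeasure_space_1[simplified])
  qed
  then show ?thesis
    using X0 prob_space_distr[OF meas] by (simp add: gauss_disintegration_def)
qed

lemma system_law_disintegration:
  fixes A :: "real^'n^'n" and B :: "real^'m^'n" and C :: "real^'n^'p"
  assumes X0: "pos_def X0" and V: "\<And>s. pos_def (V s)"
    and \<pi>: "\<And>s. s < t \<Longrightarrow> \<pi> s \<in> borel_measurable (info_algebra s)"
    and \<mu>: "\<And>s. s < t \<Longrightarrow> \<mu> s \<in> borel_measurable (info_algebra s)"
    and W: "\<And>s. s < t \<Longrightarrow> W s \<in> borel_measurable (info_algebra s)"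
    and W_pos: "\<And>s \<iota>. s < t \<Longrightarrow> \<iota> \<in> space (info_algebra s) \<Longrightarrow> pos_def (W s \<iota>)"
  shows "s \<le> t \<Longrightarrow> \<exists>m S. gauss_disintegration (system_law A B C X0 V \<pi> \<mu> W s) (info_algebra s) m S"
proof (induction s)
  case 0
  show ?case
    using gauss_disintegration_init[OF X0] by auto
next
  case (Suc s)
  then obtain m S where "gauss_disintegration (system_law A B C X0 V \<pi> \<mu> W s) (info_algebra s) m S"
    by auto
  from gauss_disintegration_step[OF this V \<pi> \<mu> W W_pos] Suc.prems show ?case
    by simp
qed

text \<open>This is all that the stage problem takes from the filter: the parameters are afterwards
  read off from \<open>\<kappa> \<iota>\<close> as its mean and covariance.\<close>

lemma regular_cond_law_gauss:
  assumes L: "gauss_disintegration L I m S" and \<kappa>: "regular_cond_law L I borel \<kappa>"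
  shows "AE \<iota> in distr L I fst. \<iota> \<in> space I \<and> (\<exists>m S. pos_def S \<and> \<kappa> \<iota> = gauss m S)"
  using regular_cond_law_unique[OF gauss_disintegration_prob_space_distr[OF L] \<kappa>
      gauss_disintegration_regular_cond_law[OF L]] AE_space
  by eventually_elim (use L in \<open>auto simp: gauss_disintegration_def\<close>)

section \<open>The objective of the stage problem\<close>

lemma distr_components_of_distr_pair:
  assumes N: "prob_space N" and G: "prob_space G" and H: "prob_space H"
    and sets: "sets G = sets S" "sets H = sets T"
    and Y[measurable]: "Y \<in> N \<rightarrow>\<^sub>M S" and Z[measurable]: "Z \<in> N \<rightarrow>\<^sub>M T"
    and law: "distr N (S \<Otimes>\<^sub>M T) (\<lambda>\<omega>. (Y \<omega>, Z \<omega>)) = G \<Otimes>\<^sub>M H"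
  shows "distr N S Y = G" and "distr N T Z = H"
proof -
  interpret N: prob_space N by (rule N)
  interpret G: prob_space G by (rule G)
  interpret H: prob_space H by (rule H)
  have "distr N S Y = distr (distr N (S \<Otimes>\<^sub>M T) (\<lambda>\<omega>. (Y \<omega>, Z \<omega>))) S fst"
    by (subst distr_distr) (auto simp: comp_def)
  also have "\<dots> = distr (G \<Otimes>\<^sub>M H) G fst"
    unfolding law by (rule distr_cong) (simp_all add: sets)
  finally show "distr N S Y = G"
    by (simp add: H.distr_pair_fst)
  have sp: "space G = space S" "space H = space T"
    using sets by (auto dest: sets_eq_imp_space_eq)
  show "distr N T Z = H"
  proof (rule measure_eqI)
    fix X assume "X \<in> sets (distr N T Z)"
    then have X[measurable]: "X \<in> sets T" by simp
    have "emeasure (distr N T Z) X = emeasure (distr N (S \<Otimes>\<^sub>M T) (\<lambda>\<omega>. (Y \<omega>, Z \<omega>))) (space S \<times> X)"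
      using X measurable_space[OF Y]
      by (subst (1 2) emeasure_distr) (auto intro!: arg_cong[where f="emeasure N"])
    also have "\<dots> = emeasure H X"
      unfolding law using X sets by (subst H.emeasure_pair_measure_Times)
        (auto simp: sp[symmetric] G.emeasure_space_1)
    finally show "emeasure (distr N T Z) X = emeasure H X" .
  qed (simp add: sets)
qed

text \<open>On a set of \<open>F\<close> the indicator is a function of \<open>Y\<close>, hence
  independent of \<open>b (Z \<omega>)\<close>. That term can therefore be replaced by its
  expectation, while \<open>a (Y \<omega>)\<close> is already measurable for
  \<open>F\<close>.\<close>

lemma (in prob_space) real_cond_exp_indep_add:
  fixes a :: "'b \<Rightarrow> real" and b :: "'c \<Rightarrow> real"
  assumes Y[measurable]: "Y \<in> M \<rightarrow>\<^sub>M S" and Z[measurable]: "Z \<in> M \<rightarrow>\<^sub>M T"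
    and law: "distr M (S \<Otimes>\<^sub>M T) (\<lambda>\<omega>. (Y \<omega>, Z \<omega>)) = distr M S Y \<Otimes>\<^sub>M distr M T Z"
    and F: "subalgebra M F"
    and F_sets: "\<And>E. E \<in> sets F \<Longrightarrow> \<exists>E'\<in>sets S. E = Y -` E' \<inter> space M"
    and a[measurable]: "a \<in> borel_measurable S" and b[measurable]: "b \<in> borel_measurable T"
    and aF: "(\<lambda>\<omega>. a (Y \<omega>)) \<in> borel_measurable F"
    and a_int: "integrable M (\<lambda>\<omega>. a (Y \<omega>))" and b_int: "integrable M (\<lambda>\<omega>. b (Z \<omega>))"
  shows "AE \<omega> in M. real_cond_exp M F (\<lambda>\<omega>. a (Y \<omega>) + b (Z \<omega>)) \<omega> = a (Y \<omega>) + expectation (\<lambda>\<omega>. b (Z \<omega>))"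
proof -
  interpret F: finite_measure_subalgebra M F
    by unfold_locales (rule F)
  show ?thesis
  proof (rule F.real_cond_exp_charact)
    fix E assume E: "E \<in> sets F"
    from F_sets[OF this] obtain E' where E': "E' \<in> sets S" "E = Y -` E' \<inter> space M" by auto
    note [measurable] = E'(1)
    have E_M[measurable]: "E \<in> sets M"
      using E F by (auto simp: subalgebra_def)
    have ind: "indicator E \<omega> = (indicator E' (Y \<omega>) :: real)" if "\<omega> \<in> space M" for \<omega>
      using that by (auto simp: E'(2) indicator_def)
    have ind_int: "integrable M (\<lambda>\<omega>. indicator E' (Y \<omega>) :: real)"
      by (rule integrable_const_bound[where B=1]) (auto simp: indicator_def)
    interpret Z: prob_space "distr M T Z" by (rule prob_space_distr) simp
    interpret bZ: prob_space "distr (distr M T Z) borel b" by (rule Z.prob_space_distr) simp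
    \<comment> \<open>Independence of the two real variables is obtained by pushing the product law
      of \<open>Y\<close> and \<open>Z\<close> forward through the indicator and
      \<open>b\<close>.\<close>
    have "distr M borel (\<lambda>\<omega>. indicator E' (Y \<omega>) :: real) \<Otimes>\<^sub>M distr M borel (\<lambda>\<omega>. b (Z \<omega>))
      = distr (distr M S Y) borel (indicator E' :: _ \<Rightarrow> real) \<Otimes>\<^sub>M distr (distr M T Z) borel b"
      by (subst (1 2) distr_distr) (auto simp: comp_def)
    also have "\<dots> = distr (distr M S Y \<Otimes>\<^sub>M distr M T Z) (borel \<Otimes>\<^sub>M borel) (\<lambda>(y, z). (indicator E' y, b z))"
      by (rule pair_measure_distr) (simp_all add: bZ.sigma_finite_measure_axioms)
    also have "\<dots> = distr M (borel \<Otimes>\<^sub>M borel) (\<lambda>\<omega>. (indicator E' (Y \<omega>), b (Z \<omega>)))"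
      unfolding law[symmetric] by (subst distr_distr) (auto simp: comp_def)
    finally have indep': "indep_var borel (\<lambda>\<omega>. indicator E' (Y \<omega>) :: real) borel (\<lambda>\<omega>. b (Z \<omega>))"
      unfolding indep_var_distribution_eq by simp
    have prod: "integrable M (\<lambda>\<omega>. indicator E' (Y \<omega>) * b (Z \<omega>))"
      "(\<integral>\<omega>. indicator E' (Y \<omega>) * b (Z \<omega>) \<partial>M) =
        (\<integral>\<omega>. indicator E' (Y \<omega>) \<partial>M) * expectation (\<lambda>\<omega>. b (Z \<omega>))"
      using indep_var_integrable[OF indep' ind_int b_int]
        indep_var_lebesgue_integral[OF indep' ind_int b_int] by simp_all
    have prod_a: "integrable M (\<lambda>\<omega>. indicator E' (Y \<omega>) * a (Y \<omega>))"
      by (rule Bochner_Integration.integrable_bound[OF a_int]) (auto simp: indicator_def)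
    have set_eq: "(\<integral>\<omega>\<in>E. f \<omega> \<partial>M) = (\<integral>\<omega>. indicator E' (Y \<omega>) * f \<omega> \<partial>M)" for f :: "'a \<Rightarrow> real"
      unfolding set_lebesgue_integral_def by (rule Bochner_Integration.integral_cong) (auto simp: ind)
    show "(\<integral>\<omega>\<in>E. a (Y \<omega>) + b (Z \<omega>) \<partial>M) = (\<integral>\<omega>\<in>E. a (Y \<omega>) + expectation (\<lambda>\<omega>. b (Z \<omega>)) \<partial>M)"
      unfolding set_eq distrib_left
      using prod prod_a ind_int by simp
  qed (use a_int b_int aF in \<open>auto intro!: borel_measurable_add\<close>)
qed

lemma nn_integral_triple_product:
  assumes "prob_space G" "prob_space H" and f: "f \<in> borel_measurable (K \<Otimes>\<^sub>M G \<Otimes>\<^sub>M H)"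
  shows "(\<integral>\<^sup>+\<omega>. f \<omega> \<partial>(K \<Otimes>\<^sub>M G \<Otimes>\<^sub>M H)) = (\<integral>\<^sup>+x. \<integral>\<^sup>+v. \<integral>\<^sup>+w. f (x, v, w) \<partial>H \<partial>G \<partial>K)"
proof -
  interpret H: prob_space H by (rule assms)
  interpret GH: prob_space "G \<Otimes>\<^sub>M H" by (rule prob_space_pair[OF assms(1,2)])
  have "(\<integral>\<^sup>+x. \<integral>\<^sup>+p. f (x, p) \<partial>(G \<Otimes>\<^sub>M H) \<partial>K) = (\<integral>\<^sup>+x. \<integral>\<^sup>+v. \<integral>\<^sup>+w. f (x, v, w) \<partial>H \<partial>G \<partial>K)"
    by (intro nn_integral_cong H.nn_integral_fst[symmetric] measurable_compose[OF measurable_Pair1' f])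
  then show ?thesis
    using GH.nn_integral_fst[OF f] by simp
qed

text \<open>\<open>Y\<close> is the new measurement, and \<open>Z\<close> is the filter error
  propagated by \<open>A\<close> plus the process noise. The product form of the law is the
  independence on which the conditional expectations rest.\<close>

lemma stage_law:
  fixes S :: "real^'n^'n" and C :: "real^'n^'p" and A :: "real^'n^'n" and m \<mu>
  assumes S: "pos_def S" and V: "pos_def V" and W: "pos_def W"
  defines "N \<equiv> gauss m S \<Otimes>\<^sub>M gauss 0 V \<Otimes>\<^sub>M gauss \<mu> W"
  defines "Y \<equiv> (\<lambda>(x, v, w). C *v x + v)"
  defines "Z \<equiv> (\<lambda>(x, v, w). A *v (x - (m + kalman_gain C V S *v (C *v x + v - C *v m))) + w)"
  shows "distr N (borel \<Otimes>\<^sub>M borel) (\<lambda>\<omega>. (Y \<omega>, Z \<omega>))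
    = gauss (C *v m) (C ** S ** transpose C + V) \<Otimes>\<^sub>M gauss \<mu> (A ** kalman_cov C V S ** transpose A + W)"
    (is "_ = ?G \<Otimes>\<^sub>M ?H")
proof (rule measure_eqI)
  have meas[measurable]: "(\<lambda>\<omega>. (Y \<omega>, Z \<omega>)) \<in> N \<rightarrow>\<^sub>M borel \<Otimes>\<^sub>M borel"
    unfolding N_def Y_def Z_def split_beta' by measurable
  have T: "pos_def (C ** S ** transpose C + V)"
    by (rule pos_def_congruence_add[OF S V])
  have H: "pos_def (A ** kalman_cov C V S ** transpose A + W)"
    by (rule pos_def_congruence_add[OF pos_def_kalman_cov[OF S V] W])
  interpret H: prob_space ?H by (rule prob_space_gauss[OF H])
  fix X assume "X \<in> sets (distr N (borel \<Otimes>\<^sub>M borel) (\<lambda>\<omega>. (Y \<omega>, Z \<omega>)))"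
  then have X[measurable]: "X \<in> sets (borel \<Otimes>\<^sub>M borel)" by simp
  let ?h = "\<lambda>y. m + kalman_gain C V S *v (y - C *v m)"
  \<comment> \<open>Subtracting the propagated estimate turns the second coordinate of the one-step
    formula into \<open>Z\<close>.\<close>
  let ?f = "\<lambda>p. indicator X (fst p, snd p - A *v ?h (fst p)) :: ennreal"
  have "emeasure (distr N (borel \<Otimes>\<^sub>M borel) (\<lambda>\<omega>. (Y \<omega>, Z \<omega>))) X
    = (\<integral>\<^sup>+\<omega>. indicator X (Y \<omega>, Z \<omega>) \<partial>N)"
    by (subst nn_integral_indicator[symmetric], simp, subst nn_integral_distr) simp_all
  also have "\<dots> = (\<integral>\<^sup>+x. \<integral>\<^sup>+v. \<integral>\<^sup>+w. ?f (C *v x + v, A *v x + w)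
      \<partial>gauss \<mu> W \<partial>gauss 0 V \<partial>gauss m S)"
    unfolding N_def using meas[unfolded N_def]
    by (subst nn_integral_triple_product[OF prob_space_gauss[OF V] prob_space_gauss[OF W]])
      (simp_all add: Y_def Z_def matrix_vector_mult_diff_distrib algebra_simps)
  also have "\<dots> = (\<integral>\<^sup>+y. \<integral>\<^sup>+h. ?f (y, A *v ?h y + h) \<partial>?H \<partial>?G)"
    by (rule gauss_step_nn_integral[OF S V W]) measurable
  also have "\<dots> = (\<integral>\<^sup>+p. indicator X p \<partial>(?G \<Otimes>\<^sub>M ?H))"
    by (subst H.nn_integral_fst[symmetric]) simp_all
  also have "\<dots> = emeasure (?G \<Otimes>\<^sub>M ?H) X"
    by (rule nn_integral_indicator) simp
  finally show "emeasure (distr N (borel \<Otimes>\<^sub>M borel) (\<lambda>\<omega>. (Y \<omega>, Z \<omega>))) X = \<dots>" .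
qed simp

text \<open>The quadratic cost of the next state is integrated without conditioning, so its
  unconditional law is needed besides the decomposition into measurement and error.\<close>

lemma state_law:
  fixes S :: "real^'n^'n" and A :: "real^'n^'n" and V :: "real^'p^'p" and m \<mu>
  assumes S: "pos_def S" and V: "pos_def V" and W: "pos_def W"
  defines "N \<equiv> gauss m S \<Otimes>\<^sub>M gauss 0 V \<Otimes>\<^sub>M gauss \<mu> W"
  shows "distr N borel (\<lambda>(x, v, w). A *v x + w) = gauss (A *v m + \<mu>) (A ** S ** transpose A + W)"
proof (rule measure_eqI)
  have meas[measurable]: "(\<lambda>(x, v, w). A *v x + w) \<in> N \<rightarrow>\<^sub>M borel"
    unfolding N_def split_beta' by measurable
  fix X assume "X \<in> sets (distr N borel (\<lambda>(x, v, w). A *v x + w))"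
  then have X[measurable]: "X \<in> sets borel" by simp
  have "emeasure (distr N borel (\<lambda>(x, v, w). A *v x + w)) X
    = (\<integral>\<^sup>+\<omega>. indicator X ((\<lambda>(x, v, w). A *v x + w) \<omega>) \<partial>N)"
    by (subst nn_integral_indicator[symmetric], simp, subst nn_integral_distr) simp_all
  also have "\<dots> = (\<integral>\<^sup>+x. \<integral>\<^sup>+v. \<integral>\<^sup>+w. indicator X (A *v x + w) \<partial>gauss \<mu> W \<partial>gauss 0 V \<partial>gauss m S)"
    unfolding N_def using meas[unfolded N_def]
    by (subst nn_integral_triple_product[OF prob_space_gauss[OF V] prob_space_gauss[OF W]]) simp_all
  also have "\<dots> = (\<integral>\<^sup>+x. \<integral>\<^sup>+w. indicator X (A *v x + w) \<partial>gauss \<mu> W \<partial>gauss m S)"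
    using nn_integral_prob_const[OF prob_space_gauss[OF V]] by simp
  also have "\<dots> = emeasure (gauss (A *v m + \<mu>) (A ** S ** transpose A + W)) X"
    by (subst gauss_convolution_nn_integral[OF S W]) simp_all
  finally show "emeasure (distr N borel (\<lambda>(x, v, w). A *v x + w)) X = \<dots>" .
qed simp

lemma gauss_law_moments:
  fixes X :: "'a \<Rightarrow> real^'n" and M :: "real^'n^'n"
  assumes X: "X \<in> borel_measurable N" and law: "distr N borel X = gauss m S" and S: "pos_def S"
  shows "integrable N (\<lambda>\<omega>. X \<omega> $ i)" and "(\<integral>\<omega>. X \<omega> $ i \<partial>N) = m $ i"
    and "integrable N (\<lambda>\<omega>. (X \<omega> - c) \<bullet> (M *v (X \<omega> - c)))"
    and "(\<integral>\<omega>. (X \<omega> - c) \<bullet> (M *v (X \<omega> - c)) \<partial>N) = (m - c) \<bullet> (M *v (m - c)) + trace (M ** S)"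
proof -
  have comp: "axis i 1 \<bullet> x = x $ i" for x :: "real^'n"
    by (simp add: inner_axis')
  show "integrable N (\<lambda>\<omega>. X \<omega> $ i)"
    using gauss_linear_form(1)[OF S, of m "axis i 1"] X
    unfolding law[symmetric] comp by (subst (asm) integrable_distr_eq) auto
  show "(\<integral>\<omega>. X \<omega> $ i \<partial>N) = m $ i"
    using gauss_linear_form(2)[OF S, of m "axis i 1"] X
    unfolding law[symmetric] comp by (subst (asm) integral_distr) auto
  show "integrable N (\<lambda>\<omega>. (X \<omega> - c) \<bullet> (M *v (X \<omega> - c)))"
    using gauss_centered_quadratic_form(1)[OF S, of m c M] X
    unfolding law[symmetric] by (subst (asm) integrable_distr_eq) auto
  show "(\<integral>\<omega>. (X \<omega> - c) \<bullet> (M *v (X \<omega> - c)) \<partial>N) = (m - c) \<bullet> (M *v (m - c)) + trace (M ** S)"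
    using gauss_centered_quadratic_form(2)[OF S, of m c M] X
    unfolding law[symmetric] by (subst (asm) integral_distr) auto
qed

text \<open>\<open>riccati_r\<close> is the cost of the propagated filter error. The process noise
  adds its own trace, so the adversary's choice at this stage does not enter
  \<open>riccati_r\<close>.\<close>

lemma trace_kalman_cov_eq_riccati_r:
  fixes A S1 X :: "real^'n^'n" and C :: "real^'n^'p"
  shows "1/2 * trace (S1 ** (A ** kalman_cov C V X ** transpose A + W)) =
    riccati_r A C V S1 X + 1/2 * trace (S1 ** W)"
proof -
  have "S1 ** (A ** kalman_cov C V X ** transpose A + W) = S1 ** (A ** X ** transpose A
       - A ** X ** transpose C ** matrix_inv (C ** X ** transpose C + V) ** C ** X ** transpose A) + S1 ** W"
    by (simp add: matrix_eq kalman_cov_def kalman_gain_def matrix_vector_mul_assoc[symmetric]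
        matrix_vector_mult_add_rdistrib matrix_vector_mult_diff_rdistrib
        matrix_vector_right_distrib matrix_vector_mult_diff_distrib del: transpose_matrix_vector)
  then show ?thesis
    by (simp add: riccati_r_def trace_add)
qed

text \<open>The next state is a function of the measurement \<open>Y\<close> plus \<open>Z\<close>, which is independent of
  \<open>Y\<close>; this gives its conditional expectation, and the error is \<open>Z - \<mu>\<close>.\<close>

lemma stage_objective_gauss:
  fixes A :: "real^'n^'n" and B :: "real^'m^'n" and C :: "real^'n^'p" and S :: "real^'n^'n"
    and \<iota> :: "('p::finite, 'm::finite) info"
  assumes S: "pos_def S" and V: "pos_def V" and W: "pos_def W" and What: "pos_def What"
    and \<iota>: "\<iota> \<in> space (info_algebra t)"
  shows "stage_objective A B C Q R P S1 z \<tau> V What t \<iota> (gauss m S) u \<mu> W =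
    1/2 * (m \<bullet> (Q *v m) + trace (Q ** S) + u \<bullet> (R *v u))
    + 1/2 * ((A *v m + B *v u + \<mu>) \<bullet> (P *v (A *v m + B *v u + \<mu>)) + trace (P ** (A ** S ** transpose A + W)))
    + riccati_r A C V S1 S + 1/2 * trace (S1 ** W) + z
    - \<tau> * ((\<mu> \<bullet> (matrix_inv What *v \<mu>) + trace (matrix_inv What ** W) - real CARD('n)
        + ln (det What / det W)) / 2)"
proof -
  define N where "N = gauss m S \<Otimes>\<^sub>M gauss 0 V \<Otimes>\<^sub>M gauss \<mu> W"
  define X' where "X' = (\<lambda>(x :: real^'n, v :: real^'p, w). next_state A B u x w)"
  define I' where "I' = (\<lambda>(x, v, w :: real^'n). next_info C t \<iota> u x v)"
  define F where "F = vimage_algebra (space N) I' (info_algebra (Suc t))"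
  define Y where "Y = (\<lambda>(x, v, w :: real^'n). C *v x + v)"
  define Z where "Z = (\<lambda>(x, v, w). A *v (x - (m + kalman_gain C V S *v (C *v x + v - C *v m))) + w)"
  define X1 where "X1 = (\<lambda>(x, v :: real^'p, w). A *v x + w)"
  define g where "g y = A *v (m + kalman_gain C V S *v (y - C *v m)) + B *v u" for y
  let ?T = "C ** S ** transpose C + V"
  let ?W' = "A ** kalman_cov C V S ** transpose A + W"
  note prob = prob_space_gauss[OF S, of m] prob_space_gauss[OF V, of 0] prob_space_gauss[OF W, of \<mu>]
  have pos: "pos_def ?T" "pos_def ?W'" "pos_def (A ** S ** transpose A + W)"
    using pos_def_congruence_add[OF S V] pos_def_congruence_add[OF pos_def_kalman_cov[OF S V] W]
      pos_def_congruence_add[OF S W] by auto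
  interpret N: prob_space N
    unfolding N_def by (intro prob_space_pair prob)
  interpret VW: prob_space "gauss 0 V \<Otimes>\<^sub>M gauss \<mu> W"
    by (intro prob_space_pair prob)
  have meas[measurable]: "Y \<in> borel_measurable N" "Z \<in> borel_measurable N" "X1 \<in> borel_measurable N"
    "fst \<in> borel_measurable N"
    unfolding N_def Y_def Z_def X1_def split_beta' by measurable
  have [measurable]: "g \<in> borel_measurable borel"
    unfolding g_def by measurable
  \<comment> \<open>The first form isolates what the measurement determines. The second writes the
    input as a centring by \<open>- (B *v u)\<close>, the shape in which the moment formulas are
    stated.\<close>
  have X'_eq: "X' \<omega> = g (Y \<omega>) + Z \<omega>" "X' \<omega> = X1 \<omega> - - (B *v u)" for \<omega>
    by (simp_all add: X'_def g_def Y_def Z_def X1_def next_state_def split_beta' algebra_simps)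
  have [measurable]: "X' \<in> borel_measurable N"
    unfolding X'_eq(1)[abs_def] by measurable
  have I'_eq: "I' \<omega> = \<iota>(t := (Y \<omega>, u))" for \<omega>
    by (simp add: I'_def Y_def next_info_def split_beta')
  have upd: "(\<lambda>y. \<iota>(t := (y, u))) \<in> borel \<rightarrow>\<^sub>M info_algebra (Suc t)"
    using \<iota> by (intro measurable_info_update) auto
  have I'_meas: "I' \<in> N \<rightarrow>\<^sub>M info_algebra (Suc t)"
    unfolding I'_eq[abs_def] by (rule measurable_compose[OF meas(1) upd])
  then have I'_space: "I' \<in> space N \<rightarrow> space (info_algebra (Suc t))"
    by (auto dest: measurable_space)
  have sets_F: "sets F = {I' -` D \<inter> space N |D. D \<in> sets (info_algebra (Suc t))}"
    unfolding F_def by (rule sets_vimage_algebra2[OF I'_space])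
  have F: "subalgebra N F"
    unfolding subalgebra_def sets_F
    using measurable_sets[OF I'_meas] by (auto simp: F_def)
  interpret F: finite_measure_subalgebra N F
    by unfold_locales (rule F)
  \<comment> \<open>With \<open>\<iota>\<close> and \<open>u\<close> fixed, the new information
    vector carries exactly the information of \<open>Y\<close>; this claim and \<open>YF\<close> are
    the two directions.\<close>
  have F_sets: "\<exists>E'\<in>sets borel. E = Y -` E' \<inter> space N" if E: "E \<in> sets F" for E
  proof -
    obtain D where D: "D \<in> sets (info_algebra (Suc t))" "E = I' -` D \<inter> space N"
      using E unfolding sets_F by auto
    show ?thesis
      using measurable_sets[OF upd D(1)] D(2)
      by (intro bexI[of _ "(\<lambda>y. \<iota>(t := (y, u))) -` D"]) (auto simp: I'_eq)
  qed
  have YF: "Y \<in> borel_measurable F"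
  proof -
    have "(\<lambda>\<omega>. fst (I' \<omega> t)) \<in> borel_measurable F"
      unfolding F_def
      by (rule measurable_compose[OF measurable_vimage_algebra1[OF I'_space]],
          rule measurable_compose[OF measurable_info_last]) (simp add: borel_prod[symmetric])
    then show ?thesis
      by (simp add: I'_eq)
  qed
  have YZ: "distr N (borel \<Otimes>\<^sub>M borel) (\<lambda>\<omega>. (Y \<omega>, Z \<omega>)) = gauss (C *v m) ?T \<Otimes>\<^sub>M gauss \<mu> ?W'"
    unfolding N_def Y_def Z_def by (rule stage_law[OF S V W])
  note YZ' = distr_components_of_distr_pair[OF N.prob_space_axioms prob_space_gauss[OF pos(1)]
      prob_space_gauss[OF pos(2)] sets_gauss sets_gauss meas(1,2) YZ]
  have X1_law: "distr N borel X1 = gauss (A *v m + \<mu>) (A ** S ** transpose A + W)"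
    unfolding N_def X1_def by (rule state_law[OF S V W])
  have fst_law: "distr N borel fst = gauss m S"
    using VW.distr_pair_fst[of "gauss m S"] unfolding N_def[symmetric]
    by (metis distr_cong sets_gauss)
  note Z_mom = gauss_law_moments[OF meas(2) YZ'(2) pos(2)]
  note X1_mom = gauss_law_moments[OF meas(3) X1_law pos(3)]
  note fst_mom = gauss_law_moments[OF meas(4) fst_law S]
  have X'_int: "integrable N (\<lambda>\<omega>. X' \<omega> $ i)" for i
    unfolding X'_eq(2) using X1_mom(1)[of i] by simp
  have AE_i: "AE \<omega> in N. real_cond_exp N F (\<lambda>\<omega>. X' \<omega> $ i) \<omega> = g (Y \<omega>) $ i + \<mu> $ i" for i
  proof -
    have "integrable N (\<lambda>\<omega>. X' \<omega> $ i - Z \<omega> $ i)"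
      using X'_int Z_mom(1) by (rule Bochner_Integration.integrable_diff)
    then have gY_int: "integrable N (\<lambda>\<omega>. g (Y \<omega>) $ i)"
      by (simp add: X'_eq(1))
    have "AE \<omega> in N. real_cond_exp N F (\<lambda>\<omega>. g (Y \<omega>) $ i + Z \<omega> $ i) \<omega>
      = g (Y \<omega>) $ i + N.expectation (\<lambda>\<omega>. Z \<omega> $ i)"
    proof (rule N.real_cond_exp_indep_add[where S=borel and T=borel and Y=Y and Z=Z
          and a="\<lambda>y. g y $ i" and b="\<lambda>z. z $ i"])
      show "distr N (borel \<Otimes>\<^sub>M borel) (\<lambda>x. (Y x, Z x)) = distr N borel Y \<Otimes>\<^sub>M distr N borel Z"
        by (simp add: YZ YZ')
      show "(\<lambda>\<omega>. g (Y \<omega>) $ i) \<in> borel_measurable F"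
        by (rule measurable_compose[OF YF]) measurable
    qed (use F F_sets gY_int Z_mom(1) in auto)
    then show ?thesis
      by (simp add: X'_eq(1) Z_mom(2))
  qed
  define \<xi> where "\<xi> \<omega> = X' \<omega> - vec_cond_exp N F X' \<omega>" for \<omega>
  have \<xi>_AE: "AE \<omega> in N. \<xi> \<omega> = Z \<omega> - \<mu>"
  proof -
    have "AE \<omega> in N. \<forall>i\<in>UNIV. real_cond_exp N F (\<lambda>\<omega>. X' \<omega> $ i) \<omega> = g (Y \<omega>) $ i + \<mu> $ i"
      using AE_i by (subst AE_finite_all) auto
    then show ?thesis
      by eventually_elim (simp add: \<xi>_def vec_cond_exp_def vec_eq_iff X'_eq(1))
  qed
  have [measurable]: "\<xi> \<in> borel_measurable N"
    unfolding \<xi>_def vec_cond_exp_def by measurable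
  have X'_quad: "integrable N (\<lambda>\<omega>. X' \<omega> \<bullet> (P *v X' \<omega>))"
    "(\<integral>\<omega>. X' \<omega> \<bullet> (P *v X' \<omega>) \<partial>N) = (A *v m + B *v u + \<mu>) \<bullet> (P *v (A *v m + B *v u + \<mu>))
      + trace (P ** (A ** S ** transpose A + W))"
    unfolding X'_eq(2) using X1_mom(3,4)[of "- (B *v u)" P] by (simp_all add: add_ac)
  have \<xi>_quad: "integrable N (\<lambda>\<omega>. \<xi> \<omega> \<bullet> (S1 *v \<xi> \<omega>))"
    "(\<integral>\<omega>. \<xi> \<omega> \<bullet> (S1 *v \<xi> \<omega>) \<partial>N) = trace (S1 ** ?W')"
  proof -
    have AE: "AE \<omega> in N. \<xi> \<omega> \<bullet> (S1 *v \<xi> \<omega>) = (Z \<omega> - \<mu>) \<bullet> (S1 *v (Z \<omega> - \<mu>))"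
      using \<xi>_AE by eventually_elim simp
    show "integrable N (\<lambda>\<omega>. \<xi> \<omega> \<bullet> (S1 *v \<xi> \<omega>))"
      using Z_mom(3)[of \<mu> S1] by (subst integrable_cong_AE[OF _ _ AE]) simp_all
    show "(\<integral>\<omega>. \<xi> \<omega> \<bullet> (S1 *v \<xi> \<omega>) \<partial>N) = trace (S1 ** ?W')"
      using Z_mom(4)[of \<mu> S1] by (subst integral_cong_AE[OF _ _ AE]) simp_all
  qed
  let ?v = "\<lambda>\<omega>. 1/2 * (X' \<omega> \<bullet> (P *v X' \<omega>) + \<xi> \<omega> \<bullet> (S1 *v \<xi> \<omega>))"
  have v_int: "integrable N ?v"
    using X'_quad(1) \<xi>_quad(1) by simp
  have v_val: "(\<integral>\<omega>. ?v \<omega> \<partial>N) = 1/2 * ((A *v m + B *v u + \<mu>) \<bullet> (P *v (A *v m + B *v u + \<mu>))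
      + trace (P ** (A ** S ** transpose A + W)) + trace (S1 ** ?W'))"
    using X'_quad \<xi>_quad by simp
  \<comment> \<open>Integrating the conditional expectation returns the integral of its argument, so
    the next value function is never computed pointwise.\<close>
  note cond = F.real_cond_exp_int[OF v_int]
  have fst_quad: "integrable N (\<lambda>\<omega>. fst \<omega> \<bullet> (Q *v fst \<omega>))"
    "(\<integral>\<omega>. fst \<omega> \<bullet> (Q *v fst \<omega>) \<partial>N) = m \<bullet> (Q *v m) + trace (Q ** S)"
    using fst_mom(3,4)[of 0 Q] by simp_all
  let ?KL = "KL_divergence (exp 1) (gauss 0 What) (gauss \<mu> W)"
  have "stage_objective A B C Q R P S1 z \<tau> V What t \<iota> (gauss m S) u \<mu> W =
    (\<integral>\<omega>. 1/2 * (fst \<omega> \<bullet> (Q *v fst \<omega>) + u \<bullet> (R *v u)) + (real_cond_exp N F ?v \<omega> + z) - \<tau> * ?KL \<partial>N)"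
    unfolding stage_objective_def Let_def next_value_def N_def[symmetric] X'_def[symmetric]
      I'_def[symmetric] F_def[symmetric] \<xi>_def[symmetric] ..
  also have "\<dots> = 1/2 * (m \<bullet> (Q *v m) + trace (Q ** S) + u \<bullet> (R *v u)) + ((\<integral>\<omega>. ?v \<omega> \<partial>N) + z) - \<tau> * ?KL"
    using fst_quad cond N.prob_space by simp
  also have "?KL = (\<mu> \<bullet> (matrix_inv What *v \<mu>) + trace (matrix_inv What ** W) - real CARD('n)
        + ln (det What / det W)) / 2"
    using KL_divergence_gauss[OF W What, of 0 \<mu>] by simp
  finally show ?thesis
    unfolding v_val using trace_kalman_cov_eq_riccati_r[of S1 A C V S W] by (simp add: algebra_simps)
qed

section \<open>The linear-quadratic game\<close>

lemma scaleR_matrix_vector: "(c *\<^sub>R M) *v x = c *\<^sub>R (M *v x)"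
  for M :: "real^'n^'m"
  by (rule scaleR_matrix_vector_assoc[symmetric])

lemma uminus_matrix_vector: "(- M) *v x = - (M *v x)"
  for M :: "real^'n^'m"
  by (simp add: matrix_vector_mult_def vec_eq_iff sum_negf)

text \<open>Expand the nonnegative number \<open>d \<bullet> (P *v d)\<close> for \<open>d = W *v x - \<tau> *\<^sub>R (matrix_inv P *v x)\<close>.\<close>

lemma pos_def_inverse_diff:
  fixes P W :: "real^'n^'n"
  assumes P: "pos_def P" and W: "pos_def W" and \<tau>: "0 < \<tau>"
    and PW: "pos_def (matrix_inv W - (1/\<tau>) *\<^sub>R P)"
  shows "pos_def (matrix_inv P - (1/\<tau>) *\<^sub>R W)"
  unfolding pos_def_def
proof (intro conjI allI impI)
  note invP = pos_def_invertible[OF P] and invW = pos_def_invertible[OF W]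
  show "transpose (matrix_inv P - (1/\<tau>) *\<^sub>R W) = matrix_inv P - (1/\<tau>) *\<^sub>R W"
    using pos_defD(1)[OF pos_def_matrix_inv[OF P]] pos_defD(1)[OF W]
    by (simp add: transpose_diff transpose_scalar)
  fix x :: "real^'n" assume "x \<noteq> 0"
  define a where "a = W *v x"
  define b where "b = matrix_inv P *v x"
  have x: "x = matrix_inv W *v a" "x = P *v b"
    by (simp_all add: a_def b_def matrix_inv_vector[OF invP] matrix_inv_vector[OF invW])
  have "a \<noteq> 0"
    using \<open>x \<noteq> 0\<close> x(1) by auto
  \<comment> \<open>Strictness comes from evaluating the hypothesis at \<open>W *v x\<close>; the
    expanded square supplies the other bound.\<close>
  from pos_defD(2)[OF PW this] have 1: "a \<bullet> (P *v a) < \<tau> * (a \<bullet> x)"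
    using \<tau> by (simp add: matrix_vector_mult_diff_rdistrib scaleR_matrix_vector x(1)[symmetric]
        inner_diff_right field_simps)
  have "0 \<le> (a - \<tau> *\<^sub>R b) \<bullet> (P *v (a - \<tau> *\<^sub>R b))"
    by (rule pos_defD(3)[OF P])
  also have "\<dots> = a \<bullet> (P *v a) - 2 * \<tau> * (a \<bullet> x) + \<tau> * \<tau> * (b \<bullet> x)"
    using inner_symmetric_matrix[OF pos_defD(1)[OF P], of b a]
    by (simp add: matrix_vector_mult_diff_distrib matrix_vector_mult_scaleR x(2)[symmetric]
        inner_diff_left inner_diff_right inner_commute[of x a] algebra_simps)
  finally have "\<tau> * (a \<bullet> x) < \<tau> * (\<tau> * (b \<bullet> x))"
    using 1 by (simp add: mult.assoc)
  then have "a \<bullet> x < \<tau> * (b \<bullet> x)"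
    using \<tau> by (simp only: mult_less_cancel_left_pos)
  then show "0 < x \<bullet> ((matrix_inv P - (1/\<tau>) *\<^sub>R W) *v x)"
    using \<tau> by (simp add: matrix_vector_mult_diff_rdistrib scaleR_matrix_vector a_def[symmetric]
        b_def[symmetric] inner_diff_right inner_commute[of x] field_simps)
qed

text \<open>Completing the square in the noise mean. At the stationary point
  \<open>P *v (h + \<mu>')\<close> equals \<open>\<tau> *\<^sub>R (matrix_inv W *v \<mu>')\<close>;
  solving for \<open>h + \<mu>'\<close> produces the inverse in \<open>\<mu>'\<close>, and half the
  form of \<open>matrix_inv (matrix_inv P - (1/\<tau>) *\<^sub>R W)\<close> at \<open>h\<close> is
  the value left.\<close>

lemma adversary_mean_square:
  fixes P W :: "real^'n^'n" and h \<mu> :: "real^'n"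
  assumes P: "pos_def P" and W: "pos_def W" and \<tau>: "0 < \<tau>"
    and PW: "pos_def (matrix_inv W - (1/\<tau>) *\<^sub>R P)"
  defines "\<Lambda> \<equiv> matrix_inv W - (1/\<tau>) *\<^sub>R P"
    and "\<mu>' \<equiv> (matrix_inv (mat 1 - (1/\<tau>) *\<^sub>R (W ** P)) - mat 1) *v h"
  shows "1/2 * ((h + \<mu>) \<bullet> (P *v (h + \<mu>))) - \<tau>/2 * (\<mu> \<bullet> (matrix_inv W *v \<mu>))
    = 1/2 * (h \<bullet> (matrix_inv (matrix_inv P - (1/\<tau>) *\<^sub>R W) *v h))
      - \<tau>/2 * ((\<mu> - \<mu>') \<bullet> (\<Lambda> *v (\<mu> - \<mu>')))"
proof -
  note invP = pos_def_invertible[OF P] and invW = pos_def_invertible[OF W]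
  let ?\<Phi> = "matrix_inv P - (1/\<tau>) *\<^sub>R W"
  have inv\<Phi>: "invertible ?\<Phi>"
    by (rule pos_def_invertible[OF pos_def_inverse_diff[OF P W \<tau> PW]])
  have eq: "mat 1 - (1/\<tau>) *\<^sub>R (W ** P) = W ** \<Lambda>"
    by (simp add: matrix_eq \<Lambda>_def matrix_vector_mult_diff_rdistrib matrix_vector_mult_diff_distrib
        matrix_vector_mul_assoc[symmetric] scaleR_matrix_vector matrix_vector_mult_scaleR
        matrix_inv_vector[OF invW])
  have inv: "invertible (mat 1 - (1/\<tau>) *\<^sub>R (W ** P))"
    unfolding eq \<Lambda>_def by (rule invertible_mult[OF invW pos_def_invertible[OF PW]])
  \<comment> \<open>\<open>k\<close> is the worst-case mean of the next state and \<open>q\<close>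
    the gradient of its cost. Both the value and the vanishing cross terms come from
    \<open>h = k - (1/\<tau>) *\<^sub>R (W *v q)\<close>.\<close>
  define k where "k = h + \<mu>'"
  define q where "q = P *v k"
  have k: "h = k - (1/\<tau>) *\<^sub>R (W *v q)"
    using matrix_inv_vector(1)[OF inv, of h]
    by (simp add: k_def \<mu>'_def q_def matrix_vector_mult_diff_rdistrib scaleR_matrix_vector
        matrix_vector_mul_assoc[symmetric])
  then have "h = ?\<Phi> *v q"
    by (simp add: matrix_vector_mult_diff_rdistrib scaleR_matrix_vector)
      (simp add: q_def matrix_inv_vector[OF invP])
  then have \<Phi>h: "matrix_inv ?\<Phi> *v h = q"
    using matrix_inv_vector(2)[OF inv\<Phi>] by simp
  have \<mu>': "\<mu>' = (1/\<tau>) *\<^sub>R (W *v q)"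
    using k by (simp add: k_def)
  then have W\<mu>': "matrix_inv W *v \<mu>' = (1/\<tau>) *\<^sub>R q"
    by (simp add: matrix_vector_mult_scaleR matrix_inv_vector[OF invW])
  define d where "d = \<mu> - \<mu>'"
  have \<mu>: "\<mu> = \<mu>' + d" "h + \<mu> = k + d"
    by (simp_all add: d_def k_def)
  have kd: "k \<bullet> (P *v d) = d \<bullet> q"
    using inner_symmetric_matrix[OF pos_defD(1)[OF P], of k d] by (simp add: q_def inner_commute)
  have Wd: "\<mu>' \<bullet> (matrix_inv W *v d) = (1/\<tau>) * (d \<bullet> q)"
    using inner_symmetric_matrix[OF pos_defD(1)[OF pos_def_matrix_inv[OF W]], of \<mu>' d] W\<mu>'
    by (simp add: inner_commute)
  have "1/2 * ((k + d) \<bullet> (P *v (k + d))) - \<tau>/2 * ((\<mu>' + d) \<bullet> (matrix_inv W *v (\<mu>' + d)))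
    = 1/2 * (k \<bullet> q) + d \<bullet> q + 1/2 * (d \<bullet> (P *v d)) - 1/2 * (\<mu>' \<bullet> q) - d \<bullet> q
      - \<tau>/2 * (d \<bullet> (matrix_inv W *v d))"
    using \<tau> by (simp add: matrix_vector_right_distrib inner_add_left inner_add_right W\<mu>' kd Wd
        q_def[symmetric] field_simps)
  also have "\<dots> = 1/2 * (h \<bullet> q) - \<tau>/2 * (d \<bullet> (\<Lambda> *v d))"
    using \<tau> by (simp add: k_def \<Lambda>_def inner_add_left matrix_vector_mult_diff_rdistrib
        scaleR_matrix_vector inner_diff_right field_simps)
  finally show ?thesis
    unfolding \<mu>(2) d_def[symmetric] \<Phi>h unfolding \<mu>(1) .
qed

text \<open>In the game \<open>matrix_inv \<Phi>\<close> is the cost left after maximising over the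
  noise mean. With the multiplier \<open>l = M *v h\<close>, stationarity reads
  \<open>R *v u' = - (transpose B *v l)\<close> and
  \<open>matrix_inv \<Phi> *v (h + B *v u') = l\<close>; these relations cancel the cross
  terms.\<close>

lemma controller_square:
  fixes \<Phi> :: "real^'n^'n" and B :: "real^'m^'n" and R :: "real^'m^'m" and h :: "real^'n"
  assumes \<Phi>: "pos_def \<Phi>" and R: "pos_def R"
  defines "M \<equiv> matrix_inv (B ** matrix_inv R ** transpose B + \<Phi>)"
  defines "u' \<equiv> - (matrix_inv R *v (transpose B *v (M *v h)))"
  shows "1/2 * (u \<bullet> (R *v u)) + 1/2 * ((h + B *v u) \<bullet> (matrix_inv \<Phi> *v (h + B *v u)))
    = 1/2 * (h \<bullet> (M *v h)) + (1/2 * ((u - u') \<bullet> (R *v (u - u')))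
      + 1/2 * ((B *v (u - u')) \<bullet> (matrix_inv \<Phi> *v (B *v (u - u')))))"
proof -
  note invR = pos_def_invertible[OF R] and inv\<Phi> = pos_def_invertible[OF \<Phi>]
  have invM: "invertible (B ** matrix_inv R ** transpose B + \<Phi>)"
    by (rule pos_def_invertible[OF pos_def_congruence_add[OF pos_def_matrix_inv[OF R] \<Phi>]])
  define l where "l = M *v h"
  have Ru': "R *v u' = - (transpose B *v l)"
    by (simp add: u'_def l_def matrix_inv_vector[OF invR] vec.neg del: transpose_matrix_vector)
  have "h + B *v u' = \<Phi> *v l"
    using matrix_inv_vector(1)[OF invM, of h]
    by (simp add: u'_def l_def M_def matrix_vector_mult_add_rdistrib vec.neg algebra_simps
        matrix_vector_mul_assoc[symmetric] del: transpose_matrix_vector)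
  then have \<Phi>k: "matrix_inv \<Phi> *v (h + B *v u') = l"
    by (simp add: matrix_inv_vector[OF inv\<Phi>])
  define d where "d = u - u'"
  define k where "k = h + B *v u'"
  have u: "u = u' + d" "h + B *v u = k + B *v d"
    by (simp_all add: d_def k_def matrix_vector_mult_diff_distrib)
  have Bl: "(B *v v) \<bullet> l = v \<bullet> (transpose B *v l)" for v
    by (rule inner_matrix_vector_mult)
  have Rd: "u' \<bullet> (R *v d) = - (d \<bullet> (transpose B *v l))"
    using inner_symmetric_matrix[OF pos_defD(1)[OF R], of u' d] Ru'
    by (simp add: inner_commute del: transpose_matrix_vector)
  have \<Phi>d: "k \<bullet> (matrix_inv \<Phi> *v (B *v d)) = d \<bullet> (transpose B *v l)"
    using inner_symmetric_matrix[OF pos_defD(1)[OF pos_def_matrix_inv[OF \<Phi>]], of k "B *v d"] \<Phi>k Bl[of d]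
    by (simp add: k_def inner_commute del: transpose_matrix_vector)
  have kl: "k \<bullet> l = h \<bullet> l + u' \<bullet> (transpose B *v l)"
    by (simp add: k_def inner_add_left Bl del: transpose_matrix_vector)
  show ?thesis
    unfolding d_def[symmetric] l_def[symmetric] u(2) unfolding u(1)
    by (simp add: matrix_vector_right_distrib inner_add_left inner_add_right Ru' Rd \<Phi>d
        \<Phi>k[folded k_def] kl Bl algebra_simps del: transpose_matrix_vector)
qed

text \<open>The term linear in \<open>W\<close> is absorbed by shifting the precision of
  \<open>What\<close> by \<open>- (1/\<tau>) *\<^sub>R N\<close>. What remains is
  \<open>- \<tau>\<close> times a divergence from the tilted covariance \<open>W'\<close>, and the
  change of normalisation appears as the log determinant.\<close>

lemma adversary_covariance_gap:
  fixes N What W :: "real^'n^'n"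
  assumes What: "pos_def What" and W: "pos_def W" and \<tau>: "0 < \<tau>"
    and G: "pos_def (matrix_inv What - (1/\<tau>) *\<^sub>R N)"
  defines "W' \<equiv> matrix_inv (matrix_inv What - (1/\<tau>) *\<^sub>R N)"
  shows "1/2 * trace (N ** W) - \<tau>/2 * (trace (matrix_inv What ** W) - real CARD('n) + ln (det What / det W))
    = - \<tau>/2 * ln (det (mat 1 - (1/\<tau>) *\<^sub>R (What ** N)))
      - \<tau>/2 * (trace (matrix_inv W' ** W) - real CARD('n) + ln (det W' / det W))"
proof -
  note invWhat = pos_def_invertible[OF What]
  let ?G = "matrix_inv What - (1/\<tau>) *\<^sub>R N"
  have W': "pos_def W'"
    unfolding W'_def by (rule pos_def_matrix_inv[OF G])
  have invW': "matrix_inv W' = ?G"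
    unfolding W'_def by (rule matrix_inv_matrix_inv[OF pos_def_invertible[OF G]])
  have "?G ** W = matrix_inv What ** W - (1/\<tau>) *\<^sub>R (N ** W)"
    by (simp add: matrix_eq matrix_vector_mult_diff_rdistrib matrix_vector_mul_assoc[symmetric]
        scaleR_matrix_vector)
  then have tr: "trace (?G ** W) = trace (matrix_inv What ** W) - (1/\<tau>) * trace (N ** W)"
    by (simp add: trace_sub) (simp add: trace_def sum_divide_distrib)
  have "mat 1 - (1/\<tau>) *\<^sub>R (What ** N) = What ** ?G"
    by (simp add: matrix_eq matrix_vector_mult_diff_rdistrib matrix_vector_mult_diff_distrib
        matrix_vector_mul_assoc[symmetric] scaleR_matrix_vector matrix_vector_mult_scaleR
        matrix_inv_vector[OF invWhat])
  then have "det (mat 1 - (1/\<tau>) *\<^sub>R (What ** N)) * det W' = det What"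
    using matrix_inv(1)[OF pos_def_invertible[OF G]]
    by (simp add: det_mul W'_def[symmetric]) (metis det_I det_mul mult.assoc mult.right_neutral)
  then have "det (mat 1 - (1/\<tau>) *\<^sub>R (What ** N)) = det What / det W'"
    using pos_def_det[OF W'] by (simp add: field_simps)
  then have ln_det: "ln (det (mat 1 - (1/\<tau>) *\<^sub>R (What ** N))) = ln (det What) - ln (det W')"
    using pos_def_det[OF W'] pos_def_det[OF What] by (simp add: ln_div)
  show ?thesis
    using pos_def_det[OF W'] pos_def_det[OF What] pos_def_det[OF W] \<tau>
    unfolding invW' tr ln_det by (simp add: ln_div field_simps)
qed

text \<open>The maximiser \<open>a' u\<close> may depend on the input, but its penalty vanishes
  there, so the supremum is \<open>c + q u\<close> and the two optimisations decouple.
  \<open>V\<close> will be positive definiteness, under which the divergence formula is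
  available.\<close>

lemma separable_saddle_point:
  fixes J :: "'u \<Rightarrow> 'a \<Rightarrow> 'w \<Rightarrow> real"
  assumes J: "\<And>u a w. V w \<Longrightarrow> J u a w = c + q u - f u a - g w"
    and q: "\<And>u. 0 \<le> q u" "\<And>u. q u = 0 \<longleftrightarrow> u = u'"
    and f: "\<And>u a. 0 \<le> f u a" "\<And>u a. f u a = 0 \<longleftrightarrow> a = a' u"
    and g: "\<And>w. V w \<Longrightarrow> 0 \<le> g w" "\<And>w. V w \<Longrightarrow> g w = 0 \<longleftrightarrow> w = w'"
    and w': "V w'"
  defines "s \<equiv> \<lambda>u. SUP (a, w) \<in> {(a, w). V w}. ereal (J u a w)"
  shows "is_arg_min s (\<lambda>_. True) u \<longleftrightarrow> u = u'"
    and "is_arg_max (\<lambda>(a, w). ereal (J u a w)) (\<lambda>(a, w). V w) (a, w) \<longleftrightarrow> a = a' u \<and> w = w'"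
    and "(INF u. s u) = ereal c"
proof -
  have opt: "f u (a' u) = 0" "g w' = 0" "q u' = 0" for u
    using f g w' q by auto
  have s: "s u = ereal (c + q u)" for u
    unfolding s_def
  proof (rule antisym)
    show "(SUP (a, w) \<in> {(a, w). V w}. ereal (J u a w)) \<le> ereal (c + q u)"
    proof (rule SUP_least, clarify)
      fix a w assume "V w"
      then show "ereal (J u a w) \<le> ereal (c + q u)"
        using f(1)[of u a] g(1)[of w] by (simp add: J)
    qed
    show "ereal (c + q u) \<le> (SUP (a, w) \<in> {(a, w). V w}. ereal (J u a w))"
      using w' by (intro SUP_upper2[of "(a' u, w')"]) (auto simp: J opt)
  qed
  show "is_arg_min s (\<lambda>_. True) u \<longleftrightarrow> u = u'"
  proof
    assume "is_arg_min s (\<lambda>_. True) u"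
    then have "\<not> q u' < q u"
      by (auto simp: is_arg_min_def s)
    then show "u = u'"
      using q opt by (metis less_eq_real_def)
  next
    assume "u = u'"
    then show "is_arg_min s (\<lambda>_. True) u"
      using q(1) opt(3) by (auto simp: is_arg_min_def s not_less)
  qed
  show "is_arg_max (\<lambda>(a, w). ereal (J u a w)) (\<lambda>(a, w). V w) (a, w) \<longleftrightarrow> a = a' u \<and> w = w'"
  proof
    assume *: "is_arg_max (\<lambda>(a, w). ereal (J u a w)) (\<lambda>(a, w). V w) (a, w)"
    then have "V w" "\<not> J u a w < J u (a' u) w'"
      using w' by (auto simp: is_arg_max_def)
    then have "f u a + g w \<le> 0"
      using w' by (simp add: J opt)
    then have "f u a = 0" "g w = 0"
      using f(1)[of u a] g(1)[OF \<open>V w\<close>] by linarith+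
    then show "a = a' u \<and> w = w'"
      using f(2) g(2)[OF \<open>V w\<close>] by simp
  next
    have "- f u a \<le> g w" if "V w" for a w
      using f(1)[of u a] g(1)[OF that] by linarith
    moreover assume "a = a' u \<and> w = w'"
    ultimately show "is_arg_max (\<lambda>(a, w). ereal (J u a w)) (\<lambda>(a, w). V w) (a, w)"
      using w' by (auto simp: is_arg_max_def J opt not_less)
  qed
  show "(INF u. s u) = ereal c"
  proof (rule antisym)
    show "(INF u. s u) \<le> ereal c"
      by (rule INF_lower2[of u']) (simp_all add: s opt)
    show "ereal c \<le> (INF u. s u)"
      using q(1) by (auto intro!: INF_greatest simp: s)
  qed
qed

text \<open>\<open>\<kappa>\<close> is determined only up to null sets, hence the almost sure
  conclusion. Taking the supremum in \<open>ereal\<close> makes it exist without a prior bound, and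
  the equivalences express uniqueness together with optimality.\<close>

theorem proposition8:
  fixes A :: "real^'n^'n" and B :: "real^'m^'n" and C :: "real^'n^'p"
    and Q :: "real^'n^'n" and R :: "real^'m^'m"
    and X0 :: "real^'n^'n" and Vhat :: "nat \<Rightarrow> real^'p^'p" and What :: "nat \<Rightarrow> real^'n^'n"
    and \<pi> :: "nat \<Rightarrow> ('p, 'm) info \<Rightarrow> real^'m"
    and \<mu> :: "nat \<Rightarrow> ('p, 'm) info \<Rightarrow> real^'n" and W :: "nat \<Rightarrow> ('p, 'm) info \<Rightarrow> real^'n^'n"
    and t :: nat and P1 S1 :: "real^'n^'n" and z1 \<tau> :: real
    and \<kappa> :: "('p, 'm) info \<Rightarrow> (real^'n) measure"
  assumes Q: "pos_semidef Q" and R: "pos_def R"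
    and X0: "pos_def X0" and Vhat: "\<And>s. pos_def (Vhat s)" and What: "\<And>s. pos_def (What s)"
    and \<pi>: "\<And>s. s < t \<Longrightarrow> \<pi> s \<in> borel_measurable (info_algebra s)"
    and \<mu>: "\<And>s. s < t \<Longrightarrow> \<mu> s \<in> borel_measurable (info_algebra s)"
    and W: "\<And>s. s < t \<Longrightarrow> W s \<in> borel_measurable (info_algebra s)"
    and W_pos: "\<And>s \<iota>. s < t \<Longrightarrow> \<iota> \<in> space (info_algebra s) \<Longrightarrow> pos_def (W s \<iota>)"
    and \<kappa>: "regular_cond_law (system_law A B C X0 Vhat \<pi> \<mu> W t) (info_algebra t) borel \<kappa>"
    and P1: "pos_def P1" and S1: "transpose S1 = S1"
    and \<tau>: "0 < \<tau>"
    and \<tau>_P: "pos_def (matrix_inv (What t) - (1/\<tau>) *\<^sub>R P1)"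
    and \<tau>_PS: "pos_def (matrix_inv (What t) - (1/\<tau>) *\<^sub>R (P1 + S1))"
  shows "AE \<iota> in distr (system_law A B C X0 Vhat \<pi> \<mu> W t) (info_algebra t) fst.
    (let xt = mean (\<kappa> \<iota>);
         J = stage_objective A B C Q R P1 S1 z1 \<tau> (Vhat t) (What t) t \<iota> (\<kappa> \<iota>);
         inner_sup = (\<lambda>u. SUP (\<mu>t, Wt) \<in> {(\<mu>t, Wt). pos_def Wt}. ereal (J u \<mu>t Wt));
         M = matrix_inv (matrix_inv P1 + B ** matrix_inv R ** transpose B - (1/\<tau>) *\<^sub>R What t);
         K_opt = - (matrix_inv R ** transpose B ** M ** A);
         u_opt = K_opt *v xt;
         \<mu>_opt = (matrix_inv (mat 1 - (1/\<tau>) *\<^sub>R (What t ** P1)) - mat 1) *v (A *v xt + B *v u_opt);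
         W_opt = matrix_inv (matrix_inv (What t) - (1/\<tau>) *\<^sub>R (P1 + S1));
         P0 = Q + transpose A ** M ** A;
         S0 = Q + transpose A ** P1 ** A - P0;
         z0 = z1 - \<tau>/2 * ln (det (mat 1 - (1/\<tau>) *\<^sub>R (What t ** (P1 + S1))))
     in (\<forall>u. is_arg_min inner_sup (\<lambda>_. True) u \<longleftrightarrow> u = u_opt)
      \<and> (\<forall>\<mu>t Wt. is_arg_max (\<lambda>(\<mu>t, Wt). ereal (J u_opt \<mu>t Wt)) (\<lambda>(\<mu>t, Wt). pos_def Wt) (\<mu>t, Wt)
            \<longleftrightarrow> \<mu>t = \<mu>_opt \<and> Wt = W_opt)
      \<and> (INF u. inner_sup u) =
          ereal ((\<integral>x. 1/2 * (x \<bullet> (P0 *v x) + (x - xt) \<bullet> (S0 *v (x - xt))) \<partial>\<kappa> \<iota>)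
                 + z0 + riccati_r A C (Vhat t) S1 (covariance (\<kappa> \<iota>))))"
proof -
  let ?L = "system_law A B C X0 Vhat \<pi> \<mu> W t"
  have "\<exists>m S. gauss_disintegration ?L (info_algebra t) m S"
    by (rule system_law_disintegration[where t=t]) (use X0 Vhat \<pi> \<mu> W W_pos in auto)
  then obtain m0 \<Sigma>0 where "gauss_disintegration ?L (info_algebra t) m0 \<Sigma>0"
    by blast
  from regular_cond_law_gauss[OF this \<kappa>] show ?thesis
  proof eventually_elim
    case (elim \<iota>)
    then obtain m \<Sigma> where \<iota>: "\<iota> \<in> space (info_algebra t)" and \<Sigma>: "pos_def \<Sigma>"
      and \<kappa>\<iota>: "\<kappa> \<iota> = gauss m \<Sigma>"
      by blast
    define \<Phi> where "\<Phi> = matrix_inv P1 - (1/\<tau>) *\<^sub>R What t"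
    define \<Lambda> where "\<Lambda> = matrix_inv (What t) - (1/\<tau>) *\<^sub>R P1"
    define M where "M = matrix_inv (matrix_inv P1 + B ** matrix_inv R ** transpose B - (1/\<tau>) *\<^sub>R What t)"
    define K_opt where "K_opt = - (matrix_inv R ** transpose B ** M ** A)"
    define u_opt where "u_opt = K_opt *v m"
    \<comment> \<open>Kept as a function of the input: the inner maximum is attained for every
      \<open>u\<close>, not only at \<open>u_opt\<close>.\<close>
    define \<mu>_opt where "\<mu>_opt u = (matrix_inv (mat 1 - (1/\<tau>) *\<^sub>R (What t ** P1)) - mat 1) *v (A *v m + B *v u)" for u
    define W_opt where "W_opt = matrix_inv (matrix_inv (What t) - (1/\<tau>) *\<^sub>R (P1 + S1))"
    define P0 where "P0 = Q + transpose A ** M ** A"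
    define S0 where "S0 = Q + transpose A ** P1 ** A - P0"
    define z0 where "z0 = z1 - \<tau>/2 * ln (det (mat 1 - (1/\<tau>) *\<^sub>R (What t ** (P1 + S1))))"
    define J where "J = stage_objective A B C Q R P1 S1 z1 \<tau> (Vhat t) (What t) t \<iota> (gauss m \<Sigma>)"
    \<comment> \<open>\<open>c\<close> is what remains when the penalties \<open>q\<close>,
      \<open>f\<close> and \<open>g\<close> all vanish: its last term is left by the controller's
      square, and the log determinant from the covariance gap sits in \<open>z0\<close>.\<close>
    define c where "c = 1/2 * (m \<bullet> (Q *v m) + trace (Q ** \<Sigma>)) + 1/2 * trace (P1 ** (A ** \<Sigma> ** transpose A))
      + riccati_r A C (Vhat t) S1 \<Sigma> + z0 + 1/2 * ((A *v m) \<bullet> (M *v (A *v m)))"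
    define q where "q u = 1/2 * ((u - u_opt) \<bullet> (R *v (u - u_opt)))
      + 1/2 * ((B *v (u - u_opt)) \<bullet> (matrix_inv \<Phi> *v (B *v (u - u_opt))))" for u
    define f where "f u \<mu>t = \<tau>/2 * ((\<mu>t - \<mu>_opt u) \<bullet> (\<Lambda> *v (\<mu>t - \<mu>_opt u)))" for u \<mu>t
    define g where "g Wt = \<tau>/2 * (trace (matrix_inv W_opt ** Wt) - real CARD('n) + ln (det W_opt / det Wt))" for Wt
    have \<Phi>: "pos_def \<Phi>"
      unfolding \<Phi>_def by (rule pos_def_inverse_diff[OF P1 What \<tau> \<tau>_P])
    have \<Lambda>: "pos_def \<Lambda>"
      unfolding \<Lambda>_def by (rule \<tau>_P)
    have W_opt: "pos_def W_opt"
      unfolding W_opt_def by (rule pos_def_matrix_inv[OF \<tau>_PS])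
    have M: "M = matrix_inv (B ** matrix_inv R ** transpose B + \<Phi>)"
      unfolding M_def \<Phi>_def by (simp add: algebra_simps)
    have u_opt: "u_opt = - (matrix_inv R *v (transpose B *v (M *v (A *v m))))"
      unfolding u_opt_def K_opt_def
      by (simp add: uminus_matrix_vector matrix_vector_mul_assoc[symmetric]
          del: transpose_matrix_vector)
    have J: "J u \<mu>t Wt = c + q u - f u \<mu>t - g Wt" if Wt: "pos_def Wt" for u \<mu>t Wt
    proof -
      \<comment> \<open>The mean square is applied at \<open>?h\<close>, and the value it leaves is
        the input of the controller's square. The traces of \<open>P1\<close> and \<open>S1\<close>
        against \<open>Wt\<close> merge, which is why the second bound on \<open>\<tau>\<close>
        involves \<open>P1 + S1\<close>.\<close>
      let ?h = "A *v m + B *v u"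
      have tr: "trace (P1 ** (A ** \<Sigma> ** transpose A + Wt)) =
          trace (P1 ** (A ** \<Sigma> ** transpose A)) + trace (P1 ** Wt)"
        "trace ((P1 + S1) ** Wt) = trace (P1 ** Wt) + trace (S1 ** Wt)"
      proof -
        have "(P1 + S1) ** Wt = P1 ** Wt + S1 ** Wt"
          by (simp add: matrix_eq matrix_vector_mult_add_rdistrib matrix_vector_mul_assoc[symmetric])
        then show "trace ((P1 + S1) ** Wt) = trace (P1 ** Wt) + trace (S1 ** Wt)"
          by (simp add: trace_add)
      qed (simp add: trace_add matrix_add_ldistrib)
      show ?thesis
        using adversary_mean_square[OF P1 What \<tau> \<tau>_P, of ?h \<mu>t]
          adversary_covariance_gap[OF What Wt \<tau> \<tau>_PS]
          controller_square[OF \<Phi> R, where u=u and B=B and h="A *v m", folded M, folded u_opt]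
        unfolding J_def stage_objective_gauss[OF \<Sigma> Vhat Wt What \<iota>] tr
          \<Phi>_def[symmetric] \<Lambda>_def[symmetric] W_opt_def[symmetric] \<mu>_opt_def[symmetric]
        unfolding c_def q_def f_def g_def z0_def
        by (simp add: distrib_left right_diff_distrib add_divide_distrib diff_divide_distrib)
    qed
    have q: "0 \<le> q u" "q u = 0 \<longleftrightarrow> u = u_opt" for u
    proof -
      have *: "0 \<le> (B *v (u - u_opt)) \<bullet> (matrix_inv \<Phi> *v (B *v (u - u_opt)))"
        by (rule pos_defD(3)[OF pos_def_matrix_inv[OF \<Phi>]])
      show "0 \<le> q u"
        unfolding q_def using * pos_defD(3)[OF R, of "u - u_opt"] by simp
      show "q u = 0 \<longleftrightarrow> u = u_opt"
      proof
        assume "q u = 0"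
        then have "\<not> 0 < (u - u_opt) \<bullet> (R *v (u - u_opt))"
          unfolding q_def using * by simp
        then show "u = u_opt"
          using pos_defD(2)[OF R, of "u - u_opt"] by auto
      qed (simp add: q_def)
    qed
    have f: "0 \<le> f u \<mu>t" "f u \<mu>t = 0 \<longleftrightarrow> \<mu>t = \<mu>_opt u" for u \<mu>t
      using \<tau> pos_defD(3)[OF \<Lambda>, of "\<mu>t - \<mu>_opt u"] pos_defD(2)[OF \<Lambda>, of "\<mu>t - \<mu>_opt u"]
      by (cases "\<mu>t = \<mu>_opt u"; simp add: f_def)+
    have g: "0 \<le> g Wt" "g Wt = 0 \<longleftrightarrow> Wt = W_opt" if "pos_def Wt" for Wt
      using \<tau> trace_ln_det_ge[OF that W_opt] by (auto simp: g_def)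
    note saddle = separable_saddle_point[of pos_def J c q f g u_opt \<mu>_opt W_opt,
        OF J q f g W_opt]
    \<comment> \<open>The error \<open>x - m\<close> has mean zero, so its form contributes only a
      trace. Since \<open>P0 + S0\<close> equals \<open>Q + transpose A ** P1 ** A\<close>, the
      matrix \<open>M\<close> cancels from the traces and survives only in the term in
      \<open>m\<close>.\<close>
    have optimal_value: "c = (\<integral>x. 1/2 * (x \<bullet> (P0 *v x) + (x - m) \<bullet> (S0 *v (x - m))) \<partial>gauss m \<Sigma>)
       + z0 + riccati_r A C (Vhat t) S1 \<Sigma>"
    proof -
      have "P0 ** \<Sigma> + S0 ** \<Sigma> = Q ** \<Sigma> + transpose A ** (P1 ** A ** \<Sigma>)"
        by (simp add: S0_def matrix_eq matrix_vector_mult_add_rdistrib matrix_vector_mult_diff_rdistrib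
            matrix_vector_mul_assoc[symmetric] del: transpose_matrix_vector)
      then have "trace (P0 ** \<Sigma>) + trace (S0 ** \<Sigma>) = trace (Q ** \<Sigma>) + trace (transpose A ** (P1 ** A ** \<Sigma>))"
        by (metis trace_add)
      also have "trace (transpose A ** (P1 ** A ** \<Sigma>)) = trace (P1 ** (A ** \<Sigma> ** transpose A))"
        by (subst trace_mul_sym) (simp add: matrix_mul_assoc)
      finally have tr: "trace (P0 ** \<Sigma>) + trace (S0 ** \<Sigma>) =
        trace (Q ** \<Sigma>) + trace (P1 ** (A ** \<Sigma> ** transpose A))" .
      have P0: "m \<bullet> (P0 *v m) = m \<bullet> (Q *v m) + (A *v m) \<bullet> (M *v (A *v m))"
        by (simp add: P0_def matrix_vector_mult_add_rdistrib inner_add_right inner_matrix_vector_mult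
            matrix_vector_mul_assoc[symmetric] del: transpose_matrix_vector)
      have "(\<integral>x. 1/2 * (x \<bullet> (P0 *v x) + (x - m) \<bullet> (S0 *v (x - m))) \<partial>gauss m \<Sigma>)
        = 1/2 * (m \<bullet> (P0 *v m) + trace (P0 ** \<Sigma>) + trace (S0 ** \<Sigma>))"
        using gauss_quadratic_form[OF \<Sigma>, of m P0] gauss_centered_quadratic_form[OF \<Sigma>, of m m S0]
        by simp
      then show ?thesis
        using tr unfolding c_def P0 by simp
    qed
    show ?case
      unfolding \<kappa>\<iota> mean_gauss[OF \<Sigma>] covariance_gauss[OF \<Sigma>] Let_def
      unfolding J_def[symmetric] M_def[symmetric]
      unfolding K_opt_def[symmetric] P0_def[symmetric] W_opt_def[symmetric] z0_def[symmetric]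
      unfolding u_opt_def[symmetric] S0_def[symmetric]
      unfolding \<mu>_opt_def[symmetric] optimal_value[symmetric]
      using saddle by blast
  qed
qed

end
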